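(* Let $R$ be an algebra over a commutative ring $\mathbb K$ and let $\mathcal B=(B,\xi,\zeta,\Delta,\epsilon)$ be a right bialgebroid over $R$. Let $C$ be a right $\mathcal B$-module coring with action $\triangleleft$, and let $X$ be a right $\mathcal B$-comodule with coaction $x\mapsto x^{[0]}\otimes_Rx^{[1]}$. Then $$w:C\otimes_RX\to X\otimes_RC,\qquad w(c\otimes_Rx):=x^{[0]}\otimes_Rc\triangleleft x^{[1]}$$ is a (dual) transposition map for the $R$-coring $C$. Hence the simplicial $\mathbb K$-module $C^{\widehat\otimes_R\,\ast+1}\widehat\otimes_RX$ admits a para-cyclic structure $$w_n(c_0\widehat\otimes_R\dots\widehat\otimes_Rc_n\widehat\otimes_Rx)=(c_n\triangleleft x^{[1]})\widehat\otimes_Rc_0\widehat\otimes_R\dots\widehat\otimes_Rc_{n-1}\widehat\otimes_Rx^{[0]}.$$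
   Context: All algebras are associative and unital; implicit summation is used in index notations. An $R$-coring is a coalgebra in the monoidal category of $R$-bimodules. Right bialgebroid over $R$: data $(B,\xi,\zeta,\Delta,\epsilon)$ with $B$ a $\mathbb K$-algebra, $\xi:R\to B$ and $\zeta:R^{op}\to B$ algebra maps with commuting ranges; $B$ is an $R$-bimodule by $r_1\cdot b\cdot r_2=b\,\zeta(r_1)\xi(r_2)$; $\Delta:B\to B\otimes_RB$, $b\mapsto b^{(1)}\otimes_Rb^{(2)}$, and $\epsilon:B\to R$ make this bimodule an $R$-coring; and (i) $\xi(r)b^{(1)}\otimes_Rb^{(2)}=b^{(1)}\otimes_R\zeta(r)b^{(2)}$; (ii) $\Delta(1_B)=1_B\otimes_R1_B$, $\Delta(bb')=b^{(1)}b'^{(1)}\otimes_Rb^{(2)}b'^{(2)}$; (iii) $\epsilon(1_B)=1_R$, $\epsilon(bb')=\epsilon(\xi(\epsilon(b))b')$. A right $\mathcal B$-module $V$ is an $R$-bimodule by $r_1\cdot v\cdot r_2=v\triangleleft(\zeta(r_1)\xi(r_2))$. A right $\mathcal B$-comodule is a right $R$-module $V$ with a right $R$-linear, coassociative and counital coaction $V\to V\otimes_R\mathcal B$, $v\mapsto v^{[0]}\otimes_Rv^{[1]}$; it is an $R$-bimodule with left action $r\cdot v:=v^{[0]}\cdot\epsilon(\xi(r)v^{[1]})$. A right $\mathcal B$-module coring is an $R$-coring $(C,\Delta_C,\epsilon_C)$, $\Delta_C(c)=c^{(1)}\otimes_Rc^{(2)}$, which is a right $\mathcal B$-module with the same underlying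 $R$-bimodule structure, such that $\epsilon_C(c\triangleleft b)=\epsilon(\xi(\epsilon_C(c))b)$ and $(c\triangleleft b)^{(1)}\otimes_R(c\triangleleft b)^{(2)}=c^{(1)}\triangleleft b^{(1)}\otimes_Rc^{(2)}\triangleleft b^{(2)}$ for $c\in C$, $b\in B$. (Dual) transposition map for an $R$-coring $C$ and an $R$-bimodule $X$: an $R$-bimodule map $w:C\otimes_RX\to X\otimes_RC$ with $(X\otimes_R\epsilon_C)\circ w=\epsilon_C\otimes_RX$ and $(X\otimes_R\Delta_C)\circ w=(w\otimes_RC)\circ(C\otimes_Rw)\circ(\Delta_C\otimes_RX)$. Cyclic tensor product: for $R$-bimodules, $X_1\widehat\otimes_R\dots\widehat\otimes_RX_n$ is the quotient $\mathbb K$-module of $Y=X_1\otimes_R\dots\otimes_RX_n$ by the submodule generated by $r\cdot y-y\cdot r$, $r\in R$, $y\in Y$; classes of tensor monomials are written $x_1\widehat\otimes_R\dots\widehat\otimes_Rx_n$. The simplicial $\mathbb K$-module $Z_n=C^{\widehat\otimes_R\,n+1}\widehat\otimes_RX$ has, for $0\le k\le n$, faces $d_k:Z_n\to Z_{n-1}$ applying $\epsilon_C$ to the factor $c_k$ (and absorbing the resulting element of $R$ via the $R$-actions) and degeneracies $s_k:Z_n\to Z_{n+1}$ applying $\Delta_C$ to the factor $c_k$. A para-cyclic structure on a simplicial object consists of morphisms $w_n:Z_n\to Z_n$ with $d_0w_n=d_n$, $d_kw_n=w_{n-1}d_{k-1}$, $s_0w_n=(w_{n+1})^2s_n$, $s_kw_n=w_{n+1}s_{k-1}$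 for $1\le k\le n$ (relations with faces for $n\ge1$). *)

theory Defs
  imports
    "HOL-Algebra.Module"
    "HOL-Algebra.AbelCoset"
    "HOL-Library.Poly_Mapping"
    "HOL-Computational_Algebra.Group_Closure"
begin

section \<open>Algebras and bimodules\<close>

text \<open>The library locale \<open>algebra\<close> is about commutative algebras, hence a separate notion.\<close>

locale assoc_algebra = module K A + ring A
  for K :: "'k ring" and A :: "('k, 'a) module" +
  assumes smult_mult_left:
    "\<lbrakk>k \<in> carrier K; a \<in> carrier A; b \<in> carrier A\<rbrakk>
      \<Longrightarrow> (k \<odot>\<^bsub>A\<^esub> a) \<otimes>\<^bsub>A\<^esub> b = k \<odot>\<^bsub>A\<^esub> (a \<otimes>\<^bsub>A\<^esub> b)"
    and smult_mult_right:
    "\<lbrakk>k \<in> carrier K; a \<in> carrier A; b \<in> carrier A\<rbrakk>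
      \<Longrightarrow> a \<otimes>\<^bsub>A\<^esub> (k \<odot>\<^bsub>A\<^esub> b) = k \<odot>\<^bsub>A\<^esub> (a \<otimes>\<^bsub>A\<^esub> b)"

definition op_algebra :: "('k, 'a) module \<Rightarrow> ('k, 'a) module" where
  "op_algebra A = A\<lparr>monoid.mult := (\<lambda>a b. b \<otimes>\<^bsub>A\<^esub> a)\<rparr>"

definition algebra_hom :: "'k ring \<Rightarrow> ('k, 'a) module \<Rightarrow> ('k, 'b) module \<Rightarrow> ('a \<Rightarrow> 'b) set" where
  "algebra_hom K A B = {h \<in> ring_hom A B.
     \<forall>k\<in>carrier K. \<forall>a\<in>carrier A. h (k \<odot>\<^bsub>A\<^esub> a) = k \<odot>\<^bsub>B\<^esub> h a}"

text \<open>The fields \<open>mult\<close> and \<open>one\<close> inherited from the ring record play no role for modules.\<close>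

record ('k, 'r, 'm) bimod = "('k, 'm) module" +
  lact :: "'r \<Rightarrow> 'm \<Rightarrow> 'm"
  ract :: "'m \<Rightarrow> 'r \<Rightarrow> 'm"

text \<open>Right modules are kept in the same record type; this locale does not look at \<open>lact\<close>.\<close>

locale right_module = R: assoc_algebra K R + module K V
  for K :: "'k ring" and R :: "('k, 'r) module" and V :: "('k, 'r, 'v) bimod" +
  assumes ract_closed: "\<lbrakk>v \<in> carrier V; r \<in> carrier R\<rbrakk> \<Longrightarrow> ract V v r \<in> carrier V"
    and ract_add_left: "\<lbrakk>v \<in> carrier V; v' \<in> carrier V; r \<in> carrier R\<rbrakk>
      \<Longrightarrow> ract V (v \<oplus>\<^bsub>V\<^esub> v') r = ract V v r \<oplus>\<^bsub>V\<^esub> ract V v' r"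
    and ract_add_right: "\<lbrakk>v \<in> carrier V; r \<in> carrier R; r' \<in> carrier R\<rbrakk>
      \<Longrightarrow> ract V v (r \<oplus>\<^bsub>R\<^esub> r') = ract V v r \<oplus>\<^bsub>V\<^esub> ract V v r'"
    and ract_mult: "\<lbrakk>v \<in> carrier V; r \<in> carrier R; r' \<in> carrier R\<rbrakk>
      \<Longrightarrow> ract V v (r \<otimes>\<^bsub>R\<^esub> r') = ract V (ract V v r) r'"
    and ract_one: "v \<in> carrier V \<Longrightarrow> ract V v \<one>\<^bsub>R\<^esub> = v"
    and ract_smult_left: "\<lbrakk>k \<in> carrier K; v \<in> carrier V; r \<in> carrier R\<rbrakk>
      \<Longrightarrow> ract V (k \<odot>\<^bsub>V\<^esub> v) r = k \<odot>\<^bsub>V\<^esub> ract V v r"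
    and ract_smult_right: "\<lbrakk>k \<in> carrier K; v \<in> carrier V; r \<in> carrier R\<rbrakk>
      \<Longrightarrow> ract V v (k \<odot>\<^bsub>R\<^esub> r) = k \<odot>\<^bsub>V\<^esub> ract V v r"

locale bimodule = right_module K R V
  for K :: "'k ring" and R :: "('k, 'r) module" and V :: "('k, 'r, 'v) bimod" +
  assumes lact_closed: "\<lbrakk>r \<in> carrier R; v \<in> carrier V\<rbrakk> \<Longrightarrow> lact V r v \<in> carrier V"
    and lact_add_right: "\<lbrakk>r \<in> carrier R; v \<in> carrier V; v' \<in> carrier V\<rbrakk>
      \<Longrightarrow> lact V r (v \<oplus>\<^bsub>V\<^esub> v') = lact V r v \<oplus>\<^bsub>V\<^esub> lact V r v'"
    and lact_add_left: "\<lbrakk>r \<in> carrier R; r' \<in> carrier R; v \<in> carrier V\<rbrakk>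
      \<Longrightarrow> lact V (r \<oplus>\<^bsub>R\<^esub> r') v = lact V r v \<oplus>\<^bsub>V\<^esub> lact V r' v"
    and lact_mult: "\<lbrakk>r \<in> carrier R; r' \<in> carrier R; v \<in> carrier V\<rbrakk>
      \<Longrightarrow> lact V (r \<otimes>\<^bsub>R\<^esub> r') v = lact V r (lact V r' v)"
    and lact_one: "v \<in> carrier V \<Longrightarrow> lact V \<one>\<^bsub>R\<^esub> v = v"
    and lact_smult_right: "\<lbrakk>k \<in> carrier K; r \<in> carrier R; v \<in> carrier V\<rbrakk>
      \<Longrightarrow> lact V r (k \<odot>\<^bsub>V\<^esub> v) = k \<odot>\<^bsub>V\<^esub> lact V r v"
    and lact_smult_left: "\<lbrakk>k \<in> carrier K; r \<in> carrier R; v \<in> carrier V\<rbrakk>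
      \<Longrightarrow> lact V (k \<odot>\<^bsub>R\<^esub> r) v = k \<odot>\<^bsub>V\<^esub> lact V r v"
    and lact_ract: "\<lbrakk>r \<in> carrier R; v \<in> carrier V; r' \<in> carrier R\<rbrakk>
      \<Longrightarrow> ract V (lact V r v) r' = lact V r (ract V v r')"

definition linear_maps ::
  "'k ring \<Rightarrow> ('k, 'm, 'p) module_scheme \<Rightarrow> ('k, 'n, 'q) module_scheme \<Rightarrow> ('m \<Rightarrow> 'n) set" where
  "linear_maps K M N = {f \<in> carrier M \<rightarrow> carrier N.
     (\<forall>x\<in>carrier M. \<forall>y\<in>carrier M. f (x \<oplus>\<^bsub>M\<^esub> y) = f x \<oplus>\<^bsub>N\<^esub> f y) \<and>
     (\<forall>k\<in>carrier K. \<forall>x\<in>carrier M. f (k \<odot>\<^bsub>M\<^esub> x) = k \<odot>\<^bsub>N\<^esub> f x)}"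

definition right_module_hom ::
  "'k ring \<Rightarrow> ('k, 'r) module \<Rightarrow> ('k, 'r, 'm) bimod \<Rightarrow> ('k, 'r, 'n) bimod \<Rightarrow> ('m \<Rightarrow> 'n) set" where
  "right_module_hom K R M N = {f \<in> linear_maps K M N.
     \<forall>x\<in>carrier M. \<forall>r\<in>carrier R. f (ract M x r) = ract N (f x) r}"

definition bimodule_hom ::
  "'k ring \<Rightarrow> ('k, 'r) module \<Rightarrow> ('k, 'r, 'm) bimod \<Rightarrow> ('k, 'r, 'n) bimod \<Rightarrow> ('m \<Rightarrow> 'n) set" where
  "bimodule_hom K R M N = {f \<in> right_module_hom K R M N.
     \<forall>r\<in>carrier R. \<forall>x\<in>carrier M. f (lact M r x) = lact N r (f x)}"

definition regular_bimod :: "('k, 'r) module \<Rightarrow> ('k, 'r, 'r) bimod" where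
  "regular_bimod R = module.extend R
     (bimod.fields (\<lambda>r x. r \<otimes>\<^bsub>R\<^esub> x) (\<lambda>x r. x \<otimes>\<^bsub>R\<^esub> r))"


section \<open>Tensor products\<close>

text \<open>Tensor products are presented abelian groups: an element is a coset of formal
  \<open>\<int>\<close>-linear combinations of tensor monomials modulo the group generated by the relations.\<close>

definition pres_coset :: "('w \<Rightarrow>\<^sub>0 int) set \<Rightarrow> ('w \<Rightarrow>\<^sub>0 int) \<Rightarrow> ('w \<Rightarrow>\<^sub>0 int) set" where
  "pres_coset rels s = {t. t - s \<in> group_closure rels}"

definition some_rep :: "'a set \<Rightarrow> 'a" where
  "some_rep S = (SOME s. s \<in> S)"

text \<open>\<open>pres_lift P f\<close> is the additive map into \<open>P\<close> sending the class of a monomial \<open>w\<close> to \<open>f w\<close>.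
  It is evaluated on a chosen representative, and is meant to be used where the result does not
  depend on that choice. In particular \<open>pres_lift P (\<lambda>(a, b). g a b) (\<Delta> c)\<close> is
  the Sweedler expression \<open>g (c\<^sup>(\<^sup>1\<^sup>)) (c\<^sup>(\<^sup>2\<^sup>))\<close>.\<close>

definition pres_lift :: "('p, 'q) ring_scheme \<Rightarrow> ('w \<Rightarrow> 'p) \<Rightarrow> ('w \<Rightarrow>\<^sub>0 int) set \<Rightarrow> 'p" where
  "pres_lift P f S =
     (\<Oplus>\<^bsub>P\<^esub>w \<in> Poly_Mapping.keys (some_rep S). [Poly_Mapping.lookup (some_rep S) w] \<cdot>\<^bsub>P\<^esub> f w)"

definition tensor_rels ::
  "('k, 'r) module \<Rightarrow> ('k, 'r, 'm) bimod \<Rightarrow> ('k, 'r, 'n) bimod \<Rightarrow> ('m \<times> 'n \<Rightarrow>\<^sub>0 int) set" where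
  "tensor_rels R M N =
     {frag_of (m \<oplus>\<^bsub>M\<^esub> m', n) - frag_of (m, n) - frag_of (m', n) | m m' n.
        m \<in> carrier M \<and> m' \<in> carrier M \<and> n \<in> carrier N} \<union>
     {frag_of (m, n \<oplus>\<^bsub>N\<^esub> n') - frag_of (m, n) - frag_of (m, n') | m n n'.
        m \<in> carrier M \<and> n \<in> carrier N \<and> n' \<in> carrier N} \<union>
     {frag_of (ract M m r, n) - frag_of (m, lact N r n) | m r n.
        m \<in> carrier M \<and> r \<in> carrier R \<and> n \<in> carrier N}"

definition tensor ::
  "('k, 'r) module \<Rightarrow> ('k, 'r, 'm) bimod \<Rightarrow> ('k, 'r, 'n) bimod
    \<Rightarrow> ('k, 'r, ('m \<times> 'n \<Rightarrow>\<^sub>0 int) set) bimod" where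
  "tensor R M N = (let cl = pres_coset (tensor_rels R M N) in
     \<lparr>carrier = cl ` {s. Poly_Mapping.keys s \<subseteq> carrier M \<times> carrier N},
      monoid.mult = undefined, one = undefined,
      zero = cl 0,
      add = (\<lambda>S T. cl (some_rep S + some_rep T)),
      smult = (\<lambda>k S. cl (frag_extend (\<lambda>(m, n). frag_of (k \<odot>\<^bsub>M\<^esub> m, n)) (some_rep S))),
      lact = (\<lambda>r S. cl (frag_extend (\<lambda>(m, n). frag_of (lact M r m, n)) (some_rep S))),
      ract = (\<lambda>S r. cl (frag_extend (\<lambda>(m, n). frag_of (m, ract N n r)) (some_rep S)))\<rparr>)"

definition tens ::
  "('k, 'r) module \<Rightarrow> ('k, 'r, 'm) bimod \<Rightarrow> ('k, 'r, 'n) bimod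
    \<Rightarrow> 'm \<Rightarrow> 'n \<Rightarrow> ('m \<times> 'n \<Rightarrow>\<^sub>0 int) set" where
  "tens R M N m n = pres_coset (tensor_rels R M N) (frag_of (m, n))"

text \<open>\<open>tensor_map R M' N' f g\<close> is \<open>f \<otimes>\<^sub>R g\<close>; only the codomain \<open>M' \<otimes>\<^sub>R N'\<close> enters the formula.\<close>

definition tensor_map ::
  "('k, 'r) module \<Rightarrow> ('k, 'r, 'm2) bimod \<Rightarrow> ('k, 'r, 'n2) bimod \<Rightarrow> ('m \<Rightarrow> 'm2) \<Rightarrow> ('n \<Rightarrow> 'n2)
    \<Rightarrow> ('m \<times> 'n \<Rightarrow>\<^sub>0 int) set \<Rightarrow> ('m2 \<times> 'n2 \<Rightarrow>\<^sub>0 int) set" where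
  "tensor_map R M' N' f g = pres_lift (tensor R M' N') (\<lambda>(m, n). tens R M' N' (f m) (g n))"

text \<open>Associativity constraint \<open>(L \<otimes>\<^sub>R M) \<otimes>\<^sub>R N \<rightarrow> L \<otimes>\<^sub>R (M \<otimes>\<^sub>R N)\<close> and its inverse.\<close>

definition tensor_assoc ::
  "('k, 'r) module \<Rightarrow> ('k, 'r, 'l) bimod \<Rightarrow> ('k, 'r, 'm) bimod \<Rightarrow> ('k, 'r, 'n) bimod
    \<Rightarrow> (('l \<times> 'm \<Rightarrow>\<^sub>0 int) set \<times> 'n \<Rightarrow>\<^sub>0 int) set \<Rightarrow> ('l \<times> ('m \<times> 'n \<Rightarrow>\<^sub>0 int) set \<Rightarrow>\<^sub>0 int) set" where
  "tensor_assoc R L M N = (let P = tensor R L (tensor R M N) in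
     pres_lift P (\<lambda>(S, n). pres_lift P (\<lambda>(l, m). tens R L (tensor R M N) l (tens R M N m n)) S))"

definition tensor_assoc_inv ::
  "('k, 'r) module \<Rightarrow> ('k, 'r, 'l) bimod \<Rightarrow> ('k, 'r, 'm) bimod \<Rightarrow> ('k, 'r, 'n) bimod
    \<Rightarrow> ('l \<times> ('m \<times> 'n \<Rightarrow>\<^sub>0 int) set \<Rightarrow>\<^sub>0 int) set \<Rightarrow> (('l \<times> 'm \<Rightarrow>\<^sub>0 int) set \<times> 'n \<Rightarrow>\<^sub>0 int) set" where
  "tensor_assoc_inv R L M N = (let P = tensor R (tensor R L M) N in
     pres_lift P (\<lambda>(l, S). pres_lift P (\<lambda>(m, n). tens R (tensor R L M) N (tens R L M l m) n) S))"


section \<open>Corings and bialgebroids\<close>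

text \<open>In the counit laws the canonical isomorphisms \<open>R \<otimes>\<^sub>R C \<cong> C \<cong> C \<otimes>\<^sub>R R\<close> are composed in.\<close>

locale coring = bimodule K R C
  for K :: "'k ring" and R :: "('k, 'r) module" and C :: "('k, 'r, 'c) bimod"
    and \<Delta> :: "'c \<Rightarrow> ('c \<times> 'c \<Rightarrow>\<^sub>0 int) set" and \<epsilon> :: "'c \<Rightarrow> 'r" +
  assumes comult_hom: "\<Delta> \<in> bimodule_hom K R C (tensor R C C)"
    and counit_hom: "\<epsilon> \<in> bimodule_hom K R C (regular_bimod R)"
    and coassoc: "c \<in> carrier C \<Longrightarrow>
      tensor_assoc R C C C (tensor_map R (tensor R C C) C \<Delta> (\<lambda>c. c) (\<Delta> c)) =
      tensor_map R C (tensor R C C) (\<lambda>c. c) \<Delta> (\<Delta> c)"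
    and counit_left: "c \<in> carrier C \<Longrightarrow> pres_lift C (\<lambda>(a, b). lact C (\<epsilon> a) b) (\<Delta> c) = c"
    and counit_right: "c \<in> carrier C \<Longrightarrow> pres_lift C (\<lambda>(a, b). ract C a (\<epsilon> b)) (\<Delta> c) = c"

definition bialgebroid_bimod ::
  "('k, 'b) module \<Rightarrow> ('r \<Rightarrow> 'b) \<Rightarrow> ('r \<Rightarrow> 'b) \<Rightarrow> ('k, 'r, 'b) bimod" where
  "bialgebroid_bimod B \<xi> \<zeta> = module.extend B
     (bimod.fields (\<lambda>r b. b \<otimes>\<^bsub>B\<^esub> \<zeta> r) (\<lambda>b r. b \<otimes>\<^bsub>B\<^esub> \<xi> r))"

text \<open>The product of the two Sweedler expressions in \<open>comult_mult\<close> exists only by virtue of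
  \<open>takeuchi\<close>. For fixed \<open>u\<close>, \<open>v\<close> the inner expression is balanced in
  \<open>(p, q)\<close>; by \<open>takeuchi\<close> for \<open>b'\<close> the result is balanced in \<open>(u, v)\<close>. The order of the two
  lifts therefore matters, here and in \<open>module_coring\<close>.\<close>

locale right_bialgebroid =
  R: assoc_algebra K R + B: assoc_algebra K B + coring K R "bialgebroid_bimod B \<xi> \<zeta>" \<Delta> \<epsilon>
  for K :: "'k ring" and R :: "('k, 'r) module" and B :: "('k, 'b) module"
    and \<xi> :: "'r \<Rightarrow> 'b" and \<zeta> :: "'r \<Rightarrow> 'b"
    and \<Delta> :: "'b \<Rightarrow> ('b \<times> 'b \<Rightarrow>\<^sub>0 int) set" and \<epsilon> :: "'b \<Rightarrow> 'r" +
  assumes source_hom: "\<xi> \<in> algebra_hom K R B"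
    and target_hom: "\<zeta> \<in> algebra_hom K (op_algebra R) B"
    and source_target_commute: "\<lbrakk>r \<in> carrier R; r' \<in> carrier R\<rbrakk>
      \<Longrightarrow> \<xi> r \<otimes>\<^bsub>B\<^esub> \<zeta> r' = \<zeta> r' \<otimes>\<^bsub>B\<^esub> \<xi> r"
    and takeuchi: "\<lbrakk>r \<in> carrier R; b \<in> carrier B\<rbrakk> \<Longrightarrow>
      (let BB = bialgebroid_bimod B \<xi> \<zeta> in
      pres_lift (tensor R BB BB) (\<lambda>(u, v). tens R BB BB (\<xi> r \<otimes>\<^bsub>B\<^esub> u) v) (\<Delta> b) =
      pres_lift (tensor R BB BB) (\<lambda>(u, v). tens R BB BB u (\<zeta> r \<otimes>\<^bsub>B\<^esub> v)) (\<Delta> b))"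
    and comult_one: "\<Delta> \<one>\<^bsub>B\<^esub> = tens R (bialgebroid_bimod B \<xi> \<zeta>) (bialgebroid_bimod B \<xi> \<zeta>) \<one>\<^bsub>B\<^esub> \<one>\<^bsub>B\<^esub>"
    and comult_mult: "\<lbrakk>b \<in> carrier B; b' \<in> carrier B\<rbrakk> \<Longrightarrow>
      (let BB = bialgebroid_bimod B \<xi> \<zeta> in
      \<Delta> (b \<otimes>\<^bsub>B\<^esub> b') =
      pres_lift (tensor R BB BB) (\<lambda>(u, v). pres_lift (tensor R BB BB)
        (\<lambda>(p, q). tens R BB BB (u \<otimes>\<^bsub>B\<^esub> p) (v \<otimes>\<^bsub>B\<^esub> q)) (\<Delta> b')) (\<Delta> b))"
    and counit_one: "\<epsilon> \<one>\<^bsub>B\<^esub> = \<one>\<^bsub>R\<^esub>"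
    and counit_mult: "\<lbrakk>b \<in> carrier B; b' \<in> carrier B\<rbrakk> \<Longrightarrow>
      \<epsilon> (b \<otimes>\<^bsub>B\<^esub> b') = \<epsilon> (\<xi> (\<epsilon> b) \<otimes>\<^bsub>B\<^esub> b')"

locale module_coring =
  right_bialgebroid K R B \<xi> \<zeta> \<Delta> \<epsilon> + C: coring K R C \<Delta>C \<epsilon>C
  for K :: "'k ring" and R :: "('k, 'r) module" and B :: "('k, 'b) module"
    and \<xi> \<zeta> \<Delta> \<epsilon> and C :: "('k, 'r, 'c) bimod"
    and \<Delta>C :: "'c \<Rightarrow> ('c \<times> 'c \<Rightarrow>\<^sub>0 int) set" and \<epsilon>C :: "'c \<Rightarrow> 'r" +
  fixes act :: "'c \<Rightarrow> 'b \<Rightarrow> 'c"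
  assumes act_closed: "\<lbrakk>c \<in> carrier C; b \<in> carrier B\<rbrakk> \<Longrightarrow> act c b \<in> carrier C"
    and act_add_left: "\<lbrakk>c \<in> carrier C; c' \<in> carrier C; b \<in> carrier B\<rbrakk>
      \<Longrightarrow> act (c \<oplus>\<^bsub>C\<^esub> c') b = act c b \<oplus>\<^bsub>C\<^esub> act c' b"
    and act_add_right: "\<lbrakk>c \<in> carrier C; b \<in> carrier B; b' \<in> carrier B\<rbrakk>
      \<Longrightarrow> act c (b \<oplus>\<^bsub>B\<^esub> b') = act c b \<oplus>\<^bsub>C\<^esub> act c b'"
    and act_smult_left: "\<lbrakk>k \<in> carrier K; c \<in> carrier C; b \<in> carrier B\<rbrakk>
      \<Longrightarrow> act (k \<odot>\<^bsub>C\<^esub> c) b = k \<odot>\<^bsub>C\<^esub> act c b"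
    and act_smult_right: "\<lbrakk>k \<in> carrier K; c \<in> carrier C; b \<in> carrier B\<rbrakk>
      \<Longrightarrow> act c (k \<odot>\<^bsub>B\<^esub> b) = k \<odot>\<^bsub>C\<^esub> act c b"
    and act_mult: "\<lbrakk>c \<in> carrier C; b \<in> carrier B; b' \<in> carrier B\<rbrakk>
      \<Longrightarrow> act c (b \<otimes>\<^bsub>B\<^esub> b') = act (act c b) b'"
    and act_one: "c \<in> carrier C \<Longrightarrow> act c \<one>\<^bsub>B\<^esub> = c"
    and lact_eq: "\<lbrakk>r \<in> carrier R; c \<in> carrier C\<rbrakk> \<Longrightarrow> lact C r c = act c (\<zeta> r)"
    and ract_eq: "\<lbrakk>r \<in> carrier R; c \<in> carrier C\<rbrakk> \<Longrightarrow> ract C c r = act c (\<xi> r)"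
    and counit_act: "\<lbrakk>c \<in> carrier C; b \<in> carrier B\<rbrakk> \<Longrightarrow>
      \<epsilon>C (act c b) = \<epsilon> (\<xi> (\<epsilon>C c) \<otimes>\<^bsub>B\<^esub> b)"
    and comult_act: "\<lbrakk>c \<in> carrier C; b \<in> carrier B\<rbrakk> \<Longrightarrow>
      \<Delta>C (act c b) =
      pres_lift (tensor R C C) (\<lambda>(u, v). pres_lift (tensor R C C)
        (\<lambda>(p, q). tens R C C (act u p) (act v q)) (\<Delta> b)) (\<Delta>C c)"

text \<open>Only the right \<open>R\<close>-module structure of \<open>V\<close> and the coaction are data: the left
  action is given by \<open>lact_eq\<close>, and \<open>V \<otimes>\<^sub>R B\<close> does not use it.\<close>

locale right_comodule = right_bialgebroid K R B \<xi> \<zeta> \<Delta> \<epsilon> + V: right_module K R V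
  for K :: "'k ring" and R :: "('k, 'r) module" and B :: "('k, 'b) module"
    and \<xi> \<zeta> \<Delta> \<epsilon> and V :: "('k, 'r, 'v) bimod" +
  fixes \<rho> :: "'v \<Rightarrow> ('v \<times> 'b \<Rightarrow>\<^sub>0 int) set"
  assumes coaction_hom: "\<rho> \<in> right_module_hom K R V (tensor R V (bialgebroid_bimod B \<xi> \<zeta>))"
    and coaction_coassoc: "v \<in> carrier V \<Longrightarrow> (let BB = bialgebroid_bimod B \<xi> \<zeta> in
      tensor_assoc R V BB BB (tensor_map R (tensor R V BB) BB \<rho> (\<lambda>b. b) (\<rho> v)) =
      tensor_map R V (tensor R BB BB) (\<lambda>v. v) \<Delta> (\<rho> v))"
    and coaction_counit: "v \<in> carrier V \<Longrightarrow> pres_lift V (\<lambda>(u, b). ract V u (\<epsilon> b)) (\<rho> v) = v"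
    and lact_eq: "\<lbrakk>r \<in> carrier R; v \<in> carrier V\<rbrakk> \<Longrightarrow>
      lact V r v = pres_lift V (\<lambda>(u, b). ract V u (\<epsilon> (\<xi> r \<otimes>\<^bsub>B\<^esub> b))) (\<rho> v)"


section \<open>Transposition maps\<close>

text \<open>The left hand side of \<open>comult\<close> lies in \<open>X \<otimes>\<^sub>R (C \<otimes>\<^sub>R C)\<close>; associativity constraints are
  inserted on the right hand side accordingly.\<close>

locale dual_transposition = C: coring K R C \<Delta> \<epsilon> + X: bimodule K R X
  for K :: "'k ring" and R :: "('k, 'r) module" and C :: "('k, 'r, 'c) bimod"
    and \<Delta> :: "'c \<Rightarrow> ('c \<times> 'c \<Rightarrow>\<^sub>0 int) set" and \<epsilon> :: "'c \<Rightarrow> 'r"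
    and X :: "('k, 'r, 'x) bimod" +
  fixes w :: "('c \<times> 'x \<Rightarrow>\<^sub>0 int) set \<Rightarrow> ('x \<times> 'c \<Rightarrow>\<^sub>0 int) set"
  assumes hom: "w \<in> bimodule_hom K R (tensor R C X) (tensor R X C)"
    and counit: "t \<in> carrier (tensor R C X) \<Longrightarrow>
      pres_lift X (\<lambda>(x, c). ract X x (\<epsilon> c)) (w t) = pres_lift X (\<lambda>(c, x). lact X (\<epsilon> c) x) t"
    and comult: "t \<in> carrier (tensor R C X) \<Longrightarrow>
      tensor_map R X (tensor R C C) (\<lambda>x. x) \<Delta> (w t) =
      (tensor_assoc R X C C
       \<circ> tensor_map R (tensor R X C) C w (\<lambda>c. c)
       \<circ> tensor_assoc_inv R C X C
       \<circ> tensor_map R C (tensor R X C) (\<lambda>c. c) w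
       \<circ> tensor_assoc R C C X
       \<circ> tensor_map R (tensor R C C) X \<Delta> (\<lambda>x. x)) t"


section \<open>The simplicial module of cyclic tensor products\<close>

text \<open>\<open>C\<^sup>\<otimes>\<^sup>n\<^sup>+\<^sup>1 \<otimes>\<^sub>R X\<close> is presented on monomials \<open>(cs, x)\<close> with \<open>cs\<close> a list of length \<open>n + 1\<close>, since
  an iteration of \<open>tensor\<close> would change the type with \<open>n\<close>.\<close>

definition multi_tensor_rels ::
  "('k, 'r) module \<Rightarrow> ('k, 'r, 'c) bimod \<Rightarrow> ('k, 'r, 'x) bimod \<Rightarrow> nat \<Rightarrow> ('c list \<times> 'x \<Rightarrow>\<^sub>0 int) set" where
  "multi_tensor_rels R C X n =
     {frag_of (us @ (a \<oplus>\<^bsub>C\<^esub> b) # vs, x) - frag_of (us @ a # vs, x) - frag_of (us @ b # vs, x)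
       | us a b vs x. length us + length vs = n \<and> set us \<subseteq> carrier C \<and> set vs \<subseteq> carrier C \<and>
           a \<in> carrier C \<and> b \<in> carrier C \<and> x \<in> carrier X} \<union>
     {frag_of (cs, x \<oplus>\<^bsub>X\<^esub> y) - frag_of (cs, x) - frag_of (cs, y)
       | cs x y. length cs = Suc n \<and> set cs \<subseteq> carrier C \<and> x \<in> carrier X \<and> y \<in> carrier X} \<union>
     {frag_of (us @ ract C a r # b # vs, x) - frag_of (us @ a # lact C r b # vs, x)
       | us a r b vs x. Suc (length us + length vs) = n \<and> set us \<subseteq> carrier C \<and> set vs \<subseteq> carrier C \<and>
           a \<in> carrier C \<and> r \<in> carrier R \<and> b \<in> carrier C \<and> x \<in> carrier X} \<union>
     {frag_of (us @ [ract C a r], x) - frag_of (us @ [a], lact X r x)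
       | us a r x. length us = n \<and> set us \<subseteq> carrier C \<and>
           a \<in> carrier C \<and> r \<in> carrier R \<and> x \<in> carrier X}"

definition multi_tensor ::
  "('k, 'r) module \<Rightarrow> ('k, 'r, 'c) bimod \<Rightarrow> ('k, 'r, 'x) bimod \<Rightarrow> nat
    \<Rightarrow> ('k, 'r, ('c list \<times> 'x \<Rightarrow>\<^sub>0 int) set) bimod" where
  "multi_tensor R C X n = (let cl = pres_coset (multi_tensor_rels R C X n) in
     \<lparr>carrier = cl ` {s. Poly_Mapping.keys s \<subseteq>
        {cs. length cs = Suc n \<and> set cs \<subseteq> carrier C} \<times> carrier X},
      monoid.mult = undefined, one = undefined,
      zero = cl 0,
      add = (\<lambda>S T. cl (some_rep S + some_rep T)),
      smult = (\<lambda>k S. cl (frag_extend (\<lambda>(cs, x). frag_of (cs, k \<odot>\<^bsub>X\<^esub> x)) (some_rep S))),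
      lact = (\<lambda>r S. cl (frag_extend (\<lambda>(cs, x). frag_of (lact C r (hd cs) # tl cs, x)) (some_rep S))),
      ract = (\<lambda>S r. cl (frag_extend (\<lambda>(cs, x). frag_of (cs, ract X x r)) (some_rep S)))\<rparr>)"

definition commutator_submodule :: "'k ring \<Rightarrow> ('k, 'r) module \<Rightarrow> ('k, 'r, 'y) bimod \<Rightarrow> 'y set" where
  "commutator_submodule K R Y = \<Inter>{N. submodule N K Y \<and>
     (\<forall>r\<in>carrier R. \<forall>y\<in>carrier Y. lact Y r y \<ominus>\<^bsub>Y\<^esub> ract Y y r \<in> N)}"

definition cyclic_quotient ::
  "'k ring \<Rightarrow> ('k, 'r) module \<Rightarrow> ('k, 'r, 'y) bimod \<Rightarrow> ('k, 'y set) module" where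
  "cyclic_quotient K R Y = (let N = commutator_submodule K R Y in
     \<lparr>carrier = a_rcosets\<^bsub>Y\<^esub> N,
      monoid.mult = undefined, one = undefined,
      zero = N,
      add = (\<lambda>S T. S <+>\<^bsub>Y\<^esub> T),
      smult = (\<lambda>k S. \<Union>y\<in>S. N +>\<^bsub>Y\<^esub> (k \<odot>\<^bsub>Y\<^esub> y))\<rparr>)"

definition cyc ::
  "'k ring \<Rightarrow> ('k, 'r) module \<Rightarrow> ('k, 'r, 'c) bimod \<Rightarrow> ('k, 'r, 'x) bimod \<Rightarrow> nat
    \<Rightarrow> ('k, ('c list \<times> 'x \<Rightarrow>\<^sub>0 int) set set) module" where
  "cyc K R C X n = cyclic_quotient K R (multi_tensor R C X n)"

definition cyc_tens ::
  "'k ring \<Rightarrow> ('k, 'r) module \<Rightarrow> ('k, 'r, 'c) bimod \<Rightarrow> ('k, 'r, 'x) bimod \<Rightarrow> nat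
    \<Rightarrow> 'c list \<Rightarrow> 'x \<Rightarrow> ('c list \<times> 'x \<Rightarrow>\<^sub>0 int) set set" where
  "cyc_tens K R C X n cs x = (let Y = multi_tensor R C X n in
     commutator_submodule K R Y +>\<^bsub>Y\<^esub> pres_coset (multi_tensor_rels R C X n) (frag_of (cs, x)))"

text \<open>The additive map out of \<open>cyc K R C X n\<close> given by \<open>f\<close> on classes of monomials.\<close>

definition cyc_lift ::
  "('p, 'q) ring_scheme \<Rightarrow> ('c list \<times> 'x \<Rightarrow> 'p) \<Rightarrow> ('c list \<times> 'x \<Rightarrow>\<^sub>0 int) set set \<Rightarrow> 'p" where
  "cyc_lift P f S = pres_lift P f (some_rep S)"

text \<open>\<open>cyc_face \<dots> n k\<close> is \<open>d\<^sub>k : Z\<^sub>n \<rightarrow> Z\<^sub>n\<^sub>-\<^sub>1\<close>, for \<open>k \<le> n\<close> and \<open>n \<ge> 1\<close>; the scalar \<open>\<epsilon> c\<^sub>k\<close> is absorbed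
  by the factor to the right of \<open>c\<^sub>k\<close>.\<close>

definition cyc_face ::
  "'k ring \<Rightarrow> ('k, 'r) module \<Rightarrow> ('k, 'r, 'c) bimod \<Rightarrow> ('c \<Rightarrow> 'r) \<Rightarrow> ('k, 'r, 'x) bimod \<Rightarrow> nat \<Rightarrow> nat
    \<Rightarrow> ('c list \<times> 'x \<Rightarrow>\<^sub>0 int) set set \<Rightarrow> ('c list \<times> 'x \<Rightarrow>\<^sub>0 int) set set" where
  "cyc_face K R C \<epsilon> X n k = cyc_lift (cyc K R C X (n - 1)) (\<lambda>(cs, x).
     if k < n
     then cyc_tens K R C X (n - 1)
            (take k cs @ lact C (\<epsilon> (cs ! k)) (cs ! Suc k) # drop (Suc (Suc k)) cs) x
     else cyc_tens K R C X (n - 1) (take k cs) (lact X (\<epsilon> (cs ! k)) x))"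

definition cyc_degeneracy ::
  "'k ring \<Rightarrow> ('k, 'r) module \<Rightarrow> ('k, 'r, 'c) bimod \<Rightarrow> ('c \<Rightarrow> ('c \<times> 'c \<Rightarrow>\<^sub>0 int) set)
    \<Rightarrow> ('k, 'r, 'x) bimod \<Rightarrow> nat \<Rightarrow> nat
    \<Rightarrow> ('c list \<times> 'x \<Rightarrow>\<^sub>0 int) set set \<Rightarrow> ('c list \<times> 'x \<Rightarrow>\<^sub>0 int) set set" where
  "cyc_degeneracy K R C \<Delta> X n k = (let Z = cyc K R C X (Suc n) in
     cyc_lift Z (\<lambda>(cs, x). pres_lift Z
       (\<lambda>(a, b). cyc_tens K R C X (Suc n) (take k cs @ a # b # drop (Suc k) cs) x) (\<Delta> (cs ! k))))"

locale simplicial_module =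
  fixes K :: "'k ring" and Z :: "nat \<Rightarrow> ('k, 'z) module"
    and d :: "nat \<Rightarrow> nat \<Rightarrow> 'z \<Rightarrow> 'z" and s :: "nat \<Rightarrow> nat \<Rightarrow> 'z \<Rightarrow> 'z"
  assumes module: "module K (Z n)"
    and face_linear: "k \<le> Suc n \<Longrightarrow> d (Suc n) k \<in> linear_maps K (Z (Suc n)) (Z n)"
    and degeneracy_linear: "k \<le> n \<Longrightarrow> s n k \<in> linear_maps K (Z n) (Z (Suc n))"
    and face_face: "\<lbrakk>i < j; j \<le> Suc (Suc n); z \<in> carrier (Z (Suc (Suc n)))\<rbrakk>
      \<Longrightarrow> d (Suc n) i (d (Suc (Suc n)) j z) = d (Suc n) (j - 1) (d (Suc (Suc n)) i z)"
    and degeneracy_degeneracy: "\<lbrakk>i \<le> j; j \<le> n; z \<in> carrier (Z n)\<rbrakk>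
      \<Longrightarrow> s (Suc n) i (s n j z) = s (Suc n) (Suc j) (s n i z)"
    and face_degeneracy_less: "\<lbrakk>i < j; j \<le> Suc n; z \<in> carrier (Z (Suc n))\<rbrakk>
      \<Longrightarrow> d (Suc (Suc n)) i (s (Suc n) j z) = s n (j - 1) (d (Suc n) i z)"
    and face_degeneracy_id: "\<lbrakk>i = j \<or> i = Suc j; j \<le> n; z \<in> carrier (Z n)\<rbrakk>
      \<Longrightarrow> d (Suc n) i (s n j z) = z"
    and face_degeneracy_greater: "\<lbrakk>Suc j < i; i \<le> Suc (Suc n); z \<in> carrier (Z (Suc n))\<rbrakk>
      \<Longrightarrow> d (Suc (Suc n)) i (s (Suc n) j z) = s n j (d (Suc n) (i - 1) z)"

locale para_cyclic_structure = simplicial_module K Z d s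
  for K :: "'k ring" and Z :: "nat \<Rightarrow> ('k, 'z) module" and d s +
  fixes w :: "nat \<Rightarrow> 'z \<Rightarrow> 'z"
  assumes w_linear: "w n \<in> linear_maps K (Z n) (Z n)"
    and face_zero: "\<lbrakk>n \<ge> 1; z \<in> carrier (Z n)\<rbrakk> \<Longrightarrow> d n 0 (w n z) = d n n z"
    and face_w: "\<lbrakk>1 \<le> k; k \<le> n; z \<in> carrier (Z n)\<rbrakk> \<Longrightarrow> d n k (w n z) = w (n - 1) (d n (k - 1) z)"
    and degeneracy_zero: "z \<in> carrier (Z n) \<Longrightarrow> s n 0 (w n z) = w (Suc n) (w (Suc n) (s n n z))"
    and degeneracy_w: "\<lbrakk>1 \<le> k; k \<le> n; z \<in> carrier (Z n)\<rbrakk>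
      \<Longrightarrow> s n k (w n z) = w (Suc n) (s n (k - 1) z)"

end

theory Submission
  imports Defs
begin

text \<open>The left action \<open>r x = x\<^sup>[\<^sup>0\<^sup>] \<epsilon>(\<xi>(r) x\<^sup>[\<^sup>1\<^sup>])\<close> on a comodule satisfies \<open>\<rho>(r x) = x\<^sup>[\<^sup>0\<^sup>] \<otimes> \<xi>(r) x\<^sup>[\<^sup>1\<^sup>]\<close> and
  \<open>r x\<^sup>[\<^sup>0\<^sup>] \<otimes> x\<^sup>[\<^sup>1\<^sup>] = x\<^sup>[\<^sup>0\<^sup>] \<otimes> \<zeta>(r) x\<^sup>[\<^sup>1\<^sup>]\<close>; the first uses \<open>\<Delta>(\<xi>(r) b) = b\<^sup>(\<^sup>1\<^sup>) \<otimes> \<xi>(r) b\<^sup>(\<^sup>2\<^sup>)\<close> and the counit, the second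
  Takeuchi's condition and the counit. These two identities give that \<open>X\<close> is a bimodule, that
  \<open>c \<otimes> x \<mapsto> x\<^sup>[\<^sup>0\<^sup>] \<otimes> c x\<^sup>[\<^sup>1\<^sup>]\<close> is well defined and bilinear over \<open>R\<close>, and that the operators \<open>w\<^sub>n\<close> are well
  defined on cyclic tensor products. Compatibility with the comultiplication is
  \<open>x\<^sup>[\<^sup>0\<^sup>] \<otimes> \<Delta>(c x\<^sup>[\<^sup>1\<^sup>]) = x\<^sup>[\<^sup>0\<^sup>]\<^sup>[\<^sup>0\<^sup>] \<otimes> c\<^sup>(\<^sup>1\<^sup>) x\<^sup>[\<^sup>0\<^sup>]\<^sup>[\<^sup>1\<^sup>] \<otimes> c\<^sup>(\<^sup>2\<^sup>) x\<^sup>[\<^sup>1\<^sup>]\<close>, which follows from the module coring axiom and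
  coassociativity of the coaction; it yields both the comultiplication law of the transposition map and
  \<open>s\<^sub>0 w\<^sub>n = w\<^sub>n\<^sub>+\<^sub>1\<^sup>2 s\<^sub>n\<close>.

  Maps out of a (cyclic) tensor product are handled through the functions on monomials that induce them.
  Such a function of a list is multibalanced iff it is so in the tail for every head, and linear and balanced
  in the head; this turns faces, degeneracies and the simplicial identities into inductions along the list.\<close>

section \<open>Presented abelian groups\<close>

text \<open>Sweedler expressions are evaluated on chosen representatives, so the recurring obstacle
  is well-definedness: an expression may be computed on a tensor monomial only after it is known to
  be balanced over \<open>R\<close>. Additivity is enough for this, so lifts are treated as additive
  maps and scalars separately. The identities are stated for an arbitrary balanced function
  \<open>g\<close> into an arbitrary abelian group. One computation then serves the transposition
  map, where \<open>g\<close> is the tensor symbol, and the cyclic operators, where \<open>g\<close>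
  puts its second argument at the front of a list. In the second case \<open>g\<close> is balanced
  because commutators have been divided out: a left scalar on the front factor equals a right scalar
  on the coefficient. The same relation turns the counit identity
  \<open>x0 \<epsilon>C(c x1) = \<epsilon>C(c) x\<close> into \<open>d_0 w_n = d_n\<close>. Since
  the laws of the left action on \<open>X\<close> are themselves to be proved,
  \<open>X \<otimes> B\<close> and the rules for the coaction have to be set up with only the right
  module structure of \<open>X\<close>; hence tensor products ask as little as possible of their
  left factor.\<close>

definition additive_maps :: "('a, 'm) ring_scheme \<Rightarrow> ('b, 'n) ring_scheme \<Rightarrow> ('a \<Rightarrow> 'b) set" where
  "additive_maps A A' = {h \<in> carrier A \<rightarrow> carrier A'.
     \<forall>x\<in>carrier A. \<forall>y\<in>carrier A. h (x \<oplus>\<^bsub>A\<^esub> y) = h x \<oplus>\<^bsub>A'\<^esub> h y}"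

lemma additive_mapsI:
  assumes "\<And>x. x \<in> carrier A \<Longrightarrow> h x \<in> carrier A'"
    and "\<And>x y. \<lbrakk>x \<in> carrier A; y \<in> carrier A\<rbrakk> \<Longrightarrow> h (x \<oplus>\<^bsub>A\<^esub> y) = h x \<oplus>\<^bsub>A'\<^esub> h y"
  shows "h \<in> additive_maps A A'"
  using assms by (auto simp: additive_maps_def)

lemma additive_maps_closed: "h \<in> additive_maps A A' \<Longrightarrow> x \<in> carrier A \<Longrightarrow> h x \<in> carrier A'"
  by (auto simp: additive_maps_def)

lemma additive_maps_add:
  "\<lbrakk>h \<in> additive_maps A A'; x \<in> carrier A; y \<in> carrier A\<rbrakk>
    \<Longrightarrow> h (x \<oplus>\<^bsub>A\<^esub> y) = h x \<oplus>\<^bsub>A'\<^esub> h y"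
  by (auto simp: additive_maps_def)

lemma additive_maps_id: "(\<lambda>x. x) \<in> additive_maps A A"
  by (auto simp: additive_maps_def)

lemma additive_maps_cong:
  assumes "abelian_group A" "h \<in> additive_maps A A'" "\<And>x. x \<in> carrier A \<Longrightarrow> h' x = h x"
  shows "h' \<in> additive_maps A A'"
proof -
  interpret abelian_group A by fact
  show ?thesis using assms(2,3) by (auto simp: additive_maps_def)
qed

lemma additive_maps_plus:
  assumes "abelian_group A'" "h \<in> additive_maps A A'" "h' \<in> additive_maps A A'"
  shows "(\<lambda>x. h x \<oplus>\<^bsub>A'\<^esub> h' x) \<in> additive_maps A A'"
proof -
  interpret A': abelian_group A' by fact
  show ?thesis
    using assms(2,3) by (intro additive_mapsI) (auto simp: additive_maps_def A'.a_ac Pi_iff)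
qed

lemma additive_maps_comp:
  "h \<in> additive_maps A A' \<Longrightarrow> h' \<in> additive_maps A' A'' \<Longrightarrow> (\<lambda>x. h' (h x)) \<in> additive_maps A A''"
  by (auto simp: additive_maps_def Pi_iff)

lemma linear_maps_additive: "h \<in> linear_maps K A A' \<Longrightarrow> h \<in> additive_maps A A'"
  by (auto simp: additive_maps_def linear_maps_def)

lemma additive_maps_zero_diff:
  assumes "abelian_group A" "abelian_group A'" "h \<in> additive_maps A A'"
  shows additive_maps_zero: "h \<zero>\<^bsub>A\<^esub> = \<zero>\<^bsub>A'\<^esub>"
    and additive_maps_diff:
      "\<And>x y. \<lbrakk>x \<in> carrier A; y \<in> carrier A\<rbrakk> \<Longrightarrow> h (x \<ominus>\<^bsub>A\<^esub> y) = h x \<ominus>\<^bsub>A'\<^esub> h y"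
proof -
  interpret A: abelian_group A by fact
  interpret A': abelian_group A' by fact
  interpret group_hom "add_monoid A" "add_monoid A'" h
    by (intro group_hom.intro A.a_group A'.a_group group_hom_axioms.intro)
       (use assms(3) in \<open>auto simp: additive_maps_def hom_def\<close>)
  show "h \<zero>\<^bsub>A\<^esub> = \<zero>\<^bsub>A'\<^esub>" using hom_one by simp
  show "h (x \<ominus>\<^bsub>A\<^esub> y) = h x \<ominus>\<^bsub>A'\<^esub> h y" if "x \<in> carrier A" "y \<in> carrier A" for x y
    using hom_inv[of y] hom_mult[of x "\<ominus>\<^bsub>A\<^esub> y"] that A.a_inv_closed
    by (simp add: a_minus_def a_inv_def[symmetric])
qed

lemma keys_diff_of:
  "Poly_Mapping.keys (frag_of a - frag_of b) \<subseteq> {a, b}"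
  "Poly_Mapping.keys (frag_of a - frag_of b - frag_of c) \<subseteq> {a, b, c}"
  using keys_diff[of "frag_of a - frag_of b" "frag_of c"] keys_diff[of "frag_of a" "frag_of b"] by auto

text \<open>Separates the finite sum in \<open>pres_lift\<close> from the choice of a
  representative, so that the rules for sums can be proved for every formal combination.\<close>

definition frag_eval :: "('p, 'q) ring_scheme \<Rightarrow> ('w \<Rightarrow> 'p) \<Rightarrow> ('w \<Rightarrow>\<^sub>0 int) \<Rightarrow> 'p" where
  "frag_eval P f s = (\<Oplus>\<^bsub>P\<^esub>w \<in> Poly_Mapping.keys s. [Poly_Mapping.lookup s w] \<cdot>\<^bsub>P\<^esub> f w)"

lemma pres_lift_eq_frag_eval: "pres_lift P f S = frag_eval P f (some_rep S)"
  by (simp add: pres_lift_def frag_eval_def)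

section \<open>Evaluation of formal integer combinations\<close>

context abelian_group
begin

lemma minus_eq_zero_iff: "\<lbrakk>a \<in> carrier G; b \<in> carrier G\<rbrakk> \<Longrightarrow> a \<ominus> b = \<zero> \<longleftrightarrow> a = b"
  by (auto simp: a_minus_def r_neg dest: minus_equality)

lemma frag_eval_zero [simp]: "frag_eval G f 0 = \<zero>"
  by (simp add: frag_eval_def)

lemma frag_eval_of [simp]: "f w \<in> carrier G \<Longrightarrow> frag_eval G f (frag_of w) = f w"
  by (simp add: frag_eval_def)

text \<open>Extra indices contribute the zeroth multiple of \<open>f w\<close>. Sums with different
  supports can thus be compared over one finite set.\<close>

lemma frag_eval_superset:
  assumes "finite U" "Poly_Mapping.keys s \<subseteq> U" "\<And>w. w \<in> U \<Longrightarrow> f w \<in> carrier G"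
  shows "frag_eval G f s = (\<Oplus>w\<in>U. [Poly_Mapping.lookup s w] \<cdot> f w)"
  unfolding frag_eval_def
  by (rule add.finprod_mono_neutral_cong_left)
     (use assms in \<open>auto simp: in_keys_iff add_pow_def[where k = "0 :: int"] intro!: add.int_pow_closed\<close>)

lemma frag_eval_closed:
  assumes "Poly_Mapping.keys s \<subseteq> W" "\<And>w. w \<in> W \<Longrightarrow> f w \<in> carrier G"
  shows "frag_eval G f s \<in> carrier G"
  unfolding frag_eval_def
  by (rule finsum_closed) (use assms in \<open>auto intro!: add.int_pow_closed\<close>)

text \<open>Cancellation can shrink the support of \<open>s + t\<close>, so all three sums are taken
  over the union of the two supports.\<close>

lemma frag_eval_add:
  assumes "Poly_Mapping.keys s \<subseteq> W" "Poly_Mapping.keys t \<subseteq> W" "\<And>w. w \<in> W \<Longrightarrow> f w \<in> carrier G"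
  shows "frag_eval G f (s + t) = frag_eval G f s \<oplus> frag_eval G f t"
proof -
  let ?U = "Poly_Mapping.keys s \<union> Poly_Mapping.keys t"
  have U: "finite ?U" "\<And>w. w \<in> ?U \<Longrightarrow> f w \<in> carrier G" using assms by auto
  have "frag_eval G f (s + t) = (\<Oplus>w\<in>?U. [Poly_Mapping.lookup (s + t) w] \<cdot> f w)"
    by (rule frag_eval_superset) (use U keys_add[of s t] in auto)
  also have "\<dots> = (\<Oplus>w\<in>?U. [Poly_Mapping.lookup s w] \<cdot> f w \<oplus> [Poly_Mapping.lookup t w] \<cdot> f w)"
    by (rule finsum_cong') (use U in \<open>auto simp: lookup_add add.int_pow_mult\<close>)
  also have "\<dots> = (\<Oplus>w\<in>?U. [Poly_Mapping.lookup s w] \<cdot> f w) \<oplus> (\<Oplus>w\<in>?U. [Poly_Mapping.lookup t w] \<cdot> f w)"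
    by (rule finsum_addf) (use U in \<open>auto intro!: add.int_pow_closed\<close>)
  also have "(\<Oplus>w\<in>?U. [Poly_Mapping.lookup s w] \<cdot> f w) = frag_eval G f s"
    by (rule frag_eval_superset[symmetric]) (use U in auto)
  also have "(\<Oplus>w\<in>?U. [Poly_Mapping.lookup t w] \<cdot> f w) = frag_eval G f t"
    by (rule frag_eval_superset[symmetric]) (use U in auto)
  finally show ?thesis .
qed

lemma frag_eval_diff:
  assumes "Poly_Mapping.keys s \<subseteq> W" "Poly_Mapping.keys t \<subseteq> W" "\<And>w. w \<in> W \<Longrightarrow> f w \<in> carrier G"
  shows "frag_eval G f (s - t) = frag_eval G f s \<ominus> frag_eval G f t"
proof -
  have k: "Poly_Mapping.keys (s - t) \<subseteq> W" using keys_diff[of s t] assms by blast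
  have "frag_eval G f s = frag_eval G f (s - t) \<oplus> frag_eval G f t"
    using frag_eval_add[OF k assms(2,3)] by simp
  moreover have "frag_eval G f (s - t) \<in> carrier G" "frag_eval G f t \<in> carrier G"
    using frag_eval_closed[OF k assms(3)] frag_eval_closed[OF assms(2,3)] by auto
  ultimately show ?thesis by (simp add: a_minus_def a_assoc r_neg)
qed

lemma frag_eval_diff_of:
  assumes "f a = f b" "f b \<in> carrier G"
  shows "frag_eval G f (frag_of a - frag_of b) = \<zero>"
proof -
  have "frag_eval G f (frag_of a - frag_of b) = f a \<ominus> f b"
    using frag_eval_diff[of "frag_of a" "{a, b}" "frag_of b" f] assms by fastforce
  then show ?thesis using assms by (simp add: minus_eq_zero_iff)
qed

lemma frag_eval_diff_diff_of:
  assumes "f a = f b \<oplus> f c" "f b \<in> carrier G" "f c \<in> carrier G"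
  shows "frag_eval G f (frag_of a - frag_of b - frag_of c) = \<zero>"
proof -
  have f: "f w \<in> carrier G" if "w \<in> {a, b, c}" for w using assms that by auto
  have k: "Poly_Mapping.keys (frag_of a - frag_of b) \<subseteq> {a, b, c}"
    using keys_diff_of(1)[of a b] by auto
  have "frag_eval G f (frag_of a - frag_of b) = f a \<ominus> f b"
    using frag_eval_diff[of "frag_of a" "{a, b, c}" "frag_of b" f] f by simp
  moreover have "frag_eval G f (frag_of a - frag_of b - frag_of c)
      = frag_eval G f (frag_of a - frag_of b) \<ominus> f c"
    using frag_eval_diff[OF k, of "frag_of c" f] f by simp
  moreover have "(f b \<oplus> f c) \<ominus> f b \<ominus> f c = \<zero>"
    using assms(2,3) a_comm[OF assms(2,3)] by (simp add: a_minus_def a_assoc r_neg)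
  ultimately show ?thesis using assms(1) by simp
qed

lemma frag_eval_cong:
  assumes "Poly_Mapping.keys s \<subseteq> W" "\<And>w. w \<in> W \<Longrightarrow> f w = g w" "\<And>w. w \<in> W \<Longrightarrow> g w \<in> carrier G"
  shows "frag_eval G f s = frag_eval G g s"
  unfolding frag_eval_def
  by (rule finsum_cong') (use assms in \<open>auto intro!: add.int_pow_closed\<close>)

lemma frag_eval_fun_add:
  assumes "Poly_Mapping.keys s \<subseteq> W" "\<And>w. w \<in> W \<Longrightarrow> f w \<in> carrier G" "\<And>w. w \<in> W \<Longrightarrow> g w \<in> carrier G"
  shows "frag_eval G (\<lambda>w. f w \<oplus> g w) s = frag_eval G f s \<oplus> frag_eval G g s"
proof -
  have fin: "finite (Poly_Mapping.keys s)" by simp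
  have "frag_eval G (\<lambda>w. f w \<oplus> g w) s = (\<Oplus>w \<in> Poly_Mapping.keys s.
      [Poly_Mapping.lookup s w] \<cdot> f w \<oplus> [Poly_Mapping.lookup s w] \<cdot> g w)"
    unfolding frag_eval_def
    by (rule finsum_cong') (use assms in \<open>auto simp: add.int_pow_distrib subset_iff\<close>)
  then show ?thesis
    unfolding frag_eval_def
    by (simp, intro finsum_addf) (use assms in \<open>auto intro!: add.int_pow_closed\<close>)
qed

lemma frag_eval_hom:
  assumes "abelian_group A'" "h \<in> additive_maps G A'"
    and "Poly_Mapping.keys s \<subseteq> W" "\<And>w. w \<in> W \<Longrightarrow> f w \<in> carrier G"
  shows "h (frag_eval G f s) = frag_eval A' (\<lambda>w. h (f w)) s"
proof -
  interpret A': abelian_group A' by fact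
  have c: "h (f w) \<in> carrier A'" if "w \<in> W" for w
    using assms(2,4) that by (auto intro: additive_maps_closed)
  \<comment> \<open>The support condition is part of the claim because the difference step of
    \<open>frag_induction\<close> supplies no supports for its two terms.\<close>
  from assms(3) have "Poly_Mapping.keys s \<subseteq> W \<and> h (frag_eval G f s) = frag_eval A' (\<lambda>w. h (f w)) s"
  proof (induction s rule: frag_induction)
    case zero
    show ?case using additive_maps_zero[OF abelian_group_axioms assms(1,2)] by simp
  next
    case (one x)
    then show ?case using c assms(4) by simp
  next
    case (diff a b)
    have "Poly_Mapping.keys (a - b) \<subseteq> W" using keys_diff[of a b] diff by blast
    moreover have "frag_eval G f a \<in> carrier G" "frag_eval G f b \<in> carrier G"
      using diff assms(4) by (auto intro: frag_eval_closed)
    ultimately show ?case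
      using diff frag_eval_diff[of a W b f] A'.frag_eval_diff[of a W b "\<lambda>w. h (f w)"] c assms(4)
      additive_maps_diff[OF abelian_group_axioms assms(1,2)] by simp
  qed
  then show ?thesis ..
qed

text \<open>Induction on the outer combination; \<open>a\<close> is written as
  \<open>(a - b) + b\<close>, so that only additivity is used under the other sum.\<close>

lemma frag_eval_swap:
  assumes "Poly_Mapping.keys s \<subseteq> V" "Poly_Mapping.keys t \<subseteq> W"
    and "\<And>v w. \<lbrakk>v \<in> V; w \<in> W\<rbrakk> \<Longrightarrow> f v w \<in> carrier G"
  shows "frag_eval G (\<lambda>v. frag_eval G (\<lambda>w. f v w) t) s = frag_eval G (\<lambda>w. frag_eval G (\<lambda>v. f v w) s) t"
proof -
  let ?L = "\<lambda>s. frag_eval G (\<lambda>v. frag_eval G (\<lambda>w. f v w) t) s"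
  let ?R = "\<lambda>s. frag_eval G (\<lambda>w. frag_eval G (\<lambda>v. f v w) s) t"
  have inner: "frag_eval G (\<lambda>w. f v w) t \<in> carrier G" if "v \<in> V" for v
    using assms that by (auto intro: frag_eval_closed)
  have inner': "frag_eval G (\<lambda>v. f v w) s \<in> carrier G" if "w \<in> W" "Poly_Mapping.keys s \<subseteq> V" for w s
    using assms that by (auto intro: frag_eval_closed)
  have rc: "?R s \<in> carrier G" if "Poly_Mapping.keys s \<subseteq> V" for s
    using that assms inner' by (intro frag_eval_closed) auto
  from assms(1) have "Poly_Mapping.keys s \<subseteq> V \<and> ?L s = ?R s"
  proof (induction s rule: frag_induction)
    case zero
    have "frag_eval G (\<lambda>w. \<zero>) t = \<zero>" by (simp add: frag_eval_def)
    then show ?case by simp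
  next
    case (one x)
    have "?R (frag_of x) = frag_eval G (\<lambda>w. f x w) t"
      by (rule frag_eval_cong) (use assms one in auto)
    then show ?case using one inner by simp
  next
    case (diff a b)
    have k: "Poly_Mapping.keys (a - b) \<subseteq> V" using keys_diff[of a b] diff by blast
    have "?R a = frag_eval G (\<lambda>w. frag_eval G (\<lambda>v. f v w) (a - b) \<oplus> frag_eval G (\<lambda>v. f v w) b) t"
    proof (rule frag_eval_cong[OF assms(2)])
      fix w assume w: "w \<in> W"
      show "frag_eval G (\<lambda>v. f v w) a = frag_eval G (\<lambda>v. f v w) (a - b) \<oplus> frag_eval G (\<lambda>v. f v w) b"
        using frag_eval_add[OF k, of b "\<lambda>v. f v w"] diff assms(3) w by simp
    qed (use diff inner' k in auto)
    also have "\<dots> = ?R (a - b) \<oplus> ?R b"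
      by (rule frag_eval_fun_add[OF assms(2)]) (use diff inner' k in auto)
    finally have "?R a = ?R (a - b) \<oplus> ?R b" .
    moreover have "?L a = ?L (a - b) \<oplus> ?L b"
      using frag_eval_add[OF k, of b "\<lambda>v. frag_eval G (\<lambda>w. f v w) t"] diff inner by simp
    moreover have "?L (a - b) \<in> carrier G" by (rule frag_eval_closed[OF k]) (use inner in auto)
    ultimately show ?case using diff k rc by simp
  qed
  then show ?thesis ..
qed

end

section \<open>Cosets and chosen representatives\<close>

lemma pres_coset_eqI: "s - t \<in> group_closure rels \<Longrightarrow> pres_coset rels s = pres_coset rels t"
proof -
  assume st: "s - t \<in> group_closure rels"
  have "u - s \<in> group_closure rels \<longleftrightarrow> u - t \<in> group_closure rels" for u
    using group_closure_add[of "u - s" rels "s - t"] group_closure.diff[of "u - t" rels "s - t"] st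
    by auto
  then show ?thesis by (auto simp: pres_coset_def)
qed

text \<open>The choice in a \<open>pres_coset\<close> enters later arguments only through this: it
  can change a combination by relations and by nothing else.\<close>

lemma some_rep_pres_coset: "some_rep (pres_coset rels s) - s \<in> group_closure rels"
proof -
  have "s \<in> pres_coset rels s" by (simp add: pres_coset_def)
  then have "some_rep (pres_coset rels s) \<in> pres_coset rels s"
    unfolding some_rep_def by (rule someI)
  then show ?thesis by (simp add: pres_coset_def)
qed

lemma pres_coset_some_rep [simp]: "pres_coset rels (some_rep (pres_coset rels s)) = pres_coset rels s"
  by (rule pres_coset_eqI[OF some_rep_pres_coset])

text \<open>The cosets live among all formal combinations, not only those supported in
  \<open>W\<close>. This keeps the chosen representatives inside \<open>W\<close>, where functions
  on monomials have known values.\<close>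

lemma keys_group_closure:
  assumes "\<And>r. r \<in> rels \<Longrightarrow> Poly_Mapping.keys r \<subseteq> W" "s \<in> group_closure rels"
  shows "Poly_Mapping.keys s \<subseteq> W"
  using assms(2)
proof (induction)
  case (base s)
  then show ?case using assms(1) by auto
next
  case (diff s t)
  then show ?case using keys_diff[of s t] by blast
qed

text \<open>The additive part shared by \<open>tensor\<close> and \<open>multi_tensor\<close>. Apart
  from the support of the relations, the assumptions are the shapes of their record fields.\<close>

locale presented_group =
  fixes P :: "(('w \<Rightarrow>\<^sub>0 int) set, 'q) ring_scheme" (structure)
    and rels :: "('w \<Rightarrow>\<^sub>0 int) set" and W :: "'w set"
  assumes keys_rels: "r \<in> rels \<Longrightarrow> Poly_Mapping.keys r \<subseteq> W"
    and carrier_eq: "carrier P = pres_coset rels ` {s. Poly_Mapping.keys s \<subseteq> W}"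
    and zero_eq: "\<zero> = pres_coset rels 0"
    and add_eq: "S \<oplus> T = pres_coset rels (some_rep S + some_rep T)"
begin

abbreviation cls where "cls \<equiv> pres_coset rels"

abbreviation monomial where "monomial w \<equiv> cls (frag_of w)"

lemma keys_some_rep_cls: "Poly_Mapping.keys s \<subseteq> W \<Longrightarrow> Poly_Mapping.keys (some_rep (cls s)) \<subseteq> W"
  using keys_group_closure[OF keys_rels some_rep_pres_coset[of rels s]]
    keys_add[of "some_rep (cls s) - s" s]
  by auto

lemma keys_some_rep: "S \<in> carrier P \<Longrightarrow> Poly_Mapping.keys (some_rep S) \<subseteq> W"
  using keys_some_rep_cls by (auto simp: carrier_eq)

lemma cls_some_rep: "S \<in> carrier P \<Longrightarrow> cls (some_rep S) = S"
  by (auto simp: carrier_eq)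

lemma cls_closed: "Poly_Mapping.keys s \<subseteq> W \<Longrightarrow> cls s \<in> carrier P"
  by (auto simp: carrier_eq)

lemma monomial_closed: "w \<in> W \<Longrightarrow> monomial w \<in> carrier P"
  by (rule cls_closed) auto

lemma cls_add: "cls s \<oplus> cls t = cls (s + t)"
  unfolding add_eq
proof (rule pres_coset_eqI)
  show "some_rep (cls s) + some_rep (cls t) - (s + t) \<in> group_closure rels"
    using group_closure_add[OF some_rep_pres_coset[of rels s] some_rep_pres_coset[of rels t]]
    by (simp add: algebra_simps)
qed

lemma abelian_group: "abelian_group P"
proof (rule abelian_groupI)
  show "S \<oplus> T \<in> carrier P" if "S \<in> carrier P" "T \<in> carrier P" for S T
    using that keys_some_rep keys_add[of "some_rep S" "some_rep T"]
    unfolding add_eq by (intro cls_closed) blast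
  show "\<zero> \<in> carrier P" by (simp add: zero_eq cls_closed)
  show "S \<oplus> T \<oplus> U = S \<oplus> (T \<oplus> U)" if "S \<in> carrier P" "T \<in> carrier P" "U \<in> carrier P" for S T U
    using that by (auto simp: carrier_eq cls_add add.assoc)
  show "S \<oplus> T = T \<oplus> S" if "S \<in> carrier P" "T \<in> carrier P" for S T
    using that by (auto simp: carrier_eq cls_add add.commute)
  show "\<zero> \<oplus> S = S" if "S \<in> carrier P" for S
    using that by (auto simp: carrier_eq cls_add zero_eq)
  show "\<exists>T\<in>carrier P. T \<oplus> S = \<zero>" if "S \<in> carrier P" for S
  proof -
    from that obtain s where s: "S = cls s" "Poly_Mapping.keys s \<subseteq> W" by (auto simp: carrier_eq)
    then have "cls (- s) \<in> carrier P" "cls (- s) \<oplus> S = \<zero>"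
      by (auto simp: cls_add zero_eq keys_minus intro!: cls_closed)
    then show ?thesis by blast
  qed
qed

lemma cls_diff:
  assumes "Poly_Mapping.keys s \<subseteq> W" "Poly_Mapping.keys t \<subseteq> W"
  shows "cls (s - t) = cls s \<ominus> cls t"
proof -
  interpret abelian_group P by (rule abelian_group)
  have k: "Poly_Mapping.keys (s - t) \<subseteq> W" using keys_diff[of s t] assms by blast
  have "cls s = cls (s - t) \<oplus> cls t" by (simp add: cls_add)
  then show ?thesis
    using cls_closed[OF k] cls_closed[OF assms(2)] by (simp add: a_minus_def a_assoc r_neg)
qed

text \<open>Monomial classes generate the group, so every element is a sum of them; uniqueness of
  additive maps rests on this.\<close>

lemma cls_eq_frag_eval: "Poly_Mapping.keys s \<subseteq> W \<Longrightarrow> cls s = frag_eval P monomial s"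
proof -
  interpret abelian_group P by (rule abelian_group)
  assume "Poly_Mapping.keys s \<subseteq> W"
  then have "Poly_Mapping.keys s \<subseteq> W \<and> cls s = frag_eval P monomial s"
  proof (induction s rule: frag_induction)
    case zero
    then show ?case by (simp add: zero_eq)
  next
    case (one x)
    then show ?case by (simp add: monomial_closed)
  next
    case (diff a b)
    have "Poly_Mapping.keys (a - b) \<subseteq> W" using keys_diff[of a b] diff by blast
    then show ?case using diff cls_diff frag_eval_diff[of a W b monomial] monomial_closed by simp
  qed
  then show ?thesis ..
qed

lemma monomial_eq: "frag_of v - frag_of w \<in> rels \<Longrightarrow> monomial v = monomial w"
  by (rule pres_coset_eqI) (auto intro: group_closure.base)

lemma monomial_add:
  assumes "frag_of u - frag_of v - frag_of w \<in> rels"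
  shows "monomial u = monomial v \<oplus> monomial w"
  unfolding cls_add
  by (rule pres_coset_eqI) (use assms in \<open>auto intro: group_closure.base simp: diff_diff_eq\<close>)

lemma pres_lift_monomials: "S \<in> carrier P \<Longrightarrow> pres_lift P monomial S = S"
  using cls_eq_frag_eval[OF keys_some_rep] cls_some_rep by (simp add: pres_lift_eq_frag_eval)

lemma pres_lift_closed:
  assumes "abelian_group A" "S \<in> carrier P" "\<And>w. w \<in> W \<Longrightarrow> f w \<in> carrier A"
  shows "pres_lift A f S \<in> carrier A"
  unfolding pres_lift_eq_frag_eval
  by (rule abelian_group.frag_eval_closed[OF assms(1) keys_some_rep]) (use assms in auto)

lemma pres_lift_cong:
  assumes "abelian_group A" "S \<in> carrier P" "\<And>w. w \<in> W \<Longrightarrow> f w = g w"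
    "\<And>w. w \<in> W \<Longrightarrow> g w \<in> carrier A"
  shows "pres_lift A f S = pres_lift A g S"
  unfolding pres_lift_eq_frag_eval
  by (rule abelian_group.frag_eval_cong[OF assms(1) keys_some_rep]) (use assms in auto)

lemma pres_lift_fun_add:
  assumes "abelian_group A" "S \<in> carrier P" "\<And>w. w \<in> W \<Longrightarrow> f w \<in> carrier A"
    "\<And>w. w \<in> W \<Longrightarrow> g w \<in> carrier A"
  shows "pres_lift A (\<lambda>w. f w \<oplus>\<^bsub>A\<^esub> g w) S = pres_lift A f S \<oplus>\<^bsub>A\<^esub> pres_lift A g S"
  unfolding pres_lift_eq_frag_eval
  by (rule abelian_group.frag_eval_fun_add[OF assms(1) keys_some_rep]) (use assms in auto)

lemma hom_pres_lift:
  assumes "abelian_group A" "abelian_group A'" "h \<in> additive_maps A A'" "S \<in> carrier P"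
    "\<And>w. w \<in> W \<Longrightarrow> f w \<in> carrier A"
  shows "h (pres_lift A f S) = pres_lift A' (\<lambda>w. h (f w)) S"
  unfolding pres_lift_eq_frag_eval
  by (rule abelian_group.frag_eval_hom[OF assms(1,2,3) keys_some_rep]) (use assms in auto)

lemma additive_ext:
  assumes "abelian_group A" "h \<in> additive_maps P A" "h' \<in> additive_maps P A"
    "\<And>w. w \<in> W \<Longrightarrow> h (monomial w) = h' (monomial w)" "S \<in> carrier P"
  shows "h S = h' S"
proof -
  have "h S = pres_lift A (\<lambda>w. h (monomial w)) S"
    using hom_pres_lift[OF abelian_group assms(1,2,5), of monomial] monomial_closed
      pres_lift_monomials[OF assms(5)] by simp
  also have "\<dots> = pres_lift A (\<lambda>w. h' (monomial w)) S"
    by (rule pres_lift_cong) (use assms monomial_closed in \<open>auto intro: additive_maps_closed\<close>)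
  also have "\<dots> = h' S"
    using hom_pres_lift[OF abelian_group assms(1,3,5), of monomial] monomial_closed
      pres_lift_monomials[OF assms(5)] by simp
  finally show ?thesis .
qed

section \<open>The universal property of a presented group\<close>

definition respects_rels :: "('a, 'c) ring_scheme \<Rightarrow> ('w \<Rightarrow> 'a) \<Rightarrow> bool" where
  "respects_rels A f \<longleftrightarrow> f \<in> W \<rightarrow> carrier A \<and> (\<forall>r\<in>rels. frag_eval A f r = \<zero>\<^bsub>A\<^esub>)"

lemma frag_eval_group_closure:
  assumes "abelian_group A" "respects_rels A f" "s \<in> group_closure rels"
  shows "frag_eval A f s = \<zero>\<^bsub>A\<^esub>"
proof -
  interpret A: abelian_group A by fact
  show ?thesis
    using assms(3)
  proof induction
    case (base s)
    then show ?case using assms(2) by (auto simp: respects_rels_def)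
  next
    case (diff s t)
    have "frag_eval A f (s - t) = frag_eval A f s \<ominus>\<^bsub>A\<^esub> frag_eval A f t"
      by (rule A.frag_eval_diff[of _ W])
         (use diff keys_group_closure[OF keys_rels] assms(2) in \<open>auto simp: respects_rels_def\<close>)
    then show ?case using diff by (simp add: A.minus_eq_zero_iff)
  qed
qed

text \<open>Independence of the representative: the chosen one and \<open>s\<close> differ by a
  combination of relations, on which \<open>f\<close> evaluates to zero.\<close>

lemma pres_lift_cls:
  assumes "abelian_group A" "respects_rels A f" "Poly_Mapping.keys s \<subseteq> W"
  shows "pres_lift A f (cls s) = frag_eval A f s"
proof -
  interpret A: abelian_group A by fact
  have f: "\<And>w. w \<in> W \<Longrightarrow> f w \<in> carrier A" using assms(2) by (auto simp: respects_rels_def)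
  have "frag_eval A f (some_rep (cls s) - s) = \<zero>\<^bsub>A\<^esub>"
    by (rule frag_eval_group_closure[OF assms(1,2) some_rep_pres_coset])
  moreover have "frag_eval A f (some_rep (cls s) - s) = frag_eval A f (some_rep (cls s)) \<ominus>\<^bsub>A\<^esub> frag_eval A f s"
    by (rule A.frag_eval_diff[OF keys_some_rep_cls[OF assms(3)] assms(3)]) (use f in auto)
  ultimately show ?thesis
    using A.frag_eval_closed[OF assms(3), of f] A.frag_eval_closed[OF keys_some_rep_cls[OF assms(3)], of f] f
    by (simp add: A.minus_eq_zero_iff pres_lift_eq_frag_eval)
qed

lemma pres_lift_monomial:
  assumes "abelian_group A" "respects_rels A f" "w \<in> W"
  shows "pres_lift A f (monomial w) = f w"
proof -
  interpret A: abelian_group A by fact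
  have "f w \<in> carrier A" using assms by (auto simp: respects_rels_def)
  then show ?thesis using pres_lift_cls[OF assms(1,2), of "frag_of w"] assms(3) by simp
qed

lemma pres_lift_additive:
  assumes "abelian_group A" "respects_rels A f"
  shows "pres_lift A f \<in> additive_maps P A"
proof (rule additive_mapsI)
  interpret A: abelian_group A by fact
  have f: "\<And>w. w \<in> W \<Longrightarrow> f w \<in> carrier A" using assms(2) by (auto simp: respects_rels_def)
  show "pres_lift A f S \<in> carrier A" if "S \<in> carrier P" for S
    using pres_lift_closed assms(1) that f by blast
  show "pres_lift A f (S \<oplus> T) = pres_lift A f S \<oplus>\<^bsub>A\<^esub> pres_lift A f T"
    if "S \<in> carrier P" "T \<in> carrier P" for S T
  proof -
    note k = keys_some_rep[OF that(1)] keys_some_rep[OF that(2)]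
    have "Poly_Mapping.keys (some_rep S + some_rep T) \<subseteq> W"
      using k keys_add[of "some_rep S" "some_rep T"] by blast
    then have "pres_lift A f (S \<oplus> T) = frag_eval A f (some_rep S + some_rep T)"
      unfolding add_eq by (rule pres_lift_cls[OF assms])
    then show ?thesis
      unfolding pres_lift_eq_frag_eval using A.frag_eval_add[OF k, of f] f by simp
  qed
qed

text \<open>Scalar actions in \<open>tensor\<close> and \<open>multi_tensor\<close> transform a
  chosen representative. Written as a lift, such an action is additive as soon as its monomial form
  is balanced.\<close>

lemma cls_frag_extend_some_rep:
  assumes "S \<in> carrier P" "\<And>w. w \<in> W \<Longrightarrow> \<phi> w \<in> W"
  shows "cls (frag_extend (\<lambda>w. frag_of (\<phi> w)) (some_rep S)) = pres_lift P (\<lambda>w. monomial (\<phi> w)) S"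
proof -
  interpret abelian_group P by (rule abelian_group)
  have "Poly_Mapping.keys s \<subseteq> W \<and> Poly_Mapping.keys (frag_extend (\<lambda>w. frag_of (\<phi> w)) s) \<subseteq> W \<and>
      cls (frag_extend (\<lambda>w. frag_of (\<phi> w)) s) = frag_eval P (\<lambda>w. monomial (\<phi> w)) s"
    if "Poly_Mapping.keys s \<subseteq> W" for s
    using that
  proof (induction s rule: frag_induction)
    case zero
    then show ?case by (simp add: zero_eq)
  next
    case (one x)
    then show ?case by (simp add: monomial_closed assms(2))
  next
    case (diff a b)
    have "Poly_Mapping.keys (a - b) \<subseteq> W" using keys_diff[of a b] diff by blast
    moreover have "Poly_Mapping.keys (frag_extend (\<lambda>w. frag_of (\<phi> w)) (a - b)) \<subseteq> W"
      unfolding frag_extend_diff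
      using diff keys_diff[of "frag_extend (\<lambda>w. frag_of (\<phi> w)) a" "frag_extend (\<lambda>w. frag_of (\<phi> w)) b"]
      by blast
    moreover have "cls (frag_extend (\<lambda>w. frag_of (\<phi> w)) (a - b)) = frag_eval P (\<lambda>w. monomial (\<phi> w)) (a - b)"
      using diff cls_diff frag_eval_diff[of a W b "\<lambda>w. monomial (\<phi> w)"] monomial_closed assms(2)
      by (simp add: frag_extend_diff)
    ultimately show ?case by simp
  qed
  from this[OF keys_some_rep[OF assms(1)]] show ?thesis by (simp add: pres_lift_eq_frag_eval)
qed

end

text \<open>\<open>pres_lift\<close> is a finite sum over a fixed representative, so additive maps can be pulled inside it and
  two of them commute without any balancing condition on the integrand.\<close>

lemma pres_lift_swap:
  assumes "presented_group P rels V" "presented_group Q rels' W" "abelian_group A"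
    "S \<in> carrier P" "T \<in> carrier Q" "\<And>v w. \<lbrakk>v \<in> V; w \<in> W\<rbrakk> \<Longrightarrow> f v w \<in> carrier A"
  shows "pres_lift A (\<lambda>v. pres_lift A (f v) T) S = pres_lift A (\<lambda>w. pres_lift A (\<lambda>v. f v w) S) T"
  unfolding pres_lift_eq_frag_eval
  by (rule abelian_group.frag_eval_swap[OF assms(3) presented_group.keys_some_rep[OF assms(1,4)]
        presented_group.keys_some_rep[OF assms(2,5)]]) (rule assms(6))

section \<open>Tensor products of bimodules\<close>

abbreviation (input) bilift :: "('p, 'q) ring_scheme \<Rightarrow> ('m \<Rightarrow> 'n \<Rightarrow> 'p) \<Rightarrow> ('m \<times> 'n \<Rightarrow>\<^sub>0 int) set \<Rightarrow> 'p" where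
  "bilift A f \<equiv> pres_lift A (\<lambda>(m, n). f m n)"

definition balanced ::
  "('k, 'r) module \<Rightarrow> ('k, 'r, 'm) bimod \<Rightarrow> ('k, 'r, 'n) bimod \<Rightarrow> ('p, 'q) ring_scheme
    \<Rightarrow> ('m \<Rightarrow> 'n \<Rightarrow> 'p) \<Rightarrow> bool" where
  "balanced R M N A f \<longleftrightarrow>
     (\<forall>n\<in>carrier N. (\<lambda>m. f m n) \<in> additive_maps M A) \<and>
     (\<forall>m\<in>carrier M. f m \<in> additive_maps N A) \<and>
     (\<forall>m\<in>carrier M. \<forall>r\<in>carrier R. \<forall>n\<in>carrier N. f (ract M m r) n = f m (lact N r n))"

lemma balancedI:
  assumes "\<And>m n. \<lbrakk>m \<in> carrier M; n \<in> carrier N\<rbrakk> \<Longrightarrow> f m n \<in> carrier A"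
    and "\<And>m m' n. \<lbrakk>m \<in> carrier M; m' \<in> carrier M; n \<in> carrier N\<rbrakk>
      \<Longrightarrow> f (m \<oplus>\<^bsub>M\<^esub> m') n = f m n \<oplus>\<^bsub>A\<^esub> f m' n"
    and "\<And>m n n'. \<lbrakk>m \<in> carrier M; n \<in> carrier N; n' \<in> carrier N\<rbrakk>
      \<Longrightarrow> f m (n \<oplus>\<^bsub>N\<^esub> n') = f m n \<oplus>\<^bsub>A\<^esub> f m n'"
    and "\<And>m r n. \<lbrakk>m \<in> carrier M; r \<in> carrier R; n \<in> carrier N\<rbrakk>
      \<Longrightarrow> f (ract M m r) n = f m (lact N r n)"
  shows "balanced R M N A f"
  using assms by (auto simp: balanced_def additive_maps_def)

lemma balancedD:
  assumes "balanced R M N A f"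
  shows balanced_closed: "\<lbrakk>m \<in> carrier M; n \<in> carrier N\<rbrakk> \<Longrightarrow> f m n \<in> carrier A"
    and balanced_add_left: "\<lbrakk>m \<in> carrier M; m' \<in> carrier M; n \<in> carrier N\<rbrakk>
      \<Longrightarrow> f (m \<oplus>\<^bsub>M\<^esub> m') n = f m n \<oplus>\<^bsub>A\<^esub> f m' n"
    and balanced_add_right: "\<lbrakk>m \<in> carrier M; n \<in> carrier N; n' \<in> carrier N\<rbrakk>
      \<Longrightarrow> f m (n \<oplus>\<^bsub>N\<^esub> n') = f m n \<oplus>\<^bsub>A\<^esub> f m n'"
    and balanced_middle: "\<lbrakk>m \<in> carrier M; r \<in> carrier R; n \<in> carrier N\<rbrakk>
      \<Longrightarrow> f (ract M m r) n = f m (lact N r n)"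
  using assms by (auto simp: balanced_def additive_maps_def)

text \<open>Just enough for the additive group of \<open>tensor\<close>: two groups and closed
  actions on the sides that meet. An iterated tensor product can therefore be a factor before any
  module law is known for it.\<close>

locale tensor_product = M: abelian_group M + N: abelian_group N
  for R :: "('k, 'r) module" and M :: "('k, 'r, 'm) bimod" and N :: "('k, 'r, 'n) bimod" +
  assumes ract_in: "\<lbrakk>m \<in> carrier M; r \<in> carrier R\<rbrakk> \<Longrightarrow> ract M m r \<in> carrier M"
    and lact_in: "\<lbrakk>r \<in> carrier R; n \<in> carrier N\<rbrakk> \<Longrightarrow> lact N r n \<in> carrier N"
begin

abbreviation T where "T \<equiv> tensor R M N"

abbreviation tns (infixl "\<otimes>\<^sub>t" 72) where "m \<otimes>\<^sub>t n \<equiv> tens R M N m n"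

sublocale pg: presented_group T "tensor_rels R M N" "carrier M \<times> carrier N"
proof
  show "Poly_Mapping.keys r \<subseteq> carrier M \<times> carrier N" if "r \<in> tensor_rels R M N" for r
    using that unfolding tensor_rels_def
    by (elim UnE CollectE exE conjE; hypsubst; intro order_trans[OF keys_diff_of(1)] order_trans[OF keys_diff_of(2)])
       (auto intro: ract_in lact_in)
qed (simp_all add: tensor_def Let_def)

lemma abelian_group: "abelian_group T"
  by (rule pg.abelian_group)

lemma tens_closed: "m \<in> carrier M \<Longrightarrow> n \<in> carrier N \<Longrightarrow> m \<otimes>\<^sub>t n \<in> carrier T"
  unfolding tens_def by (rule pg.monomial_closed) auto

lemma bilift_closed:
  assumes "abelian_group A" "S \<in> carrier T" "\<And>m n. \<lbrakk>m \<in> carrier M; n \<in> carrier N\<rbrakk> \<Longrightarrow> f m n \<in> carrier A"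
  shows "bilift A f S \<in> carrier A"
  by (rule pg.pres_lift_closed) (use assms in auto)

lemma bilift_cong:
  assumes "abelian_group A" "S \<in> carrier T" "\<And>m n. \<lbrakk>m \<in> carrier M; n \<in> carrier N\<rbrakk> \<Longrightarrow> f m n = g m n"
    "\<And>m n. \<lbrakk>m \<in> carrier M; n \<in> carrier N\<rbrakk> \<Longrightarrow> g m n \<in> carrier A"
  shows "bilift A f S = bilift A g S"
  by (rule pg.pres_lift_cong) (use assms in auto)

lemma bilift_fun_add:
  assumes "abelian_group A" "S \<in> carrier T"
    "\<And>m n. \<lbrakk>m \<in> carrier M; n \<in> carrier N\<rbrakk> \<Longrightarrow> h m n = f m n \<oplus>\<^bsub>A\<^esub> g m n"
    "\<And>m n. \<lbrakk>m \<in> carrier M; n \<in> carrier N\<rbrakk> \<Longrightarrow> f m n \<in> carrier A"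
    "\<And>m n. \<lbrakk>m \<in> carrier M; n \<in> carrier N\<rbrakk> \<Longrightarrow> g m n \<in> carrier A"
  shows "bilift A h S = bilift A f S \<oplus>\<^bsub>A\<^esub> bilift A g S"
proof -
  interpret abelian_group A by fact
  have "bilift A h S = bilift A (\<lambda>m n. f m n \<oplus>\<^bsub>A\<^esub> g m n) S"
    by (rule bilift_cong[OF assms(1,2)]) (use assms(3-5) in auto)
  then show ?thesis
    using pg.pres_lift_fun_add[OF assms(1,2), of "case_prod f" "case_prod g"] assms(4,5)
    by (simp add: split_beta' mem_Times_iff)
qed

lemma hom_bilift:
  assumes "abelian_group A" "abelian_group A'" "h \<in> additive_maps A A'" "S \<in> carrier T"
    "\<And>m n. \<lbrakk>m \<in> carrier M; n \<in> carrier N\<rbrakk> \<Longrightarrow> f m n \<in> carrier A"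
  shows "h (bilift A f S) = bilift A' (\<lambda>m n. h (f m n)) S"
  using pg.hom_pres_lift[OF assms(1-4), of "case_prod f"] assms(5)
  by (simp add: split_beta' mem_Times_iff)

text \<open>The three families in \<open>tensor_rels\<close> are the two additivity laws and the
  middle law of \<open>balanced\<close>, so each generator evaluates to zero.\<close>

lemma respects_rels_balanced:
  assumes "abelian_group A" "balanced R M N A f"
  shows "pg.respects_rels A (\<lambda>(m, n). f m n)"
proof -
  interpret A: abelian_group A by fact
  let ?f = "\<lambda>(m, n). f m n"
  show ?thesis
    unfolding pg.respects_rels_def
  proof (intro conjI ballI)
    show "?f \<in> carrier M \<times> carrier N \<rightarrow> carrier A" using balanced_closed[OF assms(2)] by auto
    fix r assume "r \<in> tensor_rels R M N"
    then show "frag_eval A ?f r = \<zero>\<^bsub>A\<^esub>"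
      unfolding tensor_rels_def
      by (elim UnE CollectE exE conjE; hypsubst;
          intro A.frag_eval_diff_of A.frag_eval_diff_diff_of)
         (simp_all add: balancedD[OF assms(2)] lact_in)
  qed
qed

lemma bilift_tens:
  assumes "abelian_group A" "balanced R M N A f" "m \<in> carrier M" "n \<in> carrier N"
  shows "bilift A f (m \<otimes>\<^sub>t n) = f m n"
  unfolding tens_def
  using pg.pres_lift_monomial[OF assms(1) respects_rels_balanced[OF assms(1,2)], of "(m, n)"] assms(3,4)
  by simp

lemma bilift_additive:
  assumes "abelian_group A" "balanced R M N A f"
  shows "bilift A f \<in> additive_maps T A"
  by (rule pg.pres_lift_additive[OF assms(1) respects_rels_balanced[OF assms]])

lemma tensor_ext:
  assumes "abelian_group A" "h \<in> additive_maps T A" "h' \<in> additive_maps T A"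
    "\<And>m n. \<lbrakk>m \<in> carrier M; n \<in> carrier N\<rbrakk> \<Longrightarrow> h (m \<otimes>\<^sub>t n) = h' (m \<otimes>\<^sub>t n)" "S \<in> carrier T"
  shows "h S = h' S"
  by (rule pg.additive_ext[OF assms(1-3) _ assms(5)]) (use assms(4) in \<open>auto simp: tens_def\<close>)

lemma tens_balanced: "balanced R M N T (tens R M N)"
proof (rule balancedI)
  show "m \<otimes>\<^sub>t n \<in> carrier T" if "m \<in> carrier M" "n \<in> carrier N" for m n
    using that by (rule tens_closed)
  show "(m \<oplus>\<^bsub>M\<^esub> m') \<otimes>\<^sub>t n = m \<otimes>\<^sub>t n \<oplus>\<^bsub>T\<^esub> m' \<otimes>\<^sub>t n"
    if "m \<in> carrier M" "m' \<in> carrier M" "n \<in> carrier N" for m m' n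
    unfolding tens_def by (rule pg.monomial_add) (use that in \<open>unfold tensor_rels_def; blast\<close>)
  show "m \<otimes>\<^sub>t (n \<oplus>\<^bsub>N\<^esub> n') = m \<otimes>\<^sub>t n \<oplus>\<^bsub>T\<^esub> m \<otimes>\<^sub>t n'"
    if "m \<in> carrier M" "n \<in> carrier N" "n' \<in> carrier N" for m n n'
    unfolding tens_def by (rule pg.monomial_add) (use that in \<open>unfold tensor_rels_def; blast\<close>)
  show "ract M m r \<otimes>\<^sub>t n = m \<otimes>\<^sub>t lact N r n"
    if "m \<in> carrier M" "r \<in> carrier R" "n \<in> carrier N" for m r n
    unfolding tens_def by (rule pg.monomial_eq) (use that in \<open>unfold tensor_rels_def; blast\<close>)
qed

lemmas tens_add_left = balanced_add_left[OF tens_balanced]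
  and tens_add_right = balanced_add_right[OF tens_balanced]
  and tens_middle = balanced_middle[OF tens_balanced]

lemma bilift_self: "S \<in> carrier T \<Longrightarrow> bilift T (\<lambda>m n. m \<otimes>\<^sub>t n) S = S"
  using pg.pres_lift_monomials by (simp add: tens_def split_beta')

end

text \<open>The left factor is only a right module: \<open>V \<otimes> B\<close> is needed to prove
  that the left action of a comodule \<open>V\<close> obeys the module laws.\<close>

locale module_tensor_product = M: right_module K R M + N: bimodule K R N
  for K :: "'k ring" and R :: "('k, 'r) module" and M :: "('k, 'r, 'm) bimod" and N :: "('k, 'r, 'n) bimod"
begin

sublocale tensor_product R M N
  by unfold_locales (auto intro: M.ract_closed N.lact_closed)

text \<open>There is no relation for scalars of \<open>K\<close> in \<open>tensor_rels\<close>; a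
  scalar \<open>k\<close> crosses the tensor sign as \<open>k\<close> times the unit of
  \<open>R\<close>.\<close>

lemma tens_smult_middle:
  assumes "k \<in> carrier K" "m \<in> carrier M" "n \<in> carrier N"
  shows "(k \<odot>\<^bsub>M\<^esub> m) \<otimes>\<^sub>t n = m \<otimes>\<^sub>t (k \<odot>\<^bsub>N\<^esub> n)"
proof -
  have "k \<odot>\<^bsub>M\<^esub> m = ract M m (k \<odot>\<^bsub>R\<^esub> \<one>\<^bsub>R\<^esub>)" "k \<odot>\<^bsub>N\<^esub> n = lact N (k \<odot>\<^bsub>R\<^esub> \<one>\<^bsub>R\<^esub>) n"
    using assms by (simp_all add: M.ract_smult_right M.ract_one N.lact_smult_left N.lact_one)
  then show ?thesis using assms by (simp add: tens_middle)
qed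

lemma smult_eq: "S \<in> carrier T \<Longrightarrow> k \<in> carrier K \<Longrightarrow> k \<odot>\<^bsub>T\<^esub> S = bilift T (\<lambda>m n. (k \<odot>\<^bsub>M\<^esub> m) \<otimes>\<^sub>t n) S"
  using pg.cls_frag_extend_some_rep[of S "\<lambda>(m, n). (k \<odot>\<^bsub>M\<^esub> m, n)"]
  by (auto simp: tensor_def Let_def tens_def split_beta')

lemma ract_tensor_eq: "S \<in> carrier T \<Longrightarrow> r \<in> carrier R \<Longrightarrow> ract T S r = bilift T (\<lambda>m n. m \<otimes>\<^sub>t ract N n r) S"
  using pg.cls_frag_extend_some_rep[of S "\<lambda>(m, n). (m, ract N n r)"] N.ract_closed
  by (auto simp: tensor_def Let_def tens_def split_beta')

lemma smult_balanced: "k \<in> carrier K \<Longrightarrow> balanced R M N T (\<lambda>m n. (k \<odot>\<^bsub>M\<^esub> m) \<otimes>\<^sub>t n)"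
  by (rule balancedI)
     (simp_all add: tens_closed tens_add_right M.smult_r_distr tens_add_left
       M.ract_smult_left[symmetric] tens_middle)

lemma ract_balanced: "r \<in> carrier R \<Longrightarrow> balanced R M N T (\<lambda>m n. m \<otimes>\<^sub>t ract N n r)"
  by (rule balancedI)
     (simp_all add: tens_closed tens_add_right tens_add_left N.ract_closed N.ract_add_left
       N.lact_ract N.lact_closed tens_middle)

lemma smult_additive: "k \<in> carrier K \<Longrightarrow> (\<lambda>S. k \<odot>\<^bsub>T\<^esub> S) \<in> additive_maps T T"
  by (rule additive_maps_cong[OF abelian_group bilift_additive[OF abelian_group smult_balanced]]) (auto simp: smult_eq)

lemma ract_additive: "r \<in> carrier R \<Longrightarrow> (\<lambda>S. ract T S r) \<in> additive_maps T T"
  by (rule additive_maps_cong[OF abelian_group bilift_additive[OF abelian_group ract_balanced]]) (auto simp: ract_tensor_eq)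

lemma smult_tens: "\<lbrakk>k \<in> carrier K; m \<in> carrier M; n \<in> carrier N\<rbrakk> \<Longrightarrow> k \<odot>\<^bsub>T\<^esub> (m \<otimes>\<^sub>t n) = (k \<odot>\<^bsub>M\<^esub> m) \<otimes>\<^sub>t n"
  by (simp add: smult_eq tens_closed bilift_tens[OF abelian_group smult_balanced])

lemma ract_tens: "\<lbrakk>r \<in> carrier R; m \<in> carrier M; n \<in> carrier N\<rbrakk> \<Longrightarrow> ract T (m \<otimes>\<^sub>t n) r = m \<otimes>\<^sub>t ract N n r"
  by (simp add: ract_tensor_eq tens_closed bilift_tens[OF abelian_group ract_balanced])

end

locale bimodule_tensor_product = module_tensor_product K R M N + M: bimodule K R M
  for K :: "'k ring" and R :: "('k, 'r) module" and M :: "('k, 'r, 'm) bimod" and N :: "('k, 'r, 'n) bimod"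
begin

lemma lact_tensor_eq: "S \<in> carrier T \<Longrightarrow> r \<in> carrier R \<Longrightarrow> lact T r S = bilift T (\<lambda>m n. lact M r m \<otimes>\<^sub>t n) S"
  using pg.cls_frag_extend_some_rep[of S "\<lambda>(m, n). (lact M r m, n)"] M.lact_closed
  by (auto simp: tensor_def Let_def tens_def split_beta')

lemma lact_balanced: "r \<in> carrier R \<Longrightarrow> balanced R M N T (\<lambda>m n. lact M r m \<otimes>\<^sub>t n)"
  by (rule balancedI)
     (simp_all add: tens_closed tens_add_right tens_add_left M.lact_closed M.lact_add_right
       M.lact_ract[symmetric] tens_middle)

lemma lact_additive: "r \<in> carrier R \<Longrightarrow> (\<lambda>S. lact T r S) \<in> additive_maps T T"
  by (rule additive_maps_cong[OF abelian_group bilift_additive[OF abelian_group lact_balanced]]) (auto simp: lact_tensor_eq)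

lemma lact_tens: "\<lbrakk>r \<in> carrier R; m \<in> carrier M; n \<in> carrier N\<rbrakk> \<Longrightarrow> lact T r (m \<otimes>\<^sub>t n) = lact M r m \<otimes>\<^sub>t n"
  by (simp add: lact_tensor_eq tens_closed bilift_tens[OF abelian_group lact_balanced])

end

lemma bilift_swap:
  assumes "tensor_product R M N" "tensor_product R' M' N'" "abelian_group A"
    "S \<in> carrier (tensor R M N)" "U \<in> carrier (tensor R' M' N')"
    "\<And>m n m' n'. \<lbrakk>m \<in> carrier M; n \<in> carrier N; m' \<in> carrier M'; n' \<in> carrier N'\<rbrakk> \<Longrightarrow> f m n m' n' \<in> carrier A"
  shows "bilift A (\<lambda>m n. bilift A (\<lambda>m' n'. f m n m' n') U) S = bilift A (\<lambda>m' n'. bilift A (\<lambda>m n. f m n m' n') S) U"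
proof -
  interpret T: tensor_product R M N by fact
  interpret T': tensor_product R' M' N' by fact
  show ?thesis
    using pres_lift_swap[OF T.pg.presented_group_axioms T'.pg.presented_group_axioms assms(3-5),
      of "\<lambda>(m, n) (m', n'). f m n m' n'"] assms(6)
    by (simp add: split_beta' mem_Times_iff)
qed

section \<open>Sweedler calculus\<close>

context tensor_product
begin

text \<open>Substitution in Sweedler notation. The balancing condition falls on the outer
  \<open>F\<close>: its lift is additive and passes through the inner lift, a finite sum of tensor
  monomials.\<close>

lemma bilift_bilift_tens:
  assumes "abelian_group A" "balanced R M N A F"
    and "tensor_product R' M' N'" "S \<in> carrier (tensor R' M' N')"
    and "\<And>m n. \<lbrakk>m \<in> carrier M'; n \<in> carrier N'\<rbrakk> \<Longrightarrow> f m n \<in> carrier M"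
    and "\<And>m n. \<lbrakk>m \<in> carrier M'; n \<in> carrier N'\<rbrakk> \<Longrightarrow> g m n \<in> carrier N"
  shows "bilift A F (bilift T (\<lambda>m n. f m n \<otimes>\<^sub>t g m n) S) = bilift A (\<lambda>m n. F (f m n) (g m n)) S"
proof -
  interpret T': tensor_product R' M' N' by fact
  have "bilift A F (bilift T (\<lambda>m n. f m n \<otimes>\<^sub>t g m n) S) = bilift A (\<lambda>m n. bilift A F (f m n \<otimes>\<^sub>t g m n)) S"
    by (rule T'.hom_bilift[OF abelian_group assms(1) bilift_additive[OF assms(1,2)] assms(4)])
       (simp add: assms tens_closed)
  also have "\<dots> = bilift A (\<lambda>m n. F (f m n) (g m n)) S"
    by (rule T'.bilift_cong[OF assms(1,4)])
       (simp_all add: assms bilift_tens[OF assms(1,2)] balanced_closed[OF assms(2)])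
  finally show ?thesis .
qed

lemma bilift_tensor_map:
  assumes "abelian_group A" "balanced R M N A F"
    and "tensor_product R' M' N'" "S \<in> carrier (tensor R' M' N')"
    and "\<And>m. m \<in> carrier M' \<Longrightarrow> f m \<in> carrier M" "\<And>n. n \<in> carrier N' \<Longrightarrow> g n \<in> carrier N"
  shows "bilift A F (tensor_map R M N f g S) = bilift A (\<lambda>m n. F (f m) (g n)) S"
  unfolding tensor_map_def by (rule bilift_bilift_tens[OF assms(1-4)]) (use assms in auto)

lemma tensor_map_closed:
  assumes "tensor_product R' M' N'" "S \<in> carrier (tensor R' M' N')"
    and "\<And>m. m \<in> carrier M' \<Longrightarrow> f m \<in> carrier M" "\<And>n. n \<in> carrier N' \<Longrightarrow> g n \<in> carrier N"
  shows "tensor_map R M N f g S \<in> carrier T"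
  unfolding tensor_map_def
  by (rule tensor_product.bilift_closed[OF assms(1) abelian_group assms(2)]) (use assms in \<open>auto intro: tens_closed\<close>)

end

text \<open>Balanced across each of the two tensor signs, with the remaining argument fixed; this is
  what allows a lift through either bracketing.\<close>

definition tribalanced ::
  "('k, 'r) module \<Rightarrow> ('k, 'r, 'l) bimod \<Rightarrow> ('k, 'r, 'm) bimod \<Rightarrow> ('k, 'r, 'n) bimod
    \<Rightarrow> ('p, 'q) ring_scheme \<Rightarrow> ('l \<Rightarrow> 'm \<Rightarrow> 'n \<Rightarrow> 'p) \<Rightarrow> bool" where
  "tribalanced R L M N A f \<longleftrightarrow>
     (\<forall>l\<in>carrier L. balanced R M N A (f l)) \<and>
     (\<forall>n\<in>carrier N. balanced R L M A (\<lambda>l m. f l m n))"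

lemma tribalancedI:
  assumes "\<And>l. l \<in> carrier L \<Longrightarrow> balanced R M N A (f l)"
    and "\<And>n. n \<in> carrier N \<Longrightarrow> balanced R L M A (\<lambda>l m. f l m n)"
  shows "tribalanced R L M N A f"
  using assms by (auto simp: tribalanced_def)

lemma tribalanced_right: "tribalanced R L M N A f \<Longrightarrow> l \<in> carrier L \<Longrightarrow> balanced R M N A (f l)"
  and tribalanced_left: "tribalanced R L M N A f \<Longrightarrow> n \<in> carrier N \<Longrightarrow> balanced R L M A (\<lambda>l m. f l m n)"
  by (auto simp: tribalanced_def)

lemma tribalanced_closed:
  "tribalanced R L M N A f \<Longrightarrow> l \<in> carrier L \<Longrightarrow> m \<in> carrier M \<Longrightarrow> n \<in> carrier N \<Longrightarrow> f l m n \<in> carrier A"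
  by (meson tribalanced_right balanced_closed)

text \<open>\<open>LMN\<close> stands for \<open>L \<otimes> (M \<otimes> N)\<close> and
  \<open>LMN'\<close> for \<open>(L \<otimes> M) \<otimes> N\<close>. As before, \<open>L\<close> is
  only a right module so that a comodule may stand there.\<close>

locale tensor_triple = L: right_module K R L + M: bimodule K R M + N: bimodule K R N
  for K :: "'k ring" and R :: "('k, 'r) module" and L :: "('k, 'r, 'l) bimod"
    and M :: "('k, 'r, 'm) bimod" and N :: "('k, 'r, 'n) bimod"
begin

sublocale LM: module_tensor_product K R L M ..

sublocale MN: bimodule_tensor_product K R M N ..

sublocale LMN: tensor_product R L "tensor R M N"
  by (intro tensor_product.intro tensor_product_axioms.intro L.abelian_group_axioms MN.abelian_group L.ract_closed
      additive_maps_closed[OF MN.lact_additive])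

sublocale LMN': tensor_product R "tensor R L M" N
  by (intro tensor_product.intro tensor_product_axioms.intro LM.abelian_group N.abelian_group_axioms N.lact_closed
      additive_maps_closed[OF LM.ract_additive])

text \<open>\<open>R\<close> acts on \<open>M \<otimes> N\<close> from the left through
  \<open>M\<close>, so balancing between \<open>L\<close> and \<open>M \<otimes> N\<close> comes
  from balancing of \<open>f\<close> in its first two arguments.\<close>

lemma balanced_bilift_right:
  assumes A: "abelian_group A" and f: "tribalanced R L M N A f"
  shows "balanced R L (tensor R M N) A (\<lambda>l U. bilift A (f l) U)"
proof (rule balancedI)
  note fl = tribalanced_right[OF f] and fr = tribalanced_left[OF f]
  show cl: "bilift A (f l) U \<in> carrier A" if "l \<in> carrier L" "U \<in> carrier (tensor R M N)" for l U
    by (rule MN.bilift_closed[OF A that(2)]) (simp add: that tribalanced_closed[OF f])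
  show "bilift A (f (l \<oplus>\<^bsub>L\<^esub> l')) U = bilift A (f l) U \<oplus>\<^bsub>A\<^esub> bilift A (f l') U"
    if "l \<in> carrier L" "l' \<in> carrier L" "U \<in> carrier (tensor R M N)" for l l' U
    by (rule MN.bilift_fun_add[OF A that(3)])
       (simp_all add: that balanced_add_left[OF fr] tribalanced_closed[OF f])
  show "bilift A (f l) (U \<oplus>\<^bsub>tensor R M N\<^esub> U') = bilift A (f l) U \<oplus>\<^bsub>A\<^esub> bilift A (f l) U'"
    if "l \<in> carrier L" "U \<in> carrier (tensor R M N)" "U' \<in> carrier (tensor R M N)" for l U U'
    by (rule additive_maps_add[OF MN.bilift_additive[OF A fl[OF that(1)]] that(2,3)])
  show "bilift A (f (ract L l r)) U = bilift A (f l) (lact (tensor R M N) r U)"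
    if "l \<in> carrier L" "r \<in> carrier R" "U \<in> carrier (tensor R M N)" for l r U
    unfolding MN.lact_tensor_eq[OF that(3,2)]
    by (subst MN.bilift_bilift_tens[OF A fl[OF that(1)] MN.tensor_product_axioms that(3)])
       (use that in \<open>auto intro!: MN.bilift_cong[OF A that(3)] M.lact_closed tribalanced_closed[OF f]
          simp: balanced_middle[OF fr]\<close>)
qed

lemma balanced_bilift_left:
  assumes A: "abelian_group A" and f: "tribalanced R L M N A f"
  shows "balanced R (tensor R L M) N A (\<lambda>U n. bilift A (\<lambda>l m. f l m n) U)"
proof (rule balancedI)
  note fl = tribalanced_right[OF f] and fr = tribalanced_left[OF f]
  show cl: "bilift A (\<lambda>l m. f l m n) U \<in> carrier A" if "U \<in> carrier (tensor R L M)" "n \<in> carrier N" for n U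
    by (rule LM.bilift_closed[OF A that(1)]) (simp add: that tribalanced_closed[OF f])
  show "bilift A (\<lambda>l m. f l m (n \<oplus>\<^bsub>N\<^esub> n')) U = bilift A (\<lambda>l m. f l m n) U \<oplus>\<^bsub>A\<^esub> bilift A (\<lambda>l m. f l m n') U"
    if "U \<in> carrier (tensor R L M)" "n \<in> carrier N" "n' \<in> carrier N" for n n' U
    by (rule LM.bilift_fun_add[OF A that(1)])
       (simp_all add: that balanced_add_right[OF fl] tribalanced_closed[OF f])
  show "bilift A (\<lambda>l m. f l m n) (U \<oplus>\<^bsub>tensor R L M\<^esub> U')
      = bilift A (\<lambda>l m. f l m n) U \<oplus>\<^bsub>A\<^esub> bilift A (\<lambda>l m. f l m n) U'"
    if "U \<in> carrier (tensor R L M)" "U' \<in> carrier (tensor R L M)" "n \<in> carrier N" for n U U'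
    by (rule additive_maps_add[OF LM.bilift_additive[OF A fr[OF that(3)]] that(1,2)])
  show "bilift A (\<lambda>l m. f l m n) (ract (tensor R L M) U r) = bilift A (\<lambda>l m. f l m (lact N r n)) U"
    if "U \<in> carrier (tensor R L M)" "r \<in> carrier R" "n \<in> carrier N" for n r U
    unfolding LM.ract_tensor_eq[OF that(1,2)]
    by (subst LM.bilift_bilift_tens[OF A fr[OF that(3)] LM.tensor_product_axioms that(1)])
       (use that in \<open>auto intro!: LM.bilift_cong[OF A that(1)] M.ract_closed N.lact_closed tribalanced_closed[OF f]
          simp: balanced_middle[OF fl]\<close>)
qed

lemma tribalanced_assoc: "tribalanced R L M N LMN.T (\<lambda>l m n. LMN.tns l (MN.tns m n))"
proof (rule tribalancedI)
  show "balanced R M N LMN.T (\<lambda>m n. LMN.tns l (MN.tns m n))" if "l \<in> carrier L" for l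
    by (rule balancedI) (simp_all add: that MN.tens_closed LMN.tens_closed MN.tens_add_left
        MN.tens_add_right LMN.tens_add_right MN.tens_middle)
  show "balanced R L M LMN.T (\<lambda>l m. LMN.tns l (MN.tns m n))" if "n \<in> carrier N" for n
    by (rule balancedI) (simp_all add: that MN.tens_closed LMN.tens_closed MN.tens_add_left
        LMN.tens_add_right LMN.tens_add_left LMN.tens_middle MN.lact_tens)
qed

lemma tribalanced_assoc_inv: "tribalanced R L M N LMN'.T (\<lambda>l m n. LMN'.tns (LM.tns l m) n)"
proof (rule tribalancedI)
  show "balanced R M N LMN'.T (\<lambda>m n. LMN'.tns (LM.tns l m) n)" if "l \<in> carrier L" for l
    by (rule balancedI) (simp_all add: that LM.tens_closed LMN'.tens_closed LM.tens_add_right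
        LMN'.tens_add_left LMN'.tens_add_right LMN'.tens_middle[symmetric] LM.ract_tens)
  show "balanced R L M LMN'.T (\<lambda>l m. LMN'.tns (LM.tns l m) n)" if "n \<in> carrier N" for n
    by (rule balancedI) (simp_all add: that LM.tens_closed LMN'.tens_closed LM.tens_add_left
        LM.tens_add_right LMN'.tens_add_left LM.tens_middle)
qed

lemma assoc_additive: "tensor_assoc R L M N \<in> additive_maps LMN'.T LMN.T"
  using LMN'.bilift_additive[OF LMN.abelian_group balanced_bilift_left[OF LMN.abelian_group tribalanced_assoc]]
  by (simp add: tensor_assoc_def Let_def)

lemma assoc_inv_additive: "tensor_assoc_inv R L M N \<in> additive_maps LMN.T LMN'.T"
  using LMN.bilift_additive[OF LMN'.abelian_group balanced_bilift_right[OF LMN'.abelian_group tribalanced_assoc_inv]]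
  by (simp add: tensor_assoc_inv_def Let_def)

lemma assoc_tens:
  "\<lbrakk>U \<in> carrier LM.T; n \<in> carrier N\<rbrakk>
    \<Longrightarrow> tensor_assoc R L M N (LMN'.tns U n) = bilift LMN.T (\<lambda>l m. LMN.tns l (MN.tns m n)) U"
  by (simp add: tensor_assoc_def Let_def
      LMN'.bilift_tens[OF LMN.abelian_group balanced_bilift_left[OF LMN.abelian_group tribalanced_assoc]])

lemma assoc_inv_tens:
  "\<lbrakk>l \<in> carrier L; U \<in> carrier MN.T\<rbrakk>
    \<Longrightarrow> tensor_assoc_inv R L M N (LMN.tns l U) = bilift LMN'.T (\<lambda>m n. LMN'.tns (LM.tns l m) n) U"
  by (simp add: tensor_assoc_inv_def Let_def
      LMN.bilift_tens[OF LMN'.abelian_group balanced_bilift_right[OF LMN'.abelian_group tribalanced_assoc_inv]])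

text \<open>Both sides are additive, so elements \<open>V \<otimes> n\<close> suffice; there
  \<open>assoc_tens\<close> expands the associator into monomials. From here on rebracketing is
  invisible in Sweedler notation.\<close>

lemma bilift_tensor_assoc:
  assumes A: "abelian_group A" and f: "tribalanced R L M N A f" and U: "U \<in> carrier LMN'.T"
  shows "bilift A (\<lambda>l V. bilift A (f l) V) (tensor_assoc R L M N U)
    = bilift A (\<lambda>V n. bilift A (\<lambda>l m. f l m n) V) U"
proof (rule LMN'.tensor_ext[OF A additive_maps_comp[OF assoc_additive LMN.bilift_additive[OF A balanced_bilift_right[OF A f]]]
      LMN'.bilift_additive[OF A balanced_bilift_left[OF A f]] _ U])
  fix V n assume V: "V \<in> carrier LM.T" and n: "n \<in> carrier N"
  have "bilift A (\<lambda>l V. bilift A (f l) V) (tensor_assoc R L M N (LMN'.tns V n))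
      = bilift A (\<lambda>l m. bilift A (f l) (MN.tns m n)) V"
    unfolding assoc_tens[OF V n]
    by (rule LMN.bilift_bilift_tens[OF A balanced_bilift_right[OF A f] LM.tensor_product_axioms V])
       (simp_all add: MN.tens_closed n)
  also have "\<dots> = bilift A (\<lambda>l m. f l m n) V"
    by (rule LM.bilift_cong[OF A V])
       (simp_all add: n MN.bilift_tens[OF A tribalanced_right[OF f]] tribalanced_closed[OF f])
  also have "\<dots> = bilift A (\<lambda>V n. bilift A (\<lambda>l m. f l m n) V) (LMN'.tns V n)"
    by (rule LMN'.bilift_tens[OF A balanced_bilift_left[OF A f] V n, symmetric])
  finally show "bilift A (\<lambda>l V. bilift A (f l) V) (tensor_assoc R L M N (LMN'.tns V n))
    = bilift A (\<lambda>V n. bilift A (\<lambda>l m. f l m n) V) (LMN'.tns V n)" .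
qed

text \<open>The modules \<open>L'\<close>, \<open>N'\<close> and the maps \<open>g\<close>,
  \<open>g'\<close> are kept apart so that one proof covers a coring, where both maps are the
  comultiplication, and a comodule, where \<open>g\<close> is the coaction and \<open>g'\<close> the
  comultiplication.\<close>

lemma sweedler_coassoc:
  assumes A: "abelian_group A" and f: "tribalanced R L M N A f"
    and S: "tensor_product R' L' N" "S \<in> carrier (tensor R' L' N)"
      "\<And>l. l \<in> carrier L' \<Longrightarrow> g l \<in> carrier LM.T"
    and S': "tensor_product R'' L N'" "S' \<in> carrier (tensor R'' L N')"
      "\<And>n. n \<in> carrier N' \<Longrightarrow> g' n \<in> carrier MN.T"
    and eq: "tensor_assoc R L M N (tensor_map R LM.T N g (\<lambda>n. n) S) = tensor_map R L MN.T (\<lambda>l. l) g' S'"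
  shows "bilift A (\<lambda>l' n. bilift A (\<lambda>l m. f l m n) (g l')) S = bilift A (\<lambda>l n'. bilift A (f l) (g' n')) S'"
proof -
  have "bilift A (\<lambda>l' n. bilift A (\<lambda>l m. f l m n) (g l')) S
      = bilift A (\<lambda>V n. bilift A (\<lambda>l m. f l m n) V) (tensor_map R LM.T N g (\<lambda>n. n) S)"
    by (rule LMN'.bilift_tensor_map[OF A balanced_bilift_left[OF A f] S(1,2), symmetric]) (use S(3) in auto)
  also have "\<dots> = bilift A (\<lambda>l V. bilift A (f l) V) (tensor_map R L MN.T (\<lambda>l. l) g' S')"
    unfolding eq[symmetric]
    by (rule bilift_tensor_assoc[OF A f, symmetric]) (rule LMN'.tensor_map_closed[OF S(1,2)], use S(3) in auto)
  also have "\<dots> = bilift A (\<lambda>l n'. bilift A (f l) (g' n')) S'"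
    by (rule LMN.bilift_tensor_map[OF A balanced_bilift_right[OF A f] S'(1,2)]) (use S'(3) in auto)
  finally show ?thesis .
qed

end

text \<open>Right linearity of \<open>f\<close> and left linearity of \<open>g\<close> are the
  conditions under which \<open>f \<otimes> g\<close> does not depend on representatives.\<close>

locale tensor_map_hom = S: tensor_product R M N + T: tensor_product R M' N'
  for R :: "('k, 'r) module" and M :: "('k, 'r, 'm) bimod" and N :: "('k, 'r, 'n) bimod"
    and M' :: "('k, 'r, 'm2) bimod" and N' :: "('k, 'r, 'n2) bimod" and f :: "'m \<Rightarrow> 'm2" and g :: "'n \<Rightarrow> 'n2" +
  assumes f_additive: "f \<in> additive_maps M M'" and g_additive: "g \<in> additive_maps N N'"
    and f_ract: "\<lbrakk>m \<in> carrier M; r \<in> carrier R\<rbrakk> \<Longrightarrow> f (ract M m r) = ract M' (f m) r"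
    and g_lact: "\<lbrakk>r \<in> carrier R; n \<in> carrier N\<rbrakk> \<Longrightarrow> g (lact N r n) = lact N' r (g n)"
begin

lemma tensor_map_balanced: "balanced R M N T.T (\<lambda>m n. T.tns (f m) (g n))"
  by (rule balancedI)
     (simp_all add: additive_maps_closed[OF f_additive] additive_maps_closed[OF g_additive] T.tens_closed
       additive_maps_add[OF f_additive] additive_maps_add[OF g_additive] T.tens_add_left T.tens_add_right
       f_ract g_lact T.tens_middle)

lemma tensor_map_additive: "tensor_map R M' N' f g \<in> additive_maps S.T T.T"
  unfolding tensor_map_def by (rule S.bilift_additive[OF T.abelian_group tensor_map_balanced])

lemma tensor_map_tens:
  "\<lbrakk>m \<in> carrier M; n \<in> carrier N\<rbrakk> \<Longrightarrow> tensor_map R M' N' f g (S.tns m n) = T.tns (f m) (g n)"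
  unfolding tensor_map_def by (rule S.bilift_tens[OF T.abelian_group tensor_map_balanced])

end

section \<open>Sweedler rules for corings\<close>

context coring
begin

sublocale CC: bimodule_tensor_product K R C C ..

sublocale CCC: tensor_triple K R C C C ..

lemma comult_additive: "\<Delta> \<in> additive_maps C CC.T"
  using comult_hom by (auto simp: bimodule_hom_def right_module_hom_def intro: linear_maps_additive)

lemma comult_closed: "c \<in> carrier C \<Longrightarrow> \<Delta> c \<in> carrier CC.T"
  by (rule additive_maps_closed[OF comult_additive])

lemma comult_ract: "\<lbrakk>c \<in> carrier C; r \<in> carrier R\<rbrakk> \<Longrightarrow> \<Delta> (ract C c r) = ract CC.T (\<Delta> c) r"
  and comult_lact: "\<lbrakk>r \<in> carrier R; c \<in> carrier C\<rbrakk> \<Longrightarrow> \<Delta> (lact C r c) = lact CC.T r (\<Delta> c)"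
  using comult_hom by (auto simp: bimodule_hom_def right_module_hom_def)

lemma counit_closed: "c \<in> carrier C \<Longrightarrow> \<epsilon> c \<in> carrier R"
  using counit_hom by (auto simp: bimodule_hom_def right_module_hom_def linear_maps_def regular_bimod_def
      module.defs bimod.defs)

lemma counit_add: "\<lbrakk>c \<in> carrier C; c' \<in> carrier C\<rbrakk> \<Longrightarrow> \<epsilon> (c \<oplus>\<^bsub>C\<^esub> c') = \<epsilon> c \<oplus>\<^bsub>R\<^esub> \<epsilon> c'"
  and counit_smult: "\<lbrakk>k \<in> carrier K; c \<in> carrier C\<rbrakk> \<Longrightarrow> \<epsilon> (k \<odot>\<^bsub>C\<^esub> c) = k \<odot>\<^bsub>R\<^esub> \<epsilon> c"
  and counit_ract: "\<lbrakk>c \<in> carrier C; r \<in> carrier R\<rbrakk> \<Longrightarrow> \<epsilon> (ract C c r) = \<epsilon> c \<otimes>\<^bsub>R\<^esub> r"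
  and counit_lact: "\<lbrakk>r \<in> carrier R; c \<in> carrier C\<rbrakk> \<Longrightarrow> \<epsilon> (lact C r c) = r \<otimes>\<^bsub>R\<^esub> \<epsilon> c"
  using counit_hom by (auto simp: bimodule_hom_def right_module_hom_def linear_maps_def regular_bimod_def
      module.defs bimod.defs)

lemma coassoc_sweedler:
  assumes "abelian_group A" "tribalanced R C C C A f" "c \<in> carrier C"
  shows "bilift A (\<lambda>a b. bilift A (\<lambda>p q. f p q b) (\<Delta> a)) (\<Delta> c) = bilift A (\<lambda>a b. bilift A (f a) (\<Delta> b)) (\<Delta> c)"
  by (rule CCC.sweedler_coassoc[OF assms(1,2) CC.tensor_product_axioms comult_closed[OF assms(3)] comult_closed
        CC.tensor_product_axioms comult_closed[OF assms(3)] comult_closed coassoc[OF assms(3)]])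

lemma bilift_comult_add:
  assumes "abelian_group A" "balanced R C C A f" "c \<in> carrier C" "c' \<in> carrier C"
  shows "bilift A f (\<Delta> (c \<oplus>\<^bsub>C\<^esub> c')) = bilift A f (\<Delta> c) \<oplus>\<^bsub>A\<^esub> bilift A f (\<Delta> c')"
  using additive_maps_add[OF CC.bilift_additive[OF assms(1,2)]] assms(3,4)
  by (simp add: additive_maps_add[OF comult_additive] comult_closed)

lemma bilift_comult_ract:
  assumes "abelian_group A" "balanced R C C A f" "c \<in> carrier C" "r \<in> carrier R"
  shows "bilift A f (\<Delta> (ract C c r)) = bilift A (\<lambda>a b. f a (ract C b r)) (\<Delta> c)"
  unfolding comult_ract[OF assms(3,4)] CC.ract_tensor_eq[OF comult_closed[OF assms(3)] assms(4)]
  by (rule CC.bilift_bilift_tens[OF assms(1,2) CC.tensor_product_axioms comult_closed[OF assms(3)]])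
     (simp_all add: assms ract_closed)

lemma bilift_comult_lact:
  assumes "abelian_group A" "balanced R C C A f" "c \<in> carrier C" "r \<in> carrier R"
  shows "bilift A f (\<Delta> (lact C r c)) = bilift A (\<lambda>a b. f (lact C r a) b) (\<Delta> c)"
  unfolding comult_lact[OF assms(4,3)] CC.lact_tensor_eq[OF comult_closed[OF assms(3)] assms(4)]
  by (rule CC.bilift_bilift_tens[OF assms(1,2) CC.tensor_product_axioms comult_closed[OF assms(3)]])
     (simp_all add: assms lact_closed)

end

section \<open>Bialgebroids and comodules\<close>

lemma bialgebroid_bimod_simps [simp]:
  "carrier (bialgebroid_bimod B \<xi> \<zeta>) = carrier B"
  "add (bialgebroid_bimod B \<xi> \<zeta>) = add B"
  "zero (bialgebroid_bimod B \<xi> \<zeta>) = zero B"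
  "smult (bialgebroid_bimod B \<xi> \<zeta>) = smult B"
  "lact (bialgebroid_bimod B \<xi> \<zeta>) r b = b \<otimes>\<^bsub>B\<^esub> \<zeta> r"
  "ract (bialgebroid_bimod B \<xi> \<zeta>) b r = b \<otimes>\<^bsub>B\<^esub> \<xi> r"
  by (simp_all add: bialgebroid_bimod_def module.defs bimod.defs)

context right_bialgebroid
begin

abbreviation BB where "BB \<equiv> bialgebroid_bimod B \<xi> \<zeta>"

lemma source_closed [simp]: "r \<in> carrier R \<Longrightarrow> \<xi> r \<in> carrier B"
  and source_mult: "\<lbrakk>r \<in> carrier R; s \<in> carrier R\<rbrakk> \<Longrightarrow> \<xi> (r \<otimes>\<^bsub>R\<^esub> s) = \<xi> r \<otimes>\<^bsub>B\<^esub> \<xi> s"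
  and source_add: "\<lbrakk>r \<in> carrier R; s \<in> carrier R\<rbrakk> \<Longrightarrow> \<xi> (r \<oplus>\<^bsub>R\<^esub> s) = \<xi> r \<oplus>\<^bsub>B\<^esub> \<xi> s"
  and source_one: "\<xi> \<one>\<^bsub>R\<^esub> = \<one>\<^bsub>B\<^esub>"
  and source_smult: "\<lbrakk>k \<in> carrier K; r \<in> carrier R\<rbrakk> \<Longrightarrow> \<xi> (k \<odot>\<^bsub>R\<^esub> r) = k \<odot>\<^bsub>B\<^esub> \<xi> r"
  using source_hom by (auto simp: algebra_hom_def ring_hom_def)

lemma target_closed [simp]: "r \<in> carrier R \<Longrightarrow> \<zeta> r \<in> carrier B"
  and target_mult: "\<lbrakk>r \<in> carrier R; s \<in> carrier R\<rbrakk> \<Longrightarrow> \<zeta> (r \<otimes>\<^bsub>R\<^esub> s) = \<zeta> s \<otimes>\<^bsub>B\<^esub> \<zeta> r"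
  and target_add: "\<lbrakk>r \<in> carrier R; s \<in> carrier R\<rbrakk> \<Longrightarrow> \<zeta> (r \<oplus>\<^bsub>R\<^esub> s) = \<zeta> r \<oplus>\<^bsub>B\<^esub> \<zeta> s"
  using target_hom by (auto simp: algebra_hom_def ring_hom_def op_algebra_def)

lemma counit_closed' [simp]: "b \<in> carrier B \<Longrightarrow> \<epsilon> b \<in> carrier R"
  using counit_closed by simp

lemma comult_closed' [simp]: "b \<in> carrier B \<Longrightarrow> \<Delta> b \<in> carrier CC.T"
  using comult_closed by simp

lemma counit_ract': "\<lbrakk>b \<in> carrier B; r \<in> carrier R\<rbrakk> \<Longrightarrow> \<epsilon> (b \<otimes>\<^bsub>B\<^esub> \<xi> r) = \<epsilon> b \<otimes>\<^bsub>R\<^esub> r"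
  and counit_lact': "\<lbrakk>b \<in> carrier B; r \<in> carrier R\<rbrakk> \<Longrightarrow> \<epsilon> (b \<otimes>\<^bsub>B\<^esub> \<zeta> r) = r \<otimes>\<^bsub>R\<^esub> \<epsilon> b"
  and counit_add': "\<lbrakk>b \<in> carrier B; b' \<in> carrier B\<rbrakk> \<Longrightarrow> \<epsilon> (b \<oplus>\<^bsub>B\<^esub> b') = \<epsilon> b \<oplus>\<^bsub>R\<^esub> \<epsilon> b'"
  and counit_smult': "\<lbrakk>k \<in> carrier K; b \<in> carrier B\<rbrakk> \<Longrightarrow> \<epsilon> (k \<odot>\<^bsub>B\<^esub> b) = k \<odot>\<^bsub>R\<^esub> \<epsilon> b"
  using counit_ract counit_lact counit_add counit_smult by simp_all

lemma counit_source_ract: "\<lbrakk>r \<in> carrier R; b \<in> carrier B; s \<in> carrier R\<rbrakk>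
    \<Longrightarrow> \<epsilon> (\<xi> r \<otimes>\<^bsub>B\<^esub> (b \<otimes>\<^bsub>B\<^esub> \<xi> s)) = \<epsilon> (\<xi> r \<otimes>\<^bsub>B\<^esub> b) \<otimes>\<^bsub>R\<^esub> s"
  and counit_source_lact: "\<lbrakk>r \<in> carrier R; b \<in> carrier B; s \<in> carrier R\<rbrakk>
    \<Longrightarrow> \<epsilon> (\<xi> r \<otimes>\<^bsub>B\<^esub> (b \<otimes>\<^bsub>B\<^esub> \<zeta> s)) = s \<otimes>\<^bsub>R\<^esub> \<epsilon> (\<xi> r \<otimes>\<^bsub>B\<^esub> b)"
  by (simp_all add: B.m_assoc[symmetric] counit_ract' counit_lact')

text \<open>The axiom equates two elements of \<open>B \<otimes> B\<close>; applying the lift of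
  \<open>F\<close> to both and substituting gives the form used in computations.\<close>

lemma takeuchi_sweedler:
  assumes A: "abelian_group A" and F: "balanced R BB BB A F" and r: "r \<in> carrier R" and b: "b \<in> carrier B"
  shows "bilift A (\<lambda>p q. F (\<xi> r \<otimes>\<^bsub>B\<^esub> p) q) (\<Delta> b) = bilift A (\<lambda>p q. F p (\<zeta> r \<otimes>\<^bsub>B\<^esub> q)) (\<Delta> b)"
proof -
  note [simp] = r b
  note tt = CC.bilift_bilift_tens[OF A F CC.tensor_product_axioms comult_closed'[OF b], symmetric]
  have "bilift A (\<lambda>p q. F (\<xi> r \<otimes>\<^bsub>B\<^esub> p) q) (\<Delta> b)
      = bilift A F (bilift CC.T (\<lambda>p q. tens R BB BB (\<xi> r \<otimes>\<^bsub>B\<^esub> p) q) (\<Delta> b))"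
    by (rule tt) auto
  also have "\<dots> = bilift A F (bilift CC.T (\<lambda>p q. tens R BB BB p (\<zeta> r \<otimes>\<^bsub>B\<^esub> q)) (\<Delta> b))"
    using takeuchi[OF r b] by (simp add: Let_def)
  also have "\<dots> = bilift A (\<lambda>p q. F p (\<zeta> r \<otimes>\<^bsub>B\<^esub> q)) (\<Delta> b)"
    by (rule tt[symmetric]) auto
  finally show ?thesis .
qed

text \<open>Takeuchi's condition makes \<open>u \<otimes> v \<mapsto> u b\<^sup>(\<^sup>1\<^sup>) \<otimes> v b\<^sup>(\<^sup>2\<^sup>)\<close> well defined.\<close>

lemma comult_mult_balanced:
  assumes b: "b \<in> carrier B"
  shows "balanced R BB BB CC.T (\<lambda>u v. bilift CC.T (\<lambda>p q. tens R BB BB (u \<otimes>\<^bsub>B\<^esub> p) (v \<otimes>\<^bsub>B\<^esub> q)) (\<Delta> b))"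
proof (rule balancedI)
  note [simp] = b B.l_distr B.r_distr
  have cl: "tens R BB BB p q \<in> carrier CC.T" if "p \<in> carrier B" "q \<in> carrier B" for p q
    using that CC.tens_closed by simp
  have lin: "tens R BB BB (p \<oplus>\<^bsub>B\<^esub> p') q = tens R BB BB p q \<oplus>\<^bsub>CC.T\<^esub> tens R BB BB p' q"
    "tens R BB BB q (p \<oplus>\<^bsub>B\<^esub> p') = tens R BB BB q p \<oplus>\<^bsub>CC.T\<^esub> tens R BB BB q p'"
    if "p \<in> carrier B" "q \<in> carrier B" "p' \<in> carrier B" for p p' q
    using that CC.tens_add_left[of p p' q] CC.tens_add_right[of q p p'] by simp_all
  have mid: "tens R BB BB (p \<otimes>\<^bsub>B\<^esub> \<xi> r) q = tens R BB BB p (q \<otimes>\<^bsub>B\<^esub> \<zeta> r)"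
    if "p \<in> carrier B" "q \<in> carrier B" "r \<in> carrier R" for p q r
    using that CC.tens_middle[of p r q] by simp
  let ?T = CC.T
  show "bilift ?T (\<lambda>p q. tens R BB BB (u \<otimes>\<^bsub>B\<^esub> p) (v \<otimes>\<^bsub>B\<^esub> q)) (\<Delta> b) \<in> carrier ?T"
    if "u \<in> carrier BB" "v \<in> carrier BB" for u v
    using that by (intro CC.bilift_closed CC.abelian_group) (auto intro: cl)
  interpret T: abelian_group ?T by (rule CC.abelian_group)
  show "bilift ?T (\<lambda>p q. tens R BB BB ((u \<oplus>\<^bsub>BB\<^esub> u') \<otimes>\<^bsub>B\<^esub> p) (v \<otimes>\<^bsub>B\<^esub> q)) (\<Delta> b) =
      bilift ?T (\<lambda>p q. tens R BB BB (u \<otimes>\<^bsub>B\<^esub> p) (v \<otimes>\<^bsub>B\<^esub> q)) (\<Delta> b) \<oplus>\<^bsub>?T\<^esub>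
      bilift ?T (\<lambda>p q. tens R BB BB (u' \<otimes>\<^bsub>B\<^esub> p) (v \<otimes>\<^bsub>B\<^esub> q)) (\<Delta> b)"
    if "u \<in> carrier BB" "u' \<in> carrier BB" "v \<in> carrier BB" for u u' v
    using that
    by (intro CC.bilift_fun_add CC.abelian_group) (simp_all add: lin cl)
  show "bilift ?T (\<lambda>p q. tens R BB BB (u \<otimes>\<^bsub>B\<^esub> p) ((v \<oplus>\<^bsub>BB\<^esub> v') \<otimes>\<^bsub>B\<^esub> q)) (\<Delta> b) =
      bilift ?T (\<lambda>p q. tens R BB BB (u \<otimes>\<^bsub>B\<^esub> p) (v \<otimes>\<^bsub>B\<^esub> q)) (\<Delta> b) \<oplus>\<^bsub>?T\<^esub>
      bilift ?T (\<lambda>p q. tens R BB BB (u \<otimes>\<^bsub>B\<^esub> p) (v' \<otimes>\<^bsub>B\<^esub> q)) (\<Delta> b)"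
    if "u \<in> carrier BB" "v \<in> carrier BB" "v' \<in> carrier BB" for u v v'
    using that
    by (intro CC.bilift_fun_add CC.abelian_group) (simp_all add: lin cl)
  show "bilift ?T (\<lambda>p q. tens R BB BB (ract BB u r \<otimes>\<^bsub>B\<^esub> p) (v \<otimes>\<^bsub>B\<^esub> q)) (\<Delta> b) =
      bilift ?T (\<lambda>p q. tens R BB BB (u \<otimes>\<^bsub>B\<^esub> p) (lact BB r v \<otimes>\<^bsub>B\<^esub> q)) (\<Delta> b)"
    if "u \<in> carrier BB" "r \<in> carrier R" "v \<in> carrier BB" for u r v
  proof -
    let ?F = "\<lambda>p q. tens R BB BB (u \<otimes>\<^bsub>B\<^esub> p) (v \<otimes>\<^bsub>B\<^esub> q)"
    note [simp] = that[simplified]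
    have F: "balanced R BB BB ?T ?F"
      by (rule balancedI) (auto simp: cl lin mid B.m_assoc[symmetric])
    have "bilift ?T (\<lambda>p q. tens R BB BB (ract BB u r \<otimes>\<^bsub>B\<^esub> p) (v \<otimes>\<^bsub>B\<^esub> q)) (\<Delta> b)
      = bilift ?T (\<lambda>p q. ?F (\<xi> r \<otimes>\<^bsub>B\<^esub> p) q) (\<Delta> b)"
      by (rule CC.bilift_cong[OF CC.abelian_group]) (auto simp: cl B.m_assoc)
    also have "\<dots> = bilift ?T (\<lambda>p q. ?F p (\<zeta> r \<otimes>\<^bsub>B\<^esub> q)) (\<Delta> b)"
      by (rule takeuchi_sweedler[OF CC.abelian_group F]) auto
    also have "\<dots> = bilift ?T (\<lambda>p q. tens R BB BB (u \<otimes>\<^bsub>B\<^esub> p) (lact BB r v \<otimes>\<^bsub>B\<^esub> q)) (\<Delta> b)"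
      by (rule CC.bilift_cong[OF CC.abelian_group]) (auto simp: cl B.m_assoc)
    finally show ?thesis .
  qed
qed

text \<open>The balancing just proved lets the outer lift of \<open>comult_mult\<close> be evaluated
  at a pure tensor. It is applied to \<open>\<xi> r\<close>, whose comultiplication is one.\<close>

lemma comult_mult_tens:
  assumes "b \<in> carrier B" "b' \<in> carrier B" "u \<in> carrier B" "v \<in> carrier B" "\<Delta> b = tens R BB BB u v"
  shows "\<Delta> (b \<otimes>\<^bsub>B\<^esub> b') = bilift CC.T (\<lambda>p q. tens R BB BB (u \<otimes>\<^bsub>B\<^esub> p) (v \<otimes>\<^bsub>B\<^esub> q)) (\<Delta> b')"
  using comult_mult[OF assms(1,2)] CC.bilift_tens[OF CC.abelian_group comult_mult_balanced[OF assms(2)], of u v] assms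
  by (simp add: Let_def)

text \<open>\<open>\<xi> r\<close> is the right translate of the unit by \<open>r\<close>, and
  \<open>\<Delta>\<close> is right linear.\<close>

lemma comult_source: "r \<in> carrier R \<Longrightarrow> \<Delta> (\<xi> r) = tens R BB BB \<one>\<^bsub>B\<^esub> (\<xi> r)"
  using comult_ract[of "\<one>\<^bsub>B\<^esub>" r] CC.ract_tens[of r "\<one>\<^bsub>B\<^esub>" "\<one>\<^bsub>B\<^esub>"] by (simp add: comult_one)

lemma bilift_comult_source:
  assumes "abelian_group A" "balanced R BB BB A F" "r \<in> carrier R" "b \<in> carrier B"
  shows "bilift A F (\<Delta> (\<xi> r \<otimes>\<^bsub>B\<^esub> b)) = bilift A (\<lambda>p q. F p (\<xi> r \<otimes>\<^bsub>B\<^esub> q)) (\<Delta> b)"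
proof -
  have "\<Delta> (\<xi> r \<otimes>\<^bsub>B\<^esub> b)
      = bilift CC.T (\<lambda>p q. tens R BB BB (\<one>\<^bsub>B\<^esub> \<otimes>\<^bsub>B\<^esub> p) (\<xi> r \<otimes>\<^bsub>B\<^esub> q)) (\<Delta> b)"
    using assms by (intro comult_mult_tens comult_source) auto
  also have "bilift A F \<dots> = bilift A (\<lambda>p q. F (\<one>\<^bsub>B\<^esub> \<otimes>\<^bsub>B\<^esub> p) (\<xi> r \<otimes>\<^bsub>B\<^esub> q)) (\<Delta> b)"
    by (rule CC.bilift_bilift_tens[OF assms(1,2) CC.tensor_product_axioms]) (use assms in auto)
  also have "\<dots> = bilift A (\<lambda>p q. F p (\<xi> r \<otimes>\<^bsub>B\<^esub> q)) (\<Delta> b)"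
    by (rule CC.bilift_cong[OF assms(1)]) (use assms in \<open>auto intro: balanced_closed[OF assms(2), simplified]\<close>)
  finally show ?thesis .
qed

text \<open>The right counit law for \<open>\<xi>(r) b\<close>, once \<open>\<Delta>\<close> has
  been moved past \<open>\<xi>(r)\<close>. It collapses the sum that arises when the coaction is
  applied to \<open>r x\<close>.\<close>

lemma counit_right_source:
  assumes "r \<in> carrier R" "b \<in> carrier B"
  shows "bilift BB (\<lambda>p q. p \<otimes>\<^bsub>B\<^esub> \<xi> (\<epsilon> (\<xi> r \<otimes>\<^bsub>B\<^esub> q))) (\<Delta> b) = \<xi> r \<otimes>\<^bsub>B\<^esub> b"
proof -
  have F: "balanced R BB BB BB (\<lambda>p q. p \<otimes>\<^bsub>B\<^esub> \<xi> (\<epsilon> q))"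
    by (rule balancedI)
       (auto simp: B.l_distr B.r_distr counit_add' source_add counit_lact' source_mult B.m_assoc)
  have "bilift BB (\<lambda>a b. ract BB a (\<epsilon> b)) (\<Delta> (\<xi> r \<otimes>\<^bsub>B\<^esub> b)) = \<xi> r \<otimes>\<^bsub>B\<^esub> b"
    by (rule counit_right) (use assms in auto)
  then have "bilift BB (\<lambda>p q. p \<otimes>\<^bsub>B\<^esub> \<xi> (\<epsilon> q)) (\<Delta> (\<xi> r \<otimes>\<^bsub>B\<^esub> b)) = \<xi> r \<otimes>\<^bsub>B\<^esub> b"
    by simp
  then show ?thesis
    using bilift_comult_source[OF abelian_group_axioms F assms] by simp
qed

text \<open>Takeuchi's condition trades \<open>\<xi>(r)\<close> on the first leg for
  \<open>\<zeta>(r)\<close> on the second; left multiplication by \<open>\<zeta>(r)\<close> then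
  leaves the sum, and the left counit law remains.\<close>

lemma counit_left_target:
  assumes "r \<in> carrier R" "b \<in> carrier B"
  shows "bilift BB (\<lambda>p q. q \<otimes>\<^bsub>B\<^esub> \<zeta> (\<epsilon> (\<xi> r \<otimes>\<^bsub>B\<^esub> p))) (\<Delta> b) = \<zeta> r \<otimes>\<^bsub>B\<^esub> b"
proof -
  let ?F = "\<lambda>p q. q \<otimes>\<^bsub>B\<^esub> \<zeta> (\<epsilon> p)"
  have F: "balanced R BB BB BB ?F"
    by (rule balancedI)
       (auto simp: B.l_distr B.r_distr counit_add' target_add counit_ract' target_mult B.m_assoc)
  have l: "(\<lambda>x. \<zeta> r \<otimes>\<^bsub>B\<^esub> x) \<in> additive_maps BB BB"
    by (rule additive_mapsI) (use assms in \<open>auto simp: B.r_distr\<close>)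
  have "bilift BB (\<lambda>p q. ?F (\<xi> r \<otimes>\<^bsub>B\<^esub> p) q) (\<Delta> b) = bilift BB (\<lambda>p q. ?F p (\<zeta> r \<otimes>\<^bsub>B\<^esub> q)) (\<Delta> b)"
    by (rule takeuchi_sweedler[OF abelian_group_axioms F assms])
  also have "\<dots> = bilift BB (\<lambda>p q. \<zeta> r \<otimes>\<^bsub>B\<^esub> ?F p q) (\<Delta> b)"
    by (rule CC.bilift_cong[OF abelian_group_axioms]) (use assms in \<open>auto simp: B.m_assoc\<close>)
  also have "\<dots> = \<zeta> r \<otimes>\<^bsub>B\<^esub> bilift BB ?F (\<Delta> b)"
    by (rule CC.hom_bilift[OF abelian_group_axioms abelian_group_axioms l, symmetric]) (use assms in auto)
  also have "bilift BB ?F (\<Delta> b) = b"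
  proof -
    have "bilift BB (\<lambda>a b. lact BB (\<epsilon> a) b) (\<Delta> b) = b" by (rule counit_left) (use assms in auto)
    then show ?thesis by simp
  qed
  finally show ?thesis .
qed

end

section \<open>The left action on a comodule\<close>

context right_comodule
begin

sublocale VB: module_tensor_product K R V "bialgebroid_bimod B \<xi> \<zeta>" ..

sublocale VBB: tensor_triple K R V "bialgebroid_bimod B \<xi> \<zeta>" "bialgebroid_bimod B \<xi> \<zeta>" ..

lemma coaction_additive: "\<rho> \<in> additive_maps V VB.T"
  using coaction_hom by (auto simp: right_module_hom_def intro: linear_maps_additive)

lemma coaction_closed: "v \<in> carrier V \<Longrightarrow> \<rho> v \<in> carrier VB.T"
  by (rule additive_maps_closed[OF coaction_additive])

lemma coaction_ract: "\<lbrakk>v \<in> carrier V; r \<in> carrier R\<rbrakk> \<Longrightarrow> \<rho> (ract V v r) = ract VB.T (\<rho> v) r"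
  and coaction_smult: "\<lbrakk>k \<in> carrier K; v \<in> carrier V\<rbrakk> \<Longrightarrow> \<rho> (k \<odot>\<^bsub>V\<^esub> v) = k \<odot>\<^bsub>VB.T\<^esub> \<rho> v"
  using coaction_hom by (auto simp: right_module_hom_def linear_maps_def)

lemma bilift_coaction_additive:
  assumes "abelian_group A" "balanced R V BB A g"
  shows "(\<lambda>v. bilift A g (\<rho> v)) \<in> additive_maps V A"
  by (rule additive_maps_comp[OF coaction_additive VB.bilift_additive[OF assms]])

lemma bilift_coaction_ract:
  assumes "abelian_group A" "balanced R V BB A g" "v \<in> carrier V" "r \<in> carrier R"
  shows "bilift A g (\<rho> (ract V v r)) = bilift A (\<lambda>u b. g u (b \<otimes>\<^bsub>B\<^esub> \<xi> r)) (\<rho> v)"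
  unfolding coaction_ract[OF assms(3,4)] VB.ract_tensor_eq[OF coaction_closed[OF assms(3)] assms(4)]
  by (subst VB.bilift_bilift_tens[OF assms(1,2) VB.tensor_product_axioms coaction_closed[OF assms(3)]])
     (use assms in auto)

lemma bilift_coaction_smult:
  assumes "abelian_group A" "balanced R V BB A g" "v \<in> carrier V" "k \<in> carrier K"
  shows "bilift A g (\<rho> (k \<odot>\<^bsub>V\<^esub> v)) = bilift A (\<lambda>u b. g (k \<odot>\<^bsub>V\<^esub> u) b) (\<rho> v)"
  unfolding coaction_smult[OF assms(4,3)] VB.smult_eq[OF coaction_closed[OF assms(3)] assms(4)]
  by (rule VB.bilift_bilift_tens[OF assms(1,2) VB.tensor_product_axioms coaction_closed[OF assms(3)]])
     (use assms in auto)

lemma coaction_coassoc_sweedler: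
  assumes A: "abelian_group A" and f: "tribalanced R V BB BB A f" and v: "v \<in> carrier V"
  shows "bilift A (\<lambda>u b. bilift A (\<lambda>u' b'. f u' b' b) (\<rho> u)) (\<rho> v)
    = bilift A (\<lambda>u b. bilift A (f u) (\<Delta> b)) (\<rho> v)"
  using coaction_coassoc[OF v, unfolded Let_def]
  by (intro VBB.sweedler_coassoc[OF A f VB.tensor_product_axioms coaction_closed[OF v] coaction_closed
        VB.tensor_product_axioms coaction_closed[OF v]]) auto

text \<open>Independence of the representative of \<open>\<rho> v\<close> in the formula for the
  left action: the counit takes a right factor \<open>\<zeta>(s)\<close> out as left multiplication
  by \<open>s\<close>.\<close>

lemma balanced_ract_counit:
  assumes "r \<in> carrier R"
  shows "balanced R V BB V (\<lambda>u b. ract V u (\<epsilon> (\<xi> r \<otimes>\<^bsub>B\<^esub> b)))"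
  by (rule balancedI)
     (use assms in \<open>auto simp: V.ract_closed V.ract_add_left V.ract_add_right B.r_distr counit_add'
       B.m_assoc[symmetric] counit_lact' V.ract_mult\<close>)

text \<open>Right linearity of \<open>\<rho>\<close> puts
  \<open>\<xi>(\<epsilon>(\<xi>(r) b))\<close> on the inner coaction; coassociativity regroups it as
  \<open>b1 \<xi>(\<epsilon>(\<xi>(r) b2))\<close>, which sums to \<open>\<xi>(r) b\<close> by
  \<open>counit_right_source\<close>.\<close>

lemma bilift_coaction_lact:
  assumes A: "abelian_group A" and g: "balanced R V BB A g" and v: "v \<in> carrier V" and r: "r \<in> carrier R"
  shows "bilift A g (\<rho> (lact V r v)) = bilift A (\<lambda>u b. g u (\<xi> r \<otimes>\<^bsub>B\<^esub> b)) (\<rho> v)"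
proof -
  note [simp] = v r
  note gcl = balanced_closed[OF g, simplified]
  note gadd = balanced_add_left[OF g, simplified] balanced_add_right[OF g, simplified]
  note gmid = balanced_middle[OF g, simplified]
  let ?f = "\<lambda>u p q. g u (p \<otimes>\<^bsub>B\<^esub> \<xi> (\<epsilon> (\<xi> r \<otimes>\<^bsub>B\<^esub> q)))"
  have f: "tribalanced R V BB BB A ?f"
  proof (rule tribalancedI)
    show "balanced R BB BB A (?f u)" if "u \<in> carrier V" for u
      by (rule balancedI)
         (use that in \<open>auto simp: gcl gadd B.l_distr B.r_distr counit_add' source_add
           B.m_assoc source_mult counit_source_lact\<close>)
    show "balanced R V BB A (\<lambda>u p. ?f u p q)" if "q \<in> carrier BB" for q
      by (rule balancedI)
         (use that in \<open>auto simp: gcl gadd gmid B.l_distr B.m_assoc source_target_commute\<close>)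
  qed
  have "bilift A g (\<rho> (lact V r v)) = bilift A (\<lambda>u b. bilift A g (\<rho> (ract V u (\<epsilon> (\<xi> r \<otimes>\<^bsub>B\<^esub> b))))) (\<rho> v)"
    unfolding lact_eq[OF r v]
    by (rule VB.hom_bilift[OF V.abelian_group_axioms A bilift_coaction_additive[OF A g] coaction_closed[OF v]])
       (auto intro: V.ract_closed)
  also have "\<dots> = bilift A (\<lambda>u b. bilift A (\<lambda>u' b'. ?f u' b' b) (\<rho> u)) (\<rho> v)"
    by (rule VB.bilift_cong[OF A coaction_closed[OF v]])
       (auto simp: bilift_coaction_ract[OF A g] gcl intro!: VB.bilift_closed[OF A coaction_closed])
  also have "\<dots> = bilift A (\<lambda>u b. bilift A (?f u) (\<Delta> b)) (\<rho> v)"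
    by (rule coaction_coassoc_sweedler[OF A f v])
  also have "\<dots> = bilift A (\<lambda>u b. g u (\<xi> r \<otimes>\<^bsub>B\<^esub> b)) (\<rho> v)"
  proof (rule VB.bilift_cong[OF A coaction_closed[OF v]])
    fix u b assume u: "u \<in> carrier V" and "b \<in> carrier BB"
    then have b: "b \<in> carrier B" by simp
    have "g u \<in> additive_maps BB A" by (rule additive_mapsI) (use u in \<open>auto simp: gcl gadd\<close>)
    from CC.hom_bilift[OF abelian_group_axioms A this comult_closed'[OF b],
        of "\<lambda>p q. p \<otimes>\<^bsub>B\<^esub> \<xi> (\<epsilon> (\<xi> r \<otimes>\<^bsub>B\<^esub> q))"]
    show "bilift A (?f u) (\<Delta> b) = g u (\<xi> r \<otimes>\<^bsub>B\<^esub> b)"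
      using counit_right_source[OF r b] by simp
  qed (auto intro: gcl)
  finally show ?thesis .
qed

text \<open>The scalar \<open>\<epsilon>(\<xi>(r) u1)\<close> sits to the right of
  \<open>u0\<close>; balancing of \<open>g\<close> carries it over as a factor
  \<open>\<zeta>\<close> of the second argument, and after coassociativity
  \<open>counit_left_target\<close> collapses the sum.\<close>

lemma bilift_lact_coaction:
  assumes A: "abelian_group A" and g: "balanced R V BB A g" and v: "v \<in> carrier V" and r: "r \<in> carrier R"
  shows "bilift A (\<lambda>u b. g (lact V r u) b) (\<rho> v) = bilift A (\<lambda>u b. g u (\<zeta> r \<otimes>\<^bsub>B\<^esub> b)) (\<rho> v)"
proof -
  note [simp] = v r
  note gcl = balanced_closed[OF g, simplified]
  note gadd = balanced_add_left[OF g, simplified] balanced_add_right[OF g, simplified]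
  note gmid = balanced_middle[OF g, simplified]
  let ?f = "\<lambda>u p q. g u (q \<otimes>\<^bsub>B\<^esub> \<zeta> (\<epsilon> (\<xi> r \<otimes>\<^bsub>B\<^esub> p)))"
  have f: "tribalanced R V BB BB A ?f"
  proof (rule tribalancedI)
    show "balanced R BB BB A (?f u)" if "u \<in> carrier V" for u
      by (rule balancedI)
         (use that in \<open>auto simp: gcl gadd B.l_distr B.r_distr counit_add' target_add
           B.m_assoc target_mult counit_source_ract\<close>)
    show "balanced R V BB A (\<lambda>u p. ?f u p q)" if "q \<in> carrier BB" for q
      by (rule balancedI)
         (use that in \<open>auto simp: gcl gadd gmid B.l_distr B.r_distr counit_add' target_add B.m_assoc
           target_mult counit_source_lact\<close>)
  qed
  have "bilift A (\<lambda>u b. g (lact V r u) b) (\<rho> v) = bilift A (\<lambda>u b. bilift A (\<lambda>u' b'. ?f u' b' b) (\<rho> u)) (\<rho> v)"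
  proof (rule VB.bilift_cong[OF A coaction_closed[OF v]])
    fix u b assume u: "u \<in> carrier V" and "b \<in> carrier BB"
    then have b: "b \<in> carrier B" by simp
    have gb: "(\<lambda>u. g u b) \<in> additive_maps V A" by (rule additive_mapsI) (use b in \<open>auto simp: gcl gadd\<close>)
    have "g (lact V r u) b = bilift A (\<lambda>u' b'. g (ract V u' (\<epsilon> (\<xi> r \<otimes>\<^bsub>B\<^esub> b'))) b) (\<rho> u)"
      unfolding lact_eq[OF r u]
      by (rule VB.hom_bilift[OF V.abelian_group_axioms A gb coaction_closed[OF u]]) (auto intro: V.ract_closed)
    also have "\<dots> = bilift A (\<lambda>u' b'. ?f u' b' b) (\<rho> u)"
      by (rule VB.bilift_cong[OF A coaction_closed[OF u]]) (use b in \<open>auto simp: gmid gcl\<close>)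
    finally show "g (lact V r u) b = bilift A (\<lambda>u' b'. ?f u' b' b) (\<rho> u)" .
  qed (auto intro!: VB.bilift_closed[OF A coaction_closed] gcl)
  also have "\<dots> = bilift A (\<lambda>u b. bilift A (?f u) (\<Delta> b)) (\<rho> v)"
    by (rule coaction_coassoc_sweedler[OF A f v])
  also have "\<dots> = bilift A (\<lambda>u b. g u (\<zeta> r \<otimes>\<^bsub>B\<^esub> b)) (\<rho> v)"
  proof (rule VB.bilift_cong[OF A coaction_closed[OF v]])
    fix u b assume u: "u \<in> carrier V" and "b \<in> carrier BB"
    then have b: "b \<in> carrier B" by simp
    have "g u \<in> additive_maps BB A" by (rule additive_mapsI) (use u in \<open>auto simp: gcl gadd\<close>)
    from CC.hom_bilift[OF abelian_group_axioms A this comult_closed'[OF b],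
        of "\<lambda>p q. q \<otimes>\<^bsub>B\<^esub> \<zeta> (\<epsilon> (\<xi> r \<otimes>\<^bsub>B\<^esub> p))"]
    show "bilift A (?f u) (\<Delta> b) = g u (\<zeta> r \<otimes>\<^bsub>B\<^esub> b)"
      using counit_left_target[OF r b] by simp
  qed (auto intro: gcl)
  finally show ?thesis .
qed

text \<open>Associativity of the action is the law that needs a formula for
  \<open>\<rho> (r' v)\<close>. The unit law is the counit of the coaction, and commutation with the
  right action comes from right linearity of \<open>\<rho>\<close> and
  \<open>\<epsilon>\<close>.\<close>

lemma comodule_bimodule: "bimodule K R V"
proof (intro bimodule.intro bimodule_axioms.intro V.right_module_axioms)
  note AV = V.abelian_group_axioms
  interpret AB: abelian_group V by (rule AV)
  have e: "\<epsilon> (\<xi> r \<otimes>\<^bsub>B\<^esub> b) \<in> carrier R" if "r \<in> carrier R" "b \<in> carrier B" for r b using that by simp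
  show "lact V r v \<in> carrier V" if "r \<in> carrier R" "v \<in> carrier V" for r v
    unfolding lact_eq[OF that]
    by (rule VB.bilift_closed[OF AV coaction_closed[OF that(2)]]) (use that in \<open>auto intro: V.ract_closed\<close>)
  show "lact V r (v \<oplus>\<^bsub>V\<^esub> v') = lact V r v \<oplus>\<^bsub>V\<^esub> lact V r v'"
    if "r \<in> carrier R" "v \<in> carrier V" "v' \<in> carrier V" for r v v'
    using additive_maps_add[OF bilift_coaction_additive[OF AV balanced_ract_counit[OF that(1)]] that(2,3)] that
    by (simp add: lact_eq)
  show "lact V (r \<oplus>\<^bsub>R\<^esub> r') v = lact V r v \<oplus>\<^bsub>V\<^esub> lact V r' v"
    if "r \<in> carrier R" "r' \<in> carrier R" "v \<in> carrier V" for r r' v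
    using that
    by (simp add: lact_eq)
       (rule VB.bilift_fun_add[OF AV coaction_closed];
         simp add: source_add B.l_distr counit_add' V.ract_add_right V.ract_closed)
  show "lact V (r \<otimes>\<^bsub>R\<^esub> r') v = lact V r (lact V r' v)"
    if "r \<in> carrier R" "r' \<in> carrier R" "v \<in> carrier V" for r r' v
  proof -
    have "lact V r' v \<in> carrier V"
      unfolding lact_eq[OF that(2,3)]
      by (rule VB.bilift_closed[OF AV coaction_closed[OF that(3)]]) (use that in \<open>auto intro: V.ract_closed\<close>)
    then have "lact V r (lact V r' v) = bilift V (\<lambda>u b. ract V u (\<epsilon> (\<xi> r \<otimes>\<^bsub>B\<^esub> b))) (\<rho> (lact V r' v))"
      by (rule lact_eq[OF that(1)])
    also have "\<dots> = bilift V (\<lambda>u b. ract V u (\<epsilon> (\<xi> r \<otimes>\<^bsub>B\<^esub> (\<xi> r' \<otimes>\<^bsub>B\<^esub> b)))) (\<rho> v)"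
      by (rule bilift_coaction_lact[OF AV balanced_ract_counit[OF that(1)] that(3,2)])
    also have "\<dots> = lact V (r \<otimes>\<^bsub>R\<^esub> r') v"
      using that
      by (simp add: lact_eq)
         (auto intro!: VB.bilift_cong[OF AV coaction_closed] simp: source_mult B.m_assoc V.ract_closed)
    finally show ?thesis by simp
  qed
  show "lact V \<one>\<^bsub>R\<^esub> v = v" if "v \<in> carrier V" for v
  proof -
    have "lact V \<one>\<^bsub>R\<^esub> v = bilift V (\<lambda>u b. ract V u (\<epsilon> b)) (\<rho> v)"
      using that
      by (simp add: lact_eq)
         (auto intro!: VB.bilift_cong[OF AV coaction_closed] simp: source_one V.ract_closed)
    then show ?thesis using coaction_counit[OF that] by simp
  qed
  show "lact V r (k \<odot>\<^bsub>V\<^esub> v) = k \<odot>\<^bsub>V\<^esub> lact V r v"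
    if "k \<in> carrier K" "r \<in> carrier R" "v \<in> carrier V" for k r v
  proof -
    have sm: "(\<lambda>v. k \<odot>\<^bsub>V\<^esub> v) \<in> additive_maps V V"
      by (rule additive_mapsI) (use that V.smult_r_distr in auto)
    have "lact V r (k \<odot>\<^bsub>V\<^esub> v) = bilift V (\<lambda>u b. ract V (k \<odot>\<^bsub>V\<^esub> u) (\<epsilon> (\<xi> r \<otimes>\<^bsub>B\<^esub> b))) (\<rho> v)"
      using bilift_coaction_smult[OF AV balanced_ract_counit[OF that(2)] that(3,1)] that by (simp add: lact_eq)
    also have "\<dots> = bilift V (\<lambda>u b. k \<odot>\<^bsub>V\<^esub> ract V u (\<epsilon> (\<xi> r \<otimes>\<^bsub>B\<^esub> b))) (\<rho> v)"
      by (rule VB.bilift_cong[OF AV coaction_closed[OF that(3)]])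
         (use that in \<open>auto simp: V.ract_smult_left V.ract_closed\<close>)
    also have "\<dots> = k \<odot>\<^bsub>V\<^esub> lact V r v"
      unfolding lact_eq[OF that(2,3)]
      by (rule VB.hom_bilift[OF AV AV sm coaction_closed[OF that(3)], symmetric])
         (use that in \<open>auto simp: V.ract_closed\<close>)
    finally show ?thesis .
  qed
  show "lact V (k \<odot>\<^bsub>R\<^esub> r) v = k \<odot>\<^bsub>V\<^esub> lact V r v"
    if "k \<in> carrier K" "r \<in> carrier R" "v \<in> carrier V" for k r v
  proof -
    have sm: "(\<lambda>v. k \<odot>\<^bsub>V\<^esub> v) \<in> additive_maps V V"
      by (rule additive_mapsI) (use that V.smult_r_distr in auto)
    have "lact V (k \<odot>\<^bsub>R\<^esub> r) v = bilift V (\<lambda>u b. k \<odot>\<^bsub>V\<^esub> ract V u (\<epsilon> (\<xi> r \<otimes>\<^bsub>B\<^esub> b))) (\<rho> v)"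
      using that
      by (simp add: lact_eq)
         (auto intro!: VB.bilift_cong[OF AV coaction_closed]
           simp: source_smult B.smult_mult_left counit_smult' V.ract_smult_right V.ract_closed)
    also have "\<dots> = k \<odot>\<^bsub>V\<^esub> lact V r v"
      unfolding lact_eq[OF that(2,3)]
      by (rule VB.hom_bilift[OF AV AV sm coaction_closed[OF that(3)], symmetric])
         (use that in \<open>auto simp: V.ract_closed\<close>)
    finally show ?thesis .
  qed
  show "ract V (lact V r v) s = lact V r (ract V v s)"
    if "r \<in> carrier R" "v \<in> carrier V" "s \<in> carrier R" for r v s
  proof -
    have ra: "(\<lambda>v. ract V v s) \<in> additive_maps V V"
      by (rule additive_mapsI) (use that V.ract_add_left V.ract_closed in auto)
    have "lact V r (ract V v s) = bilift V (\<lambda>u b. ract V u (\<epsilon> (\<xi> r \<otimes>\<^bsub>B\<^esub> (b \<otimes>\<^bsub>B\<^esub> \<xi> s)))) (\<rho> v)"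
      using bilift_coaction_ract[OF AV balanced_ract_counit[OF that(1)] that(2,3)] that
      by (simp add: lact_eq V.ract_closed)
    also have "\<dots> = bilift V (\<lambda>u b. ract V (ract V u (\<epsilon> (\<xi> r \<otimes>\<^bsub>B\<^esub> b))) s) (\<rho> v)"
      by (rule VB.bilift_cong[OF AV coaction_closed[OF that(2)]])
         (use that in \<open>auto simp: B.m_assoc[symmetric] counit_ract' V.ract_mult V.ract_closed\<close>)
    also have "\<dots> = ract V (lact V r v) s"
      unfolding lact_eq[OF that(1,2)]
      by (rule VB.hom_bilift[OF AV AV ra coaction_closed[OF that(2)], symmetric])
         (use that in \<open>auto simp: V.ract_closed\<close>)
    finally show ?thesis by simp
  qed
qed

end

section \<open>The transposition map\<close>

locale module_coring_comodule =
  module_coring K R B \<xi> \<zeta> \<Delta> \<epsilon> C \<Delta>C \<epsilon>C act + X: right_comodule K R B \<xi> \<zeta> \<Delta> \<epsilon> X \<rho>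
  for K :: "'k ring" and R :: "('k, 'r) module" and B :: "('k, 'b) module"
    and \<xi> \<zeta> \<Delta> \<epsilon> and C :: "('k, 'r, 'c) bimod" and \<Delta>C \<epsilon>C act
    and X :: "('k, 'r, 'x) bimod" and \<rho>
begin

sublocale XB: bimodule K R X by (rule X.comodule_bimodule)

sublocale CX: bimodule_tensor_product K R C X ..

sublocale XC: bimodule_tensor_product K R X C ..

sublocale XCC: tensor_triple K R X C C ..

sublocale CCX: tensor_triple K R C C X ..

sublocale CXC: tensor_triple K R C X C ..

text \<open>A scalar taken from \<open>x0\<close> appears as a right factor
  \<open>\<zeta>(r)\<close> of \<open>x1\<close>, hence as the left action on
  \<open>act c x1\<close>, which is where \<open>g\<close> expects it.\<close>

lemma balanced_act:
  assumes g: "balanced R X C A g" and c: "c \<in> carrier C"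
  shows "balanced R X BB A (\<lambda>x0 x1. g x0 (act c x1))"
  by (rule balancedI)
     (simp_all add: balancedD[OF g] c act_closed act_add_right lact_eq act_mult)

text \<open>Stated for every balanced \<open>g\<close>, because the cyclic operators use the same
  expression with a \<open>g\<close> that is not the tensor symbol. The middle law matches
  \<open>act c (\<xi> r)\<close> with the formula for \<open>\<rho> (r x)\<close>.\<close>

lemma twist_balanced:
  assumes A: "abelian_group A" and g: "balanced R X C A g"
  shows "balanced R C X A (\<lambda>c x. bilift A (\<lambda>x0 x1. g x0 (act c x1)) (\<rho> x))"
proof (rule balancedI)
  fix c x assume c: "c \<in> carrier C" and x: "x \<in> carrier X"
  note [simp] = c x
  show "bilift A (\<lambda>x0 x1. g x0 (act c x1)) (\<rho> x) \<in> carrier A"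
    by (rule X.VB.bilift_closed[OF A X.coaction_closed[OF x]]) (simp add: balanced_closed[OF g] act_closed)
  show "bilift A (\<lambda>x0 x1. g x0 (act (c \<oplus>\<^bsub>C\<^esub> c') x1)) (\<rho> x)
      = bilift A (\<lambda>x0 x1. g x0 (act c x1)) (\<rho> x) \<oplus>\<^bsub>A\<^esub> bilift A (\<lambda>x0 x1. g x0 (act c' x1)) (\<rho> x)"
    if "c' \<in> carrier C" for c'
    by (rule X.VB.bilift_fun_add[OF A])
       (simp_all add: that X.coaction_closed act_add_left act_closed balancedD[OF g])
  show "bilift A (\<lambda>x0 x1. g x0 (act c x1)) (\<rho> (x \<oplus>\<^bsub>X\<^esub> x'))
      = bilift A (\<lambda>x0 x1. g x0 (act c x1)) (\<rho> x) \<oplus>\<^bsub>A\<^esub> bilift A (\<lambda>x0 x1. g x0 (act c x1)) (\<rho> x')"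
    if "x' \<in> carrier X" for x'
    by (rule additive_maps_add[OF X.bilift_coaction_additive[OF A balanced_act[OF g c]] x that])
  show "bilift A (\<lambda>x0 x1. g x0 (act (ract C c r) x1)) (\<rho> x)
      = bilift A (\<lambda>x0 x1. g x0 (act c x1)) (\<rho> (lact X r x))" if r: "r \<in> carrier R" for r
    unfolding X.bilift_coaction_lact[OF A balanced_act[OF g c] x r]
    by (rule X.VB.bilift_cong[OF A X.coaction_closed[OF x]])
       (simp_all add: r ract_eq act_mult act_closed balanced_closed[OF g])
qed

lemma twist_lact:
  assumes A: "abelian_group A" and g: "balanced R X C A g"
    and c: "c \<in> carrier C" and x: "x \<in> carrier X" and r: "r \<in> carrier R"
  shows "bilift A (\<lambda>x0 x1. g x0 (act (lact C r c) x1)) (\<rho> x) = bilift A (\<lambda>x0 x1. g (lact X r x0) (act c x1)) (\<rho> x)"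
  unfolding X.bilift_lact_coaction[OF A balanced_act[OF g c] x r]
  by (rule X.VB.bilift_cong[OF A X.coaction_closed[OF x]])
     (simp_all add: c r lact_eq act_mult act_closed balanced_closed[OF g])

lemma twist_ract:
  assumes A: "abelian_group A" and g: "balanced R X C A g"
    and c: "c \<in> carrier C" and x: "x \<in> carrier X" and r: "r \<in> carrier R"
  shows "bilift A (\<lambda>x0 x1. g x0 (act c x1)) (\<rho> (ract X x r)) = bilift A (\<lambda>x0 x1. g x0 (ract C (act c x1) r)) (\<rho> x)"
  unfolding X.bilift_coaction_ract[OF A balanced_act[OF g c] x r]
  by (rule X.VB.bilift_cong[OF A X.coaction_closed[OF x]])
     (simp_all add: c r ract_eq act_mult act_closed balanced_closed[OF g])

text \<open>\<open>counit_act\<close> produces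
  \<open>x0 \<epsilon>(\<xi>(\<epsilon>C c) x1)\<close>, the defining formula of the left action of
  \<open>\<epsilon>C c\<close>. The counit law of \<open>w\<close> and the relation
  \<open>d_0 w_n = d_n\<close> both come from here.\<close>

lemma twist_counit:
  assumes c: "c \<in> carrier C" and x: "x \<in> carrier X"
  shows "bilift X (\<lambda>x0 x1. ract X x0 (\<epsilon>C (act c x1))) (\<rho> x) = lact X (\<epsilon>C c) x"
  unfolding X.lact_eq[OF C.counit_closed[OF c] x]
  by (rule X.VB.bilift_cong[OF X.V.abelian_group_axioms X.coaction_closed[OF x]])
     (simp_all add: c counit_act C.counit_closed X.V.ract_closed)

text \<open>\<open>comult_act\<close> forces the lift over \<open>\<Delta> x1\<close> inside the one
  over \<open>\<Delta>C c\<close>. Exchanging the latter with the lift over \<open>\<rho> x\<close>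
  brings \<open>\<rho> x\<close> and \<open>\<Delta> x1\<close> together for fixed legs of
  \<open>c\<close>, and then coassociativity of the coaction applies.\<close>

lemma twist_comult:
  assumes A: "abelian_group A" and f: "tribalanced R X C C A f"
    and c: "c \<in> carrier C" and x: "x \<in> carrier X"
  shows "bilift A (\<lambda>x0 x1. bilift A (f x0) (\<Delta>C (act c x1))) (\<rho> x)
    = bilift A (\<lambda>c1 c2. bilift A (\<lambda>x0 x1. bilift A (\<lambda>y0 y1. f y0 (act c1 y1) (act c2 x1)) (\<rho> x0)) (\<rho> x)) (\<Delta>C c)"
proof -
  note [simp] = c x
  note fcl = tribalanced_closed[OF f] and fl = tribalanced_right[OF f] and fr = tribalanced_left[OF f]
  note cls = X.coaction_closed[OF x] C.comult_closed[OF c]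
  have "bilift A (\<lambda>x0 x1. bilift A (f x0) (\<Delta>C (act c x1))) (\<rho> x)
    = bilift A (\<lambda>x0 x1. bilift A (\<lambda>c1 c2. bilift A (\<lambda>p q. f x0 (act c1 p) (act c2 q)) (\<Delta> x1)) (\<Delta>C c)) (\<rho> x)"
  proof (rule X.VB.bilift_cong[OF A cls(1)])
    fix x0 x1 assume x0: "x0 \<in> carrier X" and "x1 \<in> carrier BB"
    then have x1: "x1 \<in> carrier B" by simp
    note h = C.CC.bilift_additive[OF A fl[OF x0]]
    have inner: "bilift C.CC.T (\<lambda>p q. tens R C C (act u p) (act v q)) (\<Delta> x1) \<in> carrier C.CC.T"
      if "u \<in> carrier C" "v \<in> carrier C" for u v
      by (rule CC.bilift_closed[OF C.CC.abelian_group comult_closed'[OF x1]])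
         (use that in \<open>auto intro!: C.CC.tens_closed act_closed\<close>)
    have "bilift A (f x0) (\<Delta>C (act c x1)) = bilift A (\<lambda>u v. bilift A (f x0)
        (bilift C.CC.T (\<lambda>p q. tens R C C (act u p) (act v q)) (\<Delta> x1))) (\<Delta>C c)"
      unfolding comult_act[OF c x1]
      by (rule C.CC.hom_bilift[OF C.CC.abelian_group A h cls(2)]) (rule inner)
    also have "\<dots> = bilift A (\<lambda>c1 c2. bilift A (\<lambda>p q. f x0 (act c1 p) (act c2 q)) (\<Delta> x1)) (\<Delta>C c)"
    proof (rule C.CC.bilift_cong[OF A cls(2)])
      fix u v assume uv: "u \<in> carrier C" "v \<in> carrier C"
      show "bilift A (f x0) (bilift C.CC.T (\<lambda>p q. tens R C C (act u p) (act v q)) (\<Delta> x1))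
          = bilift A (\<lambda>p q. f x0 (act u p) (act v q)) (\<Delta> x1)"
        by (rule C.CC.bilift_bilift_tens[OF A fl[OF x0] CC.tensor_product_axioms comult_closed'[OF x1]])
           (use uv in \<open>auto intro: act_closed\<close>)
      show "bilift A (\<lambda>p q. f x0 (act u p) (act v q)) (\<Delta> x1) \<in> carrier A"
        by (rule CC.bilift_closed[OF A comult_closed'[OF x1]]) (use uv x0 in \<open>auto intro!: fcl act_closed\<close>)
    qed
    finally show "bilift A (f x0) (\<Delta>C (act c x1))
        = bilift A (\<lambda>c1 c2. bilift A (\<lambda>p q. f x0 (act c1 p) (act c2 q)) (\<Delta> x1)) (\<Delta>C c)" .
    show "bilift A (\<lambda>c1 c2. bilift A (\<lambda>p q. f x0 (act c1 p) (act c2 q)) (\<Delta> x1)) (\<Delta>C c) \<in> carrier A"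
      using x0 x1 by (auto intro!: C.CC.bilift_closed[OF A cls(2)] CC.bilift_closed[OF A] fcl act_closed)
  qed
  also have "\<dots> = bilift A (\<lambda>c1 c2. bilift A (\<lambda>x0 x1. bilift A (\<lambda>p q. f x0 (act c1 p) (act c2 q)) (\<Delta> x1)) (\<rho> x)) (\<Delta>C c)"
    by (rule bilift_swap[OF X.VB.tensor_product_axioms C.CC.tensor_product_axioms A cls])
       (auto intro!: CC.bilift_closed[OF A] fcl act_closed)
  also have "\<dots> = bilift A (\<lambda>c1 c2. bilift A (\<lambda>x0 x1. bilift A (\<lambda>y0 y1. f y0 (act c1 y1) (act c2 x1)) (\<rho> x0)) (\<rho> x)) (\<Delta>C c)"
  proof (rule C.CC.bilift_cong[OF A cls(2)])
    fix u v assume uv: "u \<in> carrier C" "v \<in> carrier C"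
    \<comment> \<open>The two actions turn right factors \<open>\<xi>\<close> and
      \<open>\<zeta>\<close> into the actions of \<open>R\<close> on \<open>C\<close>, so balancing
      is inherited from \<open>f\<close>.\<close>
    have "tribalanced R X BB BB A (\<lambda>x p q. f x (act u p) (act v q))"
    proof (rule tribalancedI)
      show "balanced R BB BB A (\<lambda>p q. f l (act u p) (act v q))" if "l \<in> carrier X" for l
        by (rule balancedI)
           (use uv that in \<open>simp_all add: fcl act_closed act_add_right balancedD[OF fl] act_mult
             ract_eq[symmetric] lact_eq[symmetric]\<close>)
      show "balanced R X BB A (\<lambda>l p. f l (act u p) (act v n))" if "n \<in> carrier BB" for n
        by (rule balancedI)
           (use uv that in \<open>simp_all add: fcl act_closed act_add_right balancedD[OF fr] act_mult
             lact_eq[symmetric]\<close>)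
    qed
    from X.coaction_coassoc_sweedler[OF A this x]
    show "bilift A (\<lambda>x0 x1. bilift A (\<lambda>p q. f x0 (act u p) (act v q)) (\<Delta> x1)) (\<rho> x)
        = bilift A (\<lambda>x0 x1. bilift A (\<lambda>y0 y1. f y0 (act u y1) (act v x1)) (\<rho> x0)) (\<rho> x)"
      by simp
    show "bilift A (\<lambda>x0 x1. bilift A (\<lambda>y0 y1. f y0 (act u y1) (act v x1)) (\<rho> x0)) (\<rho> x) \<in> carrier A"
      using uv by (auto intro!: X.VB.bilift_closed[OF A X.coaction_closed] fcl act_closed)
  qed
  finally show ?thesis .
qed

section \<open>The map \<open>w\<close> and its linearity\<close>

definition transposition :: "('c \<times> 'x \<Rightarrow>\<^sub>0 int) set \<Rightarrow> ('x \<times> 'c \<Rightarrow>\<^sub>0 int) set" where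
  "transposition = bilift XC.T (\<lambda>c x. bilift XC.T (\<lambda>x0 x1. XC.tns x0 (act c x1)) (\<rho> x))"

lemma transposition_additive: "transposition \<in> additive_maps CX.T XC.T"
  unfolding transposition_def
  by (rule CX.bilift_additive[OF XC.abelian_group twist_balanced[OF XC.abelian_group XC.tens_balanced]])

lemma transposition_tens:
  "\<lbrakk>c \<in> carrier C; x \<in> carrier X\<rbrakk>
    \<Longrightarrow> transposition (CX.tns c x) = bilift XC.T (\<lambda>x0 x1. XC.tns x0 (act c x1)) (\<rho> x)"
  unfolding transposition_def
  by (rule CX.bilift_tens[OF XC.abelian_group twist_balanced[OF XC.abelian_group XC.tens_balanced]])

lemma transposition_closed: "t \<in> carrier CX.T \<Longrightarrow> transposition t \<in> carrier XC.T"
  by (rule additive_maps_closed[OF transposition_additive])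

lemma bilift_transposition:
  assumes "abelian_group A" "balanced R X C A g" "c \<in> carrier C" "x \<in> carrier X"
  shows "bilift A g (transposition (CX.tns c x)) = bilift A (\<lambda>x0 x1. g x0 (act c x1)) (\<rho> x)"
  unfolding transposition_tens[OF assms(3,4)]
  by (rule XC.bilift_bilift_tens[OF assms(1,2) X.VB.tensor_product_axioms X.coaction_closed[OF assms(4)]])
     (use assms in \<open>auto intro: act_closed\<close>)

text \<open>Each scalar operation on \<open>X \<otimes> C\<close> is the lift of some balanced
  \<open>g\<close>, so compatibility with \<open>w\<close> becomes an identity of Sweedler
  expressions on monomials. Used for both actions of \<open>R\<close> and for
  \<open>K\<close>.\<close>

lemma transposition_commute:
  assumes \<phi>: "\<phi> \<in> additive_maps CX.T CX.T" and \<psi>: "\<psi> \<in> additive_maps XC.T XC.T"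
    and g: "balanced R X C XC.T g" "\<And>t. t \<in> carrier XC.T \<Longrightarrow> \<psi> t = bilift XC.T g t"
    and eq: "\<And>c x. \<lbrakk>c \<in> carrier C; x \<in> carrier X\<rbrakk>
      \<Longrightarrow> transposition (\<phi> (CX.tns c x)) = bilift XC.T (\<lambda>x0 x1. g x0 (act c x1)) (\<rho> x)"
    and t: "t \<in> carrier CX.T"
  shows "transposition (\<phi> t) = \<psi> (transposition t)"
  by (rule CX.tensor_ext[OF XC.abelian_group additive_maps_comp[OF \<phi> transposition_additive]
        additive_maps_comp[OF transposition_additive \<psi>] _ t])
     (simp add: eq g(2) transposition_closed CX.tens_closed bilift_transposition[OF XC.abelian_group g(1)])

lemma transposition_lact:
  assumes "r \<in> carrier R" "t \<in> carrier CX.T"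
  shows "transposition (lact CX.T r t) = lact XC.T r (transposition t)"
  by (rule transposition_commute[OF CX.lact_additive XC.lact_additive XC.lact_balanced])
     (use assms in \<open>simp_all add: XC.lact_tensor_eq CX.lact_tens transposition_tens C.lact_closed
       twist_lact[OF XC.abelian_group XC.tens_balanced]\<close>)

lemma transposition_ract:
  assumes "r \<in> carrier R" "t \<in> carrier CX.T"
  shows "transposition (ract CX.T t r) = ract XC.T (transposition t) r"
  by (rule transposition_commute[OF CX.ract_additive XC.ract_additive XC.ract_balanced])
     (use assms in \<open>simp_all add: XC.ract_tensor_eq CX.ract_tens transposition_tens X.V.ract_closed
       twist_ract[OF XC.abelian_group XC.tens_balanced]\<close>)

lemma transposition_smult:
  assumes "k \<in> carrier K" "t \<in> carrier CX.T"
  shows "transposition (k \<odot>\<^bsub>CX.T\<^esub> t) = k \<odot>\<^bsub>XC.T\<^esub> transposition t"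
proof (rule transposition_commute[OF CX.smult_additive XC.smult_additive XC.smult_balanced])
  \<comment> \<open>The scalar multiplies the first factor of either tensor product:
    \<open>c\<close> in \<open>C \<otimes> X\<close>, but \<open>x0\<close> in
    \<open>X \<otimes> C\<close>.\<close>
  show "transposition (k \<odot>\<^bsub>CX.T\<^esub> CX.tns c x) = bilift XC.T (\<lambda>x0 x1. XC.tns (k \<odot>\<^bsub>X\<^esub> x0) (act c x1)) (\<rho> x)"
    if cx: "c \<in> carrier C" "x \<in> carrier X" for c x
    using cx assms(1)
    by (simp add: CX.smult_tens transposition_tens, intro X.VB.bilift_cong[OF XC.abelian_group X.coaction_closed])
       (simp_all add: act_smult_left XC.tens_smult_middle act_closed XC.tens_closed)
qed (use assms in \<open>simp_all add: XC.smult_eq\<close>)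

lemma transposition_bimodule_hom: "transposition \<in> bimodule_hom K R CX.T XC.T"
  by (simp add: bimodule_hom_def right_module_hom_def linear_maps_def transposition_closed
      additive_maps_add[OF transposition_additive] transposition_lact transposition_ract transposition_smult)

lemma balanced_ract_counit_coring: "balanced R X C X (\<lambda>x c. ract X x (\<epsilon>C c))"
  by (rule balancedI)
     (simp_all add: X.V.ract_closed X.V.ract_add_left X.V.ract_add_right C.counit_closed C.counit_add
       C.counit_lact X.V.ract_mult)

lemma balanced_lact_counit_coring: "balanced R C X X (\<lambda>c x. lact X (\<epsilon>C c) x)"
  by (rule balancedI)
     (simp_all add: XB.lact_closed XB.lact_add_left XB.lact_add_right C.counit_closed C.counit_add
       C.counit_ract XB.lact_mult)

lemma transposition_counit:
  assumes "t \<in> carrier CX.T"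
  shows "bilift X (\<lambda>x c. ract X x (\<epsilon>C c)) (transposition t) = bilift X (\<lambda>c x. lact X (\<epsilon>C c) x) t"
proof (rule CX.tensor_ext[OF X.V.abelian_group_axioms _ CX.bilift_additive[OF X.V.abelian_group_axioms balanced_lact_counit_coring] _ assms])
  show "(\<lambda>t. bilift X (\<lambda>x c. ract X x (\<epsilon>C c)) (transposition t)) \<in> additive_maps CX.T X"
    by (rule additive_maps_comp[OF transposition_additive XC.bilift_additive[OF X.V.abelian_group_axioms balanced_ract_counit_coring]])
  fix c x assume cx: "c \<in> carrier C" "x \<in> carrier X"
  then show "bilift X (\<lambda>x c. ract X x (\<epsilon>C c)) (transposition (CX.tns c x))
      = bilift X (\<lambda>c x. lact X (\<epsilon>C c) x) (CX.tns c x)"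
    using bilift_transposition[OF X.V.abelian_group_axioms balanced_ract_counit_coring cx] twist_counit[OF cx]
      CX.bilift_tens[OF X.V.abelian_group_axioms balanced_lact_counit_coring cx]
    by simp
qed

text \<open>The four tensor maps of the comultiplication law; linearity of \<open>\<Delta>C\<close>
  and of \<open>w\<close> on the side facing the tensor sign makes each of them computable on
  monomials.\<close>

sublocale comult_X: tensor_map_hom R C X "tensor R C C" X \<Delta>C "\<lambda>x. x"
  by (intro tensor_map_hom.intro tensor_map_hom_axioms.intro additive_maps_id C.comult_additive C.comult_ract
      CX.tensor_product_axioms CCX.LMN'.tensor_product_axioms refl)

sublocale C_transposition: tensor_map_hom R C "tensor R C X" C "tensor R X C" "\<lambda>c. c" transposition
  by (intro tensor_map_hom.intro tensor_map_hom_axioms.intro additive_maps_id transposition_additive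
      transposition_lact CCX.LMN.tensor_product_axioms CXC.LMN.tensor_product_axioms refl)

sublocale transposition_C: tensor_map_hom R "tensor R C X" C "tensor R X C" C transposition "\<lambda>c. c"
  by (intro tensor_map_hom.intro tensor_map_hom_axioms.intro additive_maps_id transposition_additive
      transposition_ract CXC.LMN'.tensor_product_axioms XCC.LMN'.tensor_product_axioms refl)

sublocale X_comult: tensor_map_hom R X C X "tensor R C C" "\<lambda>x. x" \<Delta>C
  by (intro tensor_map_hom.intro tensor_map_hom_axioms.intro additive_maps_id C.comult_additive C.comult_lact
      XC.tensor_product_axioms XCC.LMN.tensor_product_axioms refl)

text \<open>Both sides are brought to the right-hand side of \<open>twist_comult\<close>, with the
  triple tensor symbol for \<open>f\<close>: the left side by that lemma, the right side by
  unwinding one arrow after another on monomials.\<close>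

lemma transposition_comult_tens:
  assumes c: "c \<in> carrier C" and x: "x \<in> carrier X"
  shows "tensor_map R X (tensor R C C) (\<lambda>x. x) \<Delta>C (transposition (CX.tns c x)) =
      tensor_assoc R X C C (tensor_map R (tensor R X C) C transposition (\<lambda>c. c)
       (tensor_assoc_inv R C X C (tensor_map R C (tensor R X C) (\<lambda>c. c) transposition
       (tensor_assoc R C C X (tensor_map R (tensor R C C) X \<Delta>C (\<lambda>x. x) (CX.tns c x))))))"
    (is "?L = ?R")
proof -
  let ?P = "XCC.LMN.T"
  let ?f = "\<lambda>x c c'. XCC.LMN.tns x (C.CC.tns c c')"
  note P = XCC.LMN.abelian_group and D = C.comult_closed[OF c]
  have "?L = bilift ?P (\<lambda>x0 x1. XCC.LMN.tns x0 (\<Delta>C (act c x1))) (\<rho> x)"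
    unfolding tensor_map_def by (rule bilift_transposition[OF P X_comult.tensor_map_balanced c x])
  \<comment> \<open>\<open>\<Delta>C (act c x1)\<close> is rewritten as the sum of its own
    monomials, which gives \<open>twist_comult\<close> a function of three arguments.\<close>
  also have "\<dots> = bilift ?P (\<lambda>x0 x1. bilift ?P (?f x0) (\<Delta>C (act c x1))) (\<rho> x)"
  proof (rule X.VB.bilift_cong[OF P X.coaction_closed[OF x]])
    fix x0 x1 assume x0: "x0 \<in> carrier X" and x1: "x1 \<in> carrier BB"
    then have d: "\<Delta>C (act c x1) \<in> carrier C.CC.T" using c by (auto intro: C.comult_closed act_closed)
    have t: "XCC.LMN.tns x0 \<in> additive_maps C.CC.T ?P"
      by (rule additive_mapsI) (use x0 in \<open>auto simp: XCC.LMN.tens_closed XCC.LMN.tens_add_right\<close>)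
    from C.CC.hom_bilift[OF C.CC.abelian_group P t d, of "\<lambda>p q. C.CC.tns p q"]
    show "XCC.LMN.tns x0 (\<Delta>C (act c x1)) = bilift ?P (?f x0) (\<Delta>C (act c x1))"
      by (simp add: C.CC.bilift_self[OF d] C.CC.tens_closed)
    show "bilift ?P (?f x0) (\<Delta>C (act c x1)) \<in> carrier ?P"
      by (rule C.CC.bilift_closed[OF P d]) (use x0 in \<open>auto intro!: XCC.LMN.tens_closed C.CC.tens_closed\<close>)
  qed
  also have "\<dots> = bilift ?P (\<lambda>c1 c2. bilift ?P (\<lambda>x0 x1. bilift ?P
      (\<lambda>y0 y1. ?f y0 (act c1 y1) (act c2 x1)) (\<rho> x0)) (\<rho> x)) (\<Delta>C c)"
    by (rule twist_comult[OF P XCC.tribalanced_assoc c x])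
  \<comment> \<open>For fixed legs \<open>c1\<close>, \<open>c2\<close> this is the path of
    \<open>c1 \<otimes> w(c2 \<otimes> x)\<close> through the last three arrows.\<close>
  also have "\<dots> = bilift ?P (\<lambda>c1 c2. tensor_assoc R X C C (tensor_map R (tensor R X C) C transposition (\<lambda>c. c)
       (tensor_assoc_inv R C X C (CXC.LMN.tns c1 (transposition (CX.tns c2 x)))))) (\<Delta>C c)"
  proof (rule C.CC.bilift_cong[OF P D])
    fix c1 c2 assume c12: "c1 \<in> carrier C" "c2 \<in> carrier C"
    let ?w = "transposition (CX.tns c2 x)"
    let ?h = "\<lambda>z. tensor_assoc R X C C (tensor_map R (tensor R X C) C transposition (\<lambda>c. c) z)"
    have h: "?h \<in> additive_maps CXC.LMN'.T ?P"
      by (rule additive_maps_comp[OF transposition_C.tensor_map_additive XCC.assoc_additive])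
    have w: "?w \<in> carrier XC.T" using c12 x by (auto intro: transposition_closed CX.tens_closed)
    have tt: "CXC.LMN'.tns (CX.tns c1 x') c' \<in> carrier CXC.LMN'.T" if "x' \<in> carrier X" "c' \<in> carrier C" for x' c'
      using that c12 by (auto intro!: CXC.LMN'.tens_closed CX.tens_closed)
    have tb: "balanced R X C CXC.LMN'.T (\<lambda>x' c'. CXC.LMN'.tns (CX.tns c1 x') c')"
      using tribalanced_right[OF CXC.tribalanced_assoc_inv c12(1)] .
    have "?h (tensor_assoc_inv R C X C (CXC.LMN.tns c1 ?w))
        = ?h (bilift CXC.LMN'.T (\<lambda>x' c'. CXC.LMN'.tns (CX.tns c1 x') c') ?w)"
      by (simp only: CXC.assoc_inv_tens[OF c12(1) w])
    also have "\<dots> = ?h (bilift CXC.LMN'.T (\<lambda>x0 x1. CXC.LMN'.tns (CX.tns c1 x0) (act c2 x1)) (\<rho> x))"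
      by (simp only: bilift_transposition[OF CXC.LMN'.abelian_group tb c12(2) x])
    also have "\<dots> = bilift ?P (\<lambda>x0 x1. ?h (CXC.LMN'.tns (CX.tns c1 x0) (act c2 x1))) (\<rho> x)"
      by (rule X.VB.hom_bilift[OF CXC.LMN'.abelian_group P h X.coaction_closed[OF x]])
         (use c12 in \<open>auto intro!: tt act_closed\<close>)
    also have "\<dots> = bilift ?P (\<lambda>x0 x1. bilift ?P (\<lambda>y0 y1. ?f y0 (act c1 y1) (act c2 x1)) (\<rho> x0)) (\<rho> x)"
    proof (rule X.VB.bilift_cong[OF P X.coaction_closed[OF x]])
      fix x0 x1 assume x0: "x0 \<in> carrier X" and x1: "x1 \<in> carrier BB"
      have a: "act c2 x1 \<in> carrier C" using c12 x1 by (auto intro: act_closed)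
      have t: "CX.tns c1 x0 \<in> carrier CX.T" using c12 x0 by (auto intro: CX.tens_closed)
      show "?h (CXC.LMN'.tns (CX.tns c1 x0) (act c2 x1)) = bilift ?P (\<lambda>y0 y1. ?f y0 (act c1 y1) (act c2 x1)) (\<rho> x0)"
        unfolding transposition_C.tensor_map_tens[OF t a] XCC.assoc_tens[OF transposition_closed[OF t] a]
        by (rule bilift_transposition[OF P tribalanced_left[OF XCC.tribalanced_assoc a] c12(1) x0])
      show "bilift ?P (\<lambda>y0 y1. ?f y0 (act c1 y1) (act c2 x1)) (\<rho> x0) \<in> carrier ?P"
        by (rule X.VB.bilift_closed[OF P X.coaction_closed[OF x0]])
           (use a c12 in \<open>auto intro!: XCC.LMN.tens_closed C.CC.tens_closed act_closed\<close>)
    qed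
    finally show "bilift ?P (\<lambda>x0 x1. bilift ?P (\<lambda>y0 y1. ?f y0 (act c1 y1) (act c2 x1)) (\<rho> x0)) (\<rho> x)
       = ?h (tensor_assoc_inv R C X C (CXC.LMN.tns c1 ?w))" by simp
    show "?h (tensor_assoc_inv R C X C (CXC.LMN.tns c1 ?w)) \<in> carrier ?P"
      by (rule additive_maps_closed[OF h additive_maps_closed[OF CXC.assoc_inv_additive CXC.LMN.tens_closed[OF c12(1) w]]])
  qed
  also have "\<dots> = ?R"
  proof -
    \<comment> \<open>The last four arrows as one additive map, which can then be pulled inside the
      lift over \<open>\<Delta>C c\<close>.\<close>
    let ?k = "\<lambda>z. tensor_assoc R X C C (tensor_map R (tensor R X C) C transposition (\<lambda>c. c)
       (tensor_assoc_inv R C X C (tensor_map R C (tensor R X C) (\<lambda>c. c) transposition z)))"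
    have k: "?k \<in> additive_maps CCX.LMN.T ?P"
      using additive_maps_comp[OF additive_maps_comp[OF additive_maps_comp[OF C_transposition.tensor_map_additive
          CXC.assoc_inv_additive] transposition_C.tensor_map_additive] XCC.assoc_additive] .
    have "?R = ?k (bilift CCX.LMN.T (\<lambda>c1 c2. CCX.LMN.tns c1 (CX.tns c2 x)) (\<Delta>C c))"
      by (simp only: comult_X.tensor_map_tens[OF c x] CCX.assoc_tens[OF D x])
    also have "\<dots> = bilift ?P (\<lambda>c1 c2. ?k (CCX.LMN.tns c1 (CX.tns c2 x))) (\<Delta>C c)"
      by (rule C.CC.hom_bilift[OF CCX.LMN.abelian_group P k D])
         (use x in \<open>auto intro!: CCX.LMN.tens_closed CX.tens_closed\<close>)
    also have "\<dots> = bilift ?P (\<lambda>c1 c2. tensor_assoc R X C C (tensor_map R (tensor R X C) C transposition (\<lambda>c. c)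
       (tensor_assoc_inv R C X C (CXC.LMN.tns c1 (transposition (CX.tns c2 x)))))) (\<Delta>C c)"
      (is "_ = bilift ?P ?g _")
    proof (rule C.CC.bilift_cong[OF P D])
      fix c1 c2 assume c12: "c1 \<in> carrier C" "c2 \<in> carrier C"
      then have t: "CX.tns c2 x \<in> carrier CX.T" using x by (auto intro: CX.tens_closed)
      show eq: "?k (CCX.LMN.tns c1 (CX.tns c2 x)) = ?g c1 c2"
        by (simp only: C_transposition.tensor_map_tens[OF c12(1) t])
      show "?g c1 c2 \<in> carrier ?P"
        unfolding eq[symmetric] by (rule additive_maps_closed[OF k CCX.LMN.tens_closed[OF c12(1) t]])
    qed
    finally show ?thesis by simp
  qed
  finally show ?thesis .
qed

theorem dual_transposition: "dual_transposition K R C \<Delta>C \<epsilon>C X transposition"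
proof (intro dual_transposition.intro dual_transposition_axioms.intro transposition_bimodule_hom
    transposition_counit)
  show "coring K R C \<Delta>C \<epsilon>C" by (rule C.coring_axioms)
  show "bimodule K R X" by (rule XB.bimodule_axioms)
  show "tensor_map R X (tensor R C C) (\<lambda>x. x) \<Delta>C (transposition t) =
      (tensor_assoc R X C C
       \<circ> tensor_map R (tensor R X C) C transposition (\<lambda>c. c)
       \<circ> tensor_assoc_inv R C X C
       \<circ> tensor_map R C (tensor R X C) (\<lambda>c. c) transposition
       \<circ> tensor_assoc R C C X
       \<circ> tensor_map R (tensor R C C) X \<Delta>C (\<lambda>x. x)) t" if t: "t \<in> carrier CX.T" for t
  proof (rule CX.tensor_ext[OF XCC.LMN.abelian_group _ _ _ t])
    show "(\<lambda>t. tensor_map R X (tensor R C C) (\<lambda>x. x) \<Delta>C (transposition t)) \<in> additive_maps CX.T XCC.LMN.T"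
      by (rule additive_maps_comp[OF transposition_additive X_comult.tensor_map_additive])
  next
    show "(tensor_assoc R X C C
       \<circ> tensor_map R (tensor R X C) C transposition (\<lambda>c. c)
       \<circ> tensor_assoc_inv R C X C
       \<circ> tensor_map R C (tensor R X C) (\<lambda>c. c) transposition
       \<circ> tensor_assoc R C C X
       \<circ> tensor_map R (tensor R C C) X \<Delta>C (\<lambda>x. x)) \<in> additive_maps CX.T XCC.LMN.T"
      unfolding comp_def
      by (rule additive_maps_comp[OF additive_maps_comp[OF additive_maps_comp[OF additive_maps_comp[OF
          additive_maps_comp[OF comult_X.tensor_map_additive CCX.assoc_additive]
          C_transposition.tensor_map_additive] CXC.assoc_inv_additive]
          transposition_C.tensor_map_additive] XCC.assoc_additive])
  qed (simp only: comp_def transposition_comult_tens)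
qed

end

section \<open>Cyclic tensor products\<close>

text \<open>The simplicial module depends only on the coring and a coefficient bimodule; the
  bialgebroid returns with the operators \<open>w_n\<close>.\<close>

locale coring_coefficients = C: coring K R C \<Delta> \<epsilon> + X: bimodule K R X
  for K :: "'k ring" and R :: "('k, 'r) module" and C :: "('k, 'r, 'c) bimod"
    and \<Delta> :: "'c \<Rightarrow> ('c \<times> 'c \<Rightarrow>\<^sub>0 int) set" and \<epsilon> :: "'c \<Rightarrow> 'r"
    and X :: "('k, 'r, 'x) bimod"
begin

text \<open>\<open>next_list r vs\<close> and \<open>next_coeff r vs x\<close> are the two
  components of the left action of \<open>r\<close> on the monomial with factors \<open>vs\<close>
  and coefficient \<open>x\<close>.\<close>

definition next_list :: "'r \<Rightarrow> 'c list \<Rightarrow> 'c list" where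
  "next_list r vs = (case vs of [] \<Rightarrow> [] | b # vs' \<Rightarrow> lact C r b # vs')"

definition next_coeff :: "'r \<Rightarrow> 'c list \<Rightarrow> 'x \<Rightarrow> 'x" where
  "next_coeff r vs x = (if vs = [] then lact X r x else x)"

lemma next_simps [simp]:
  "next_list r [] = []" "next_list r (b # vs) = lact C r b # vs"
  "next_coeff r [] x = lact X r x" "next_coeff r (b # vs) x = x"
  "length (next_list r vs) = length vs"
  by (simp_all add: next_list_def next_coeff_def split: list.split)

definition tuples :: "nat \<Rightarrow> 'c list set" where
  "tuples m = {cs. length cs = m \<and> set cs \<subseteq> carrier C}"

lemma tuples_simps [simp]:
  "[] \<in> tuples m \<longleftrightarrow> m = 0" "c # cs \<in> tuples 0 \<longleftrightarrow> False"
  "c # cs \<in> tuples (Suc m) \<longleftrightarrow> c \<in> carrier C \<and> cs \<in> tuples m"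
  by (auto simp: tuples_def)

lemma tuples_0 [simp]: "cs \<in> tuples 0 \<longleftrightarrow> cs = []"
  by (auto simp: tuples_def)

lemma tuples_SucE:
  assumes "cs \<in> tuples (Suc m)"
  obtains c ds where "cs = c # ds" "c \<in> carrier C" "ds \<in> tuples m"
  using assms by (cases cs) auto

lemma tuples_Suc_lastE:
  assumes "cs \<in> tuples (Suc m)"
  obtains ds c where "cs = ds @ [c]" "c \<in> carrier C" "ds \<in> tuples m"
  using assms by (cases cs rule: rev_cases) (auto simp: tuples_def)

lemma append_tuples: "us \<in> tuples i \<Longrightarrow> vs \<in> tuples j \<Longrightarrow> i + j = m \<Longrightarrow> us @ vs \<in> tuples m"
  by (auto simp: tuples_def)

lemma next_list_tuples: "r \<in> carrier R \<Longrightarrow> vs \<in> tuples m \<Longrightarrow> next_list r vs \<in> tuples m"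
  by (cases vs; cases m) (auto intro: C.lact_closed)

lemma next_coeff_closed: "r \<in> carrier R \<Longrightarrow> x \<in> carrier X \<Longrightarrow> next_coeff r vs x \<in> carrier X"
  by (cases vs) (auto intro: X.lact_closed)

text \<open>The scalar in the balancing condition moves to the factor on the right, which is the coefficient
  once the list is exhausted.\<close>

definition multibalanced :: "nat \<Rightarrow> ('p, 'q) ring_scheme \<Rightarrow> ('c list \<Rightarrow> 'x \<Rightarrow> 'p) \<Rightarrow> bool" where
  "multibalanced m A F \<longleftrightarrow>
     (\<forall>cs\<in>tuples m. F cs \<in> additive_maps X A) \<and>
     (\<forall>i j us vs a b x. Suc (i + j) = m \<longrightarrow> us \<in> tuples i \<longrightarrow> vs \<in> tuples j \<longrightarrow>
        a \<in> carrier C \<longrightarrow> b \<in> carrier C \<longrightarrow> x \<in> carrier X \<longrightarrow>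
        F (us @ (a \<oplus>\<^bsub>C\<^esub> b) # vs) x = F (us @ a # vs) x \<oplus>\<^bsub>A\<^esub> F (us @ b # vs) x) \<and>
     (\<forall>i j us vs a r x. Suc (i + j) = m \<longrightarrow> us \<in> tuples i \<longrightarrow> vs \<in> tuples j \<longrightarrow>
        a \<in> carrier C \<longrightarrow> r \<in> carrier R \<longrightarrow> x \<in> carrier X \<longrightarrow>
        F (us @ ract C a r # vs) x = F (us @ a # next_list r vs) (next_coeff r vs x))"

lemma multibalanced_closed:
  "multibalanced m A F \<Longrightarrow> cs \<in> tuples m \<Longrightarrow> x \<in> carrier X \<Longrightarrow> F cs x \<in> carrier A"
  by (auto simp: multibalanced_def intro: additive_maps_closed)

lemma multibalanced_additive: "multibalanced m A F \<Longrightarrow> cs \<in> tuples m \<Longrightarrow> F cs \<in> additive_maps X A"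
  by (auto simp: multibalanced_def)

lemma multibalanced_coeff_add:
  "multibalanced m A F \<Longrightarrow> cs \<in> tuples m \<Longrightarrow> x \<in> carrier X \<Longrightarrow> y \<in> carrier X
    \<Longrightarrow> F cs (x \<oplus>\<^bsub>X\<^esub> y) = F cs x \<oplus>\<^bsub>A\<^esub> F cs y"
  by (auto simp: multibalanced_def intro: additive_maps_add)

lemma multibalanced_add:
  assumes "multibalanced m A F" "us \<in> tuples i" "vs \<in> tuples j" "Suc (i + j) = m"
    "a \<in> carrier C" "b \<in> carrier C" "x \<in> carrier X"
  shows "F (us @ (a \<oplus>\<^bsub>C\<^esub> b) # vs) x = F (us @ a # vs) x \<oplus>\<^bsub>A\<^esub> F (us @ b # vs) x"
  using assms(1)[unfolded multibalanced_def, THEN conjunct2, THEN conjunct1, rule_format, OF assms(4,2,3,5-7)] .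

lemma multibalanced_ract:
  assumes "multibalanced m A F" "us \<in> tuples i" "vs \<in> tuples j" "Suc (i + j) = m"
    "a \<in> carrier C" "r \<in> carrier R" "x \<in> carrier X"
  shows "F (us @ ract C a r # vs) x = F (us @ a # next_list r vs) (next_coeff r vs x)"
  using assms(1)[unfolded multibalanced_def, THEN conjunct2, THEN conjunct2, rule_format, OF assms(4,2,3,5-7)] .

lemma multibalanced_0: "multibalanced 0 A F \<longleftrightarrow> F [] \<in> additive_maps X A"
  by (auto simp: multibalanced_def)

lemma multibalanced_Cons:
  assumes "multibalanced (Suc m) A F" "c \<in> carrier C"
  shows "multibalanced m A (\<lambda>cs. F (c # cs))"
  unfolding multibalanced_def
proof (intro conjI ballI allI impI)
  show "F (c # cs) \<in> additive_maps X A" if "cs \<in> tuples m" for cs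
    by (rule multibalanced_additive[OF assms(1)]) (use assms(2) that in simp)
  fix i j us vs a assume *: "Suc (i + j) = m" "us \<in> tuples i" "vs \<in> tuples j" "a \<in> carrier C"
  have us: "c # us \<in> tuples (Suc i)" "Suc (Suc i + j) = Suc m" using * assms by auto
  show "F (c # us @ (a \<oplus>\<^bsub>C\<^esub> b) # vs) x = F (c # us @ a # vs) x \<oplus>\<^bsub>A\<^esub> F (c # us @ b # vs) x"
    if "b \<in> carrier C" "x \<in> carrier X" for b x
    using multibalanced_add[OF assms(1) us(1) *(3) us(2) *(4) that] by simp
  show "F (c # us @ ract C a r # vs) x = F (c # us @ a # next_list r vs) (next_coeff r vs x)"
    if "r \<in> carrier R" "x \<in> carrier X" for r x
    using multibalanced_ract[OF assms(1) us(1) *(3) us(2) *(4) that] by simp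
qed

lemma multibalanced_hd_add:
  "multibalanced (Suc m) A F \<Longrightarrow> a \<in> carrier C \<Longrightarrow> b \<in> carrier C \<Longrightarrow> cs \<in> tuples m \<Longrightarrow> x \<in> carrier X \<Longrightarrow>
    F ((a \<oplus>\<^bsub>C\<^esub> b) # cs) x = F (a # cs) x \<oplus>\<^bsub>A\<^esub> F (b # cs) x"
  using multibalanced_add[of "Suc m" A F "[]" 0 cs m a b x] by simp

lemma multibalanced_hd_ract:
  "multibalanced (Suc m) A F \<Longrightarrow> a \<in> carrier C \<Longrightarrow> r \<in> carrier R \<Longrightarrow> cs \<in> tuples m \<Longrightarrow> x \<in> carrier X \<Longrightarrow>
    F (ract C a r # cs) x = F (a # next_list r cs) (next_coeff r cs x)"
  using multibalanced_ract[of "Suc m" A F "[]" 0 cs m a r x] by simp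

lemma multibalanced_SucI:
  assumes "\<And>c. c \<in> carrier C \<Longrightarrow> multibalanced m A (\<lambda>cs. F (c # cs))"
    and "\<And>a b cs x. \<lbrakk>a \<in> carrier C; b \<in> carrier C; cs \<in> tuples m; x \<in> carrier X\<rbrakk>
      \<Longrightarrow> F ((a \<oplus>\<^bsub>C\<^esub> b) # cs) x = F (a # cs) x \<oplus>\<^bsub>A\<^esub> F (b # cs) x"
    and "\<And>a r cs x. \<lbrakk>a \<in> carrier C; r \<in> carrier R; cs \<in> tuples m; x \<in> carrier X\<rbrakk>
      \<Longrightarrow> F (ract C a r # cs) x = F (a # next_list r cs) (next_coeff r cs x)"
  shows "multibalanced (Suc m) A F"
  unfolding multibalanced_def
proof (intro conjI ballI allI impI)
  show "F cs \<in> additive_maps X A" if "cs \<in> tuples (Suc m)" for cs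
    using that by (elim tuples_SucE) (simp add: multibalanced_additive[OF assms(1)])
  fix i j us vs a assume *: "Suc (i + j) = Suc m" "us \<in> tuples i" "vs \<in> tuples j" "a \<in> carrier C"
  show "F (us @ (a \<oplus>\<^bsub>C\<^esub> b) # vs) x = F (us @ a # vs) x \<oplus>\<^bsub>A\<^esub> F (us @ b # vs) x"
    if "b \<in> carrier C" "x \<in> carrier X" for b x
  proof (cases us)
    case Nil
    then show ?thesis using assms(2)[OF *(4) that(1) _ that(2), of vs] * by auto
  next
    case (Cons u us')
    then show ?thesis
      using multibalanced_add[OF assms(1)[of u], of us' "i - 1" vs j a b x] * that by (cases i) auto
  qed
  show "F (us @ ract C a r # vs) x = F (us @ a # next_list r vs) (next_coeff r vs x)"
    if "r \<in> carrier R" "x \<in> carrier X" for r x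
  proof (cases us)
    case Nil
    then show ?thesis using assms(3)[OF *(4) that(1) _ that(2), of vs] * by auto
  next
    case (Cons u us')
    then show ?thesis
      using multibalanced_ract[OF assms(1)[of u], of us' "i - 1" vs j a r x] * that by (cases i) auto
  qed
qed

lemma multibalanced_comp:
  assumes "multibalanced m A F" "h \<in> additive_maps A A'"
  shows "multibalanced m A' (\<lambda>cs x. h (F cs x))"
  unfolding multibalanced_def
proof (intro conjI ballI allI impI)
  show "(\<lambda>x. h (F cs x)) \<in> additive_maps X A'" if "cs \<in> tuples m" for cs
    by (rule additive_maps_comp[OF multibalanced_additive[OF assms(1) that] assms(2)])
  fix i j us vs a assume *: "Suc (i + j) = m" "us \<in> tuples i" "vs \<in> tuples j" "a \<in> carrier C"
  have cl: "F (us @ b # vs) x \<in> carrier A" if "b \<in> carrier C" "x \<in> carrier X" for b x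
    by (rule multibalanced_closed[OF assms(1) append_tuples[OF *(2), of "b # vs" "Suc j"] that(2)])
       (use that * in auto)
  show "h (F (us @ (a \<oplus>\<^bsub>C\<^esub> b) # vs) x) = h (F (us @ a # vs) x) \<oplus>\<^bsub>A'\<^esub> h (F (us @ b # vs) x)"
    if "b \<in> carrier C" "x \<in> carrier X" for b x
    using that * by (simp add: multibalanced_add[OF assms(1)] cl additive_maps_add[OF assms(2)])
  show "h (F (us @ ract C a r # vs) x) = h (F (us @ a # next_list r vs) (next_coeff r vs x))"
    if "r \<in> carrier R" "x \<in> carrier X" for r x
    using that * by (simp add: multibalanced_ract[OF assms(1)])
qed

text \<open>This lemma and the next two show that the scalar operations on
  \<open>multi_tensor\<close> (by \<open>K\<close>, from the right, from the left) preserve the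
  balancing conditions; the last two rely on commuting left and right actions.\<close>

lemma multibalanced_smult:
  assumes "multibalanced m A F" "k \<in> carrier K"
  shows "multibalanced m A (\<lambda>cs x. F cs (k \<odot>\<^bsub>X\<^esub> x))"
  unfolding multibalanced_def
proof (intro conjI ballI allI impI)
  show "(\<lambda>x. F cs (k \<odot>\<^bsub>X\<^esub> x)) \<in> additive_maps X A" if "cs \<in> tuples m" for cs
    by (rule additive_maps_comp[OF _ multibalanced_additive[OF assms(1) that]])
       (rule additive_mapsI, use assms(2) X.smult_r_distr in auto)
  fix i j us vs a assume *: "Suc (i + j) = m" "us \<in> tuples i" "vs \<in> tuples j" "a \<in> carrier C"
  show "F (us @ (a \<oplus>\<^bsub>C\<^esub> b) # vs) (k \<odot>\<^bsub>X\<^esub> x) = F (us @ a # vs) (k \<odot>\<^bsub>X\<^esub> x) \<oplus>\<^bsub>A\<^esub> F (us @ b # vs) (k \<odot>\<^bsub>X\<^esub> x)"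
    if "b \<in> carrier C" "x \<in> carrier X" for b x
    using that * assms(2) by (simp add: multibalanced_add[OF assms(1)])
  show "F (us @ ract C a r # vs) (k \<odot>\<^bsub>X\<^esub> x) = F (us @ a # next_list r vs) (k \<odot>\<^bsub>X\<^esub> next_coeff r vs x)"
    if "r \<in> carrier R" "x \<in> carrier X" for r x
    using that * assms(2) by (cases vs) (simp_all add: multibalanced_ract[OF assms(1)] X.lact_smult_right)
qed

lemma multibalanced_coeff_ract:
  assumes "multibalanced m A F" "s \<in> carrier R"
  shows "multibalanced m A (\<lambda>cs x. F cs (ract X x s))"
  unfolding multibalanced_def
proof (intro conjI ballI allI impI)
  show "(\<lambda>x. F cs (ract X x s)) \<in> additive_maps X A" if "cs \<in> tuples m" for cs
    by (rule additive_maps_comp[OF _ multibalanced_additive[OF assms(1) that]])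
       (rule additive_mapsI, use assms(2) X.ract_add_left X.ract_closed in auto)
  fix i j us vs a assume *: "Suc (i + j) = m" "us \<in> tuples i" "vs \<in> tuples j" "a \<in> carrier C"
  show "F (us @ (a \<oplus>\<^bsub>C\<^esub> b) # vs) (ract X x s) = F (us @ a # vs) (ract X x s) \<oplus>\<^bsub>A\<^esub> F (us @ b # vs) (ract X x s)"
    if "b \<in> carrier C" "x \<in> carrier X" for b x
    using that * assms(2) by (simp add: multibalanced_add[OF assms(1)] X.ract_closed)
  show "F (us @ ract C a r # vs) (ract X x s) = F (us @ a # next_list r vs) (ract X (next_coeff r vs x) s)"
    if "r \<in> carrier R" "x \<in> carrier X" for r x
    using that * assms(2)
    by (cases vs) (simp_all add: multibalanced_ract[OF assms(1)] X.lact_ract X.ract_closed)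
qed

lemma multibalanced_hd_lact:
  assumes "multibalanced (Suc m) A F" "s \<in> carrier R"
  shows "multibalanced (Suc m) A (\<lambda>cs x. F (lact C s (hd cs) # tl cs) x)"
  by (rule multibalanced_SucI)
     (use assms in \<open>simp_all add: multibalanced_Cons C.lact_closed C.lact_add_right
       multibalanced_hd_add[OF assms(1)] C.lact_ract[symmetric] multibalanced_hd_ract[OF assms(1)]\<close>)

section \<open>The module presented on lists of factors\<close>

sublocale mt: presented_group "multi_tensor R C X n" "multi_tensor_rels R C X n" "tuples (Suc n) \<times> carrier X"
  for n
proof
  show "Poly_Mapping.keys r \<subseteq> tuples (Suc n) \<times> carrier X" if "r \<in> multi_tensor_rels R C X n" for r
    using that unfolding multi_tensor_rels_def
    by (elim UnE CollectE exE conjE; hypsubst; intro order_trans[OF keys_diff_of(1)] order_trans[OF keys_diff_of(2)])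
       (auto simp: tuples_def intro: C.ract_closed C.lact_closed X.lact_closed)
qed (simp_all add: multi_tensor_def Let_def tuples_def)

abbreviation MT where "MT n \<equiv> multi_tensor R C X n"

abbreviation mono where "mono n cs x \<equiv> mt.monomial n (cs, x)"

lemma mono_multibalanced: "multibalanced (Suc n) (MT n) (mono n)"
  unfolding multibalanced_def
proof (intro conjI ballI allI impI additive_mapsI)
  show "mono n cs x \<in> carrier (MT n)" if "cs \<in> tuples (Suc n)" "x \<in> carrier X" for cs x
    using that by (intro mt.monomial_closed) auto
  show "mono n cs (x \<oplus>\<^bsub>X\<^esub> y) = mono n cs x \<oplus>\<^bsub>MT n\<^esub> mono n cs y"
    if "cs \<in> tuples (Suc n)" "x \<in> carrier X" "y \<in> carrier X" for cs x y
    by (rule mt.monomial_add) (use that in \<open>unfold multi_tensor_rels_def tuples_def; blast\<close>)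
  fix i j us vs a assume "Suc (i + j) = Suc n" "us \<in> tuples i" "vs \<in> tuples j" "a \<in> carrier C"
  then have *: "length us + length vs = n" "set us \<subseteq> carrier C" "set vs \<subseteq> carrier C" "a \<in> carrier C"
    by (auto simp: tuples_def)
  show "mono n (us @ (a \<oplus>\<^bsub>C\<^esub> b) # vs) x = mono n (us @ a # vs) x \<oplus>\<^bsub>MT n\<^esub> mono n (us @ b # vs) x"
    if "b \<in> carrier C" "x \<in> carrier X" for b x
    by (rule mt.monomial_add) (use that * in \<open>unfold multi_tensor_rels_def; blast\<close>)
  show "mono n (us @ ract C a r # vs) x = mono n (us @ a # next_list r vs) (next_coeff r vs x)"
    if "r \<in> carrier R" "x \<in> carrier X" for r x
  \<comment> \<open>The two families of middle relations, inside the list and between the last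
    factor and the coefficient, are a single condition in terms of \<open>next_list\<close>.\<close>
  proof (cases vs)
    case Nil
    show ?thesis
      unfolding Nil next_simps
      by (rule mt.monomial_eq) (use that * Nil in \<open>unfold multi_tensor_rels_def; auto\<close>)
  next
    case (Cons b vs')
    have "Suc (length us + length vs') = n" "set vs' \<subseteq> carrier C" "b \<in> carrier C" using Cons * by auto
    then show ?thesis
      unfolding Cons next_simps
      by (intro mt.monomial_eq) (use that * in \<open>unfold multi_tensor_rels_def; blast\<close>)
  qed
qed

lemma respects_rels_multibalanced:
  assumes "abelian_group A" "multibalanced (Suc n) A F"
  shows "mt.respects_rels n A (\<lambda>(cs, x). F cs x)"
  unfolding mt.respects_rels_def
proof (intro conjI ballI)
  interpret A: abelian_group A by fact
  note cl = multibalanced_closed[OF assms(2)]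
  show "(\<lambda>(cs, x). F cs x) \<in> tuples (Suc n) \<times> carrier X \<rightarrow> carrier A"
    using cl by auto
  have ap: "us @ vs \<in> tuples (Suc n)"
    if "length us + length vs = Suc n" "set us \<subseteq> carrier C" "set vs \<subseteq> carrier C" for us vs
    using that by (auto simp: tuples_def)
  have tup: "us \<in> tuples (length us)" if "set us \<subseteq> carrier C" for us using that by (simp add: tuples_def)
  have mid: "F (us @ ract C a r # b # vs) x = F (us @ a # lact C r b # vs) x"
    if "Suc (length us + length vs) = n" "set us \<subseteq> carrier C" "set vs \<subseteq> carrier C" "a \<in> carrier C"
      "r \<in> carrier R" "b \<in> carrier C" "x \<in> carrier X" for us a r b vs x
    using multibalanced_ract[OF assms(2) tup[OF that(2)], of "b # vs" "Suc (length vs)" a r x] that tup[OF that(3)]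
    by simp
  have last: "F (us @ [ract C a r]) x = F (us @ [a]) (lact X r x)"
    if "length us = n" "set us \<subseteq> carrier C" "a \<in> carrier C" "r \<in> carrier R" "x \<in> carrier X" for us a r x
    using multibalanced_ract[OF assms(2) tup[OF that(2)], of "[]" 0 a r x] that by simp
  have add: "F (us @ (a \<oplus>\<^bsub>C\<^esub> b) # vs) x = F (us @ a # vs) x \<oplus>\<^bsub>A\<^esub> F (us @ b # vs) x"
    if "length us + length vs = n" "set us \<subseteq> carrier C" "set vs \<subseteq> carrier C" "a \<in> carrier C"
      "b \<in> carrier C" "x \<in> carrier X" for us a b vs x
    using multibalanced_add[OF assms(2) tup[OF that(2)] tup[OF that(3)]] that by simp
  fix r assume "r \<in> multi_tensor_rels R C X n"
  then show "frag_eval A (\<lambda>(cs, x). F cs x) r = \<zero>\<^bsub>A\<^esub>"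
    unfolding multi_tensor_rels_def
    by (elim UnE CollectE exE conjE; hypsubst; intro A.frag_eval_diff_of A.frag_eval_diff_diff_of)
       (simp_all add: mid last add cl ap C.lact_closed X.lact_closed tuples_def multibalanced_coeff_add[OF assms(2)])
qed

lemma mt_lift_mono:
  assumes "abelian_group A" "multibalanced (Suc n) A F" "cs \<in> tuples (Suc n)" "x \<in> carrier X"
  shows "pres_lift A (\<lambda>(cs, x). F cs x) (mono n cs x) = F cs x"
  using mt.pres_lift_monomial[OF assms(1) respects_rels_multibalanced[OF assms(1,2)], of "(cs, x)"] assms(3,4)
  by simp

lemma mt_lift_additive:
  assumes "abelian_group A" "multibalanced (Suc n) A F"
  shows "pres_lift A (\<lambda>(cs, x). F cs x) \<in> additive_maps (MT n) A"
  by (rule mt.pres_lift_additive[OF assms(1) respects_rels_multibalanced[OF assms]])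

lemma mt_ext:
  assumes "abelian_group A" "h \<in> additive_maps (MT n) A" "h' \<in> additive_maps (MT n) A"
    "\<And>cs x. \<lbrakk>cs \<in> tuples (Suc n); x \<in> carrier X\<rbrakk> \<Longrightarrow> h (mono n cs x) = h' (mono n cs x)" "y \<in> carrier (MT n)"
  shows "h y = h' y"
  by (rule mt.additive_ext[OF assms(1-3) _ assms(5)]) (use assms(4) in auto)

lemma mono_closed: "cs \<in> tuples (Suc n) \<Longrightarrow> x \<in> carrier X \<Longrightarrow> mono n cs x \<in> carrier (MT n)"
  by (rule multibalanced_closed[OF mono_multibalanced])

lemma mt_smult:
  assumes k: "k \<in> carrier K"
  shows mt_smult_additive: "(\<lambda>y. k \<odot>\<^bsub>MT n\<^esub> y) \<in> additive_maps (MT n) (MT n)"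
    and mt_smult_mono: "\<lbrakk>cs \<in> tuples (Suc n); x \<in> carrier X\<rbrakk> \<Longrightarrow> k \<odot>\<^bsub>MT n\<^esub> mono n cs x = mono n cs (k \<odot>\<^bsub>X\<^esub> x)"
proof -
  have eq: "k \<odot>\<^bsub>MT n\<^esub> y = pres_lift (MT n) (\<lambda>(cs, x). mono n cs (k \<odot>\<^bsub>X\<^esub> x)) y" if "y \<in> carrier (MT n)" for y
    using mt.cls_frag_extend_some_rep[OF that, of "\<lambda>(cs, x). (cs, k \<odot>\<^bsub>X\<^esub> x)"] k
    by (auto simp: multi_tensor_def Let_def split_beta')
  note b = multibalanced_smult[OF mono_multibalanced k]
  show "(\<lambda>y. k \<odot>\<^bsub>MT n\<^esub> y) \<in> additive_maps (MT n) (MT n)"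
    by (rule additive_maps_cong[OF mt.abelian_group mt_lift_additive[OF mt.abelian_group b]]) (auto simp: eq)
  show "k \<odot>\<^bsub>MT n\<^esub> mono n cs x = mono n cs (k \<odot>\<^bsub>X\<^esub> x)" if "cs \<in> tuples (Suc n)" "x \<in> carrier X"
    using that by (simp add: eq mono_closed mt_lift_mono[OF mt.abelian_group b])
qed

lemma mt_lact:
  assumes r: "r \<in> carrier R"
  shows mt_lact_additive: "(\<lambda>y. lact (MT n) r y) \<in> additive_maps (MT n) (MT n)"
    and mt_lact_mono: "\<lbrakk>c # cs \<in> tuples (Suc n); x \<in> carrier X\<rbrakk>
      \<Longrightarrow> lact (MT n) r (mono n (c # cs) x) = mono n (lact C r c # cs) x"
proof -
  have cl: "lact C r (hd cs) # tl cs \<in> tuples (Suc n)" if "cs \<in> tuples (Suc n)" for cs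
    using that r by (elim tuples_SucE) (auto intro: C.lact_closed)
  have eq: "lact (MT n) r y = pres_lift (MT n) (\<lambda>(cs, x). mono n (lact C r (hd cs) # tl cs) x) y"
    if "y \<in> carrier (MT n)" for y
    using mt.cls_frag_extend_some_rep[OF that, of "\<lambda>(cs, x). (lact C r (hd cs) # tl cs, x)"] cl
    by (auto simp: multi_tensor_def Let_def split_beta')
  note b = multibalanced_hd_lact[OF mono_multibalanced r]
  show "(\<lambda>y. lact (MT n) r y) \<in> additive_maps (MT n) (MT n)"
    by (rule additive_maps_cong[OF mt.abelian_group mt_lift_additive[OF mt.abelian_group b]]) (auto simp: eq)
  show "lact (MT n) r (mono n (c # cs) x) = mono n (lact C r c # cs) x" if "c # cs \<in> tuples (Suc n)" "x \<in> carrier X"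
    using that mt_lift_mono[OF mt.abelian_group b that] by (simp add: eq mono_closed)
qed

lemma mt_ract:
  assumes r: "r \<in> carrier R"
  shows mt_ract_additive: "(\<lambda>y. ract (MT n) y r) \<in> additive_maps (MT n) (MT n)"
    and mt_ract_mono: "\<lbrakk>cs \<in> tuples (Suc n); x \<in> carrier X\<rbrakk> \<Longrightarrow> ract (MT n) (mono n cs x) r = mono n cs (ract X x r)"
proof -
  have eq: "ract (MT n) y r = pres_lift (MT n) (\<lambda>(cs, x). mono n cs (ract X x r)) y" if "y \<in> carrier (MT n)" for y
    using mt.cls_frag_extend_some_rep[OF that, of "\<lambda>(cs, x). (cs, ract X x r)"] r X.ract_closed
    by (auto simp: multi_tensor_def Let_def split_beta')
  note b = multibalanced_coeff_ract[OF mono_multibalanced r]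
  show "(\<lambda>y. ract (MT n) y r) \<in> additive_maps (MT n) (MT n)"
    by (rule additive_maps_cong[OF mt.abelian_group mt_lift_additive[OF mt.abelian_group b]]) (auto simp: eq)
  show "ract (MT n) (mono n cs x) r = mono n cs (ract X x r)" if "cs \<in> tuples (Suc n)" "x \<in> carrier X"
    using that by (simp add: eq mono_closed mt_lift_mono[OF mt.abelian_group b])
qed

lemma mt_module: "module K (MT n)"
proof (rule moduleI)
  note AB = mt.abelian_group[of n]
  note comp = additive_maps_comp and plus = additive_maps_plus[OF AB]
  show "cring K" by (rule C.R.is_cring)
  show "abelian_group (MT n)" by (rule AB)
  show "k \<odot>\<^bsub>MT n\<^esub> S \<in> carrier (MT n)" if "k \<in> carrier K" "S \<in> carrier (MT n)" for k S
    by (rule additive_maps_closed[OF mt_smult_additive[OF that(1)] that(2)])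
  show "k \<odot>\<^bsub>MT n\<^esub> (S \<oplus>\<^bsub>MT n\<^esub> S') = k \<odot>\<^bsub>MT n\<^esub> S \<oplus>\<^bsub>MT n\<^esub> k \<odot>\<^bsub>MT n\<^esub> S'"
    if "k \<in> carrier K" "S \<in> carrier (MT n)" "S' \<in> carrier (MT n)" for k S S'
    by (rule additive_maps_add[OF mt_smult_additive[OF that(1)] that(2,3)])
  show "(k \<oplus>\<^bsub>K\<^esub> k') \<odot>\<^bsub>MT n\<^esub> S = k \<odot>\<^bsub>MT n\<^esub> S \<oplus>\<^bsub>MT n\<^esub> k' \<odot>\<^bsub>MT n\<^esub> S"
    if "k \<in> carrier K" "k' \<in> carrier K" "S \<in> carrier (MT n)" for k k' S
    by (rule mt_ext[OF AB _ _ _ that(3)])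
       (use that in \<open>auto simp: mt_smult_mono X.smult_l_distr multibalanced_coeff_add[OF mono_multibalanced]
          intro!: mt_smult_additive plus\<close>)
  show "(k \<otimes>\<^bsub>K\<^esub> k') \<odot>\<^bsub>MT n\<^esub> S = k \<odot>\<^bsub>MT n\<^esub> (k' \<odot>\<^bsub>MT n\<^esub> S)"
    if "k \<in> carrier K" "k' \<in> carrier K" "S \<in> carrier (MT n)" for k k' S
    by (rule mt_ext[OF AB _ _ _ that(3)])
       (use that in \<open>auto simp: mt_smult_mono X.smult_assoc1
          intro!: mt_smult_additive comp[OF mt_smult_additive mt_smult_additive]\<close>)
  show "\<one>\<^bsub>K\<^esub> \<odot>\<^bsub>MT n\<^esub> S = S" if "S \<in> carrier (MT n)" for S
    by (rule mt_ext[OF AB _ _ _ that])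
       (auto simp: mt_smult_mono intro!: mt_smult_additive additive_maps_id)
qed

end

text \<open>Only closure of the two actions of \<open>R\<close> is asked, so the quotient is
  available for \<open>multi_tensor\<close> once that is a \<open>K\<close>-module.\<close>

locale commutator_quotient = module K Y
  for K :: "'k ring" and R :: "('k, 'r) module" and Y :: "('k, 'r, 'y) bimod" +
  assumes lact_in: "\<lbrakk>r \<in> carrier R; y \<in> carrier Y\<rbrakk> \<Longrightarrow> lact Y r y \<in> carrier Y"
    and ract_in: "\<lbrakk>y \<in> carrier Y; r \<in> carrier R\<rbrakk> \<Longrightarrow> ract Y y r \<in> carrier Y"
begin

abbreviation commutators where "commutators \<equiv> commutator_submodule K R Y"

abbreviation Q where "Q \<equiv> cyclic_quotient K R Y"

abbreviation proj where "proj y \<equiv> commutators +>\<^bsub>Y\<^esub> y"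

lemma commutators_least:
  assumes "submodule H K Y" "\<And>r y. \<lbrakk>r \<in> carrier R; y \<in> carrier Y\<rbrakk> \<Longrightarrow> lact Y r y \<ominus>\<^bsub>Y\<^esub> ract Y y r \<in> H"
  shows "commutators \<subseteq> H"
  using assms unfolding commutator_submodule_def by blast

lemma commutator_in: "\<lbrakk>r \<in> carrier R; y \<in> carrier Y\<rbrakk> \<Longrightarrow> lact Y r y \<ominus>\<^bsub>Y\<^esub> ract Y y r \<in> commutators"
  unfolding commutator_submodule_def by blast

lemma submodule_zero: "submodule H K Y \<Longrightarrow> \<zero>\<^bsub>Y\<^esub> \<in> H"
  using subgroup.one_closed[OF submodule.axioms(1)] by fastforce

lemma commutators_submodule: "submodule commutators K Y"
proof (rule submoduleI)
  \<comment> \<open>The whole module is one of the submodules intersected, so the intersection does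
    not leave the carrier.\<close>
  show "commutators \<subseteq> carrier Y"
    by (rule commutators_least[OF carrier_is_submodule]) (simp add: lact_in ract_in)
qed (auto simp: commutator_submodule_def submodule_zero intro: submoduleE(3,4,5))

sublocale N: abelian_subgroup commutators Y
  by (rule abelian_subgroupI3)
     (auto intro: additive_subgroupI submodule.axioms(1)[OF commutators_submodule] abelian_group_axioms)

lemma carrier_Q: "carrier Q = proj ` carrier Y"
  by (auto simp: cyclic_quotient_def Let_def A_RCOSETS_def')

lemma proj_closed: "y \<in> carrier Y \<Longrightarrow> proj y \<in> carrier Q"
  by (simp add: carrier_Q)

lemma proj_add: "\<lbrakk>y \<in> carrier Y; z \<in> carrier Y\<rbrakk> \<Longrightarrow> proj (y \<oplus>\<^bsub>Y\<^esub> z) = proj y \<oplus>\<^bsub>Q\<^esub> proj z"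
  by (simp add: cyclic_quotient_def Let_def N.a_rcos_sum)

lemma proj_zero: "proj \<zero>\<^bsub>Y\<^esub> = \<zero>\<^bsub>Q\<^esub>"
  using a_coset_join2[OF zero_closed N.a_subgroup N.zero_closed] by (simp add: cyclic_quotient_def Let_def)

lemma proj_eqI: "\<lbrakk>y \<in> carrier Y; z \<in> carrier Y; y \<ominus>\<^bsub>Y\<^esub> z \<in> commutators\<rbrakk> \<Longrightarrow> proj y = proj z"
  using N.a_rcos_module_rev[of z y] N.a_repr_independence'[of y z] by (simp add: a_minus_def)

lemma proj_eqD: "\<lbrakk>y \<in> carrier Y; z \<in> proj y\<rbrakk> \<Longrightarrow> z \<in> carrier Y \<and> z \<ominus>\<^bsub>Y\<^esub> y \<in> commutators"
  using N.a_elemrcos_carrier[of y z] N.a_rcos_module_imp[of y z] by (simp add: a_minus_def)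

lemma self_in_proj: "y \<in> carrier Y \<Longrightarrow> y \<in> proj y"
  by (rule N.a_rcos_self)

lemma proj_commute: "\<lbrakk>r \<in> carrier R; y \<in> carrier Y\<rbrakk> \<Longrightarrow> proj (lact Y r y) = proj (ract Y y r)"
  by (rule proj_eqI) (auto simp: lact_in ract_in commutator_in)

text \<open>The scalar multiple in the quotient is a union over the members of a coset. These differ
  by commutators, and the submodule is closed under \<open>k\<close>, so all cosets in the union
  coincide.\<close>

lemma proj_smult:
  assumes k: "k \<in> carrier K" and y: "y \<in> carrier Y"
  shows "proj (k \<odot>\<^bsub>Y\<^esub> y) = k \<odot>\<^bsub>Q\<^esub> proj y"
proof -
  have "proj (k \<odot>\<^bsub>Y\<^esub> z) = proj (k \<odot>\<^bsub>Y\<^esub> y)" if "z \<in> proj y" for z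
  proof (rule proj_eqI)
    have z: "z \<in> carrier Y" "z \<ominus>\<^bsub>Y\<^esub> y \<in> commutators" using proj_eqD[OF y that] by auto
    show "k \<odot>\<^bsub>Y\<^esub> z \<in> carrier Y" "k \<odot>\<^bsub>Y\<^esub> y \<in> carrier Y" using k y z by auto
    have "k \<odot>\<^bsub>Y\<^esub> z \<ominus>\<^bsub>Y\<^esub> k \<odot>\<^bsub>Y\<^esub> y = k \<odot>\<^bsub>Y\<^esub> (z \<ominus>\<^bsub>Y\<^esub> y)"
      using k y z by (simp add: a_minus_def smult_r_distr smult_r_minus)
    then show "k \<odot>\<^bsub>Y\<^esub> z \<ominus>\<^bsub>Y\<^esub> k \<odot>\<^bsub>Y\<^esub> y \<in> commutators"
      using submodule.smult_closed[OF commutators_submodule k z(2)] by simp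
  qed
  then have "(\<Union>z\<in>proj y. proj (k \<odot>\<^bsub>Y\<^esub> z)) = proj (k \<odot>\<^bsub>Y\<^esub> y)"
    using self_in_proj[OF y] by blast
  then show ?thesis by (simp add: cyclic_quotient_def Let_def)
qed

lemma module_Q: "module K Q"
proof (rule moduleI)
  show "cring K" by (rule is_cring)
  show "abelian_group Q"
  proof (rule abelian_groupI)
    show "\<exists>T\<in>carrier Q. T \<oplus>\<^bsub>Q\<^esub> S = \<zero>\<^bsub>Q\<^esub>" if "S \<in> carrier Q" for S
    proof -
      from that obtain y where y: "y \<in> carrier Y" "S = proj y" by (auto simp: carrier_Q)
      have "proj (\<ominus>\<^bsub>Y\<^esub> y) \<oplus>\<^bsub>Q\<^esub> S = \<zero>\<^bsub>Q\<^esub>"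
        using y by (simp add: proj_add[symmetric] l_neg proj_zero)
      then show ?thesis using y by (blast intro: proj_closed a_inv_closed)
    qed
  qed (auto simp: carrier_Q proj_add[symmetric] proj_zero[symmetric] a_ac)
qed (auto simp: carrier_Q proj_add[symmetric] proj_smult[symmetric] smult_l_distr smult_r_distr smult_assoc1)

lemma proj_linear: "(\<lambda>y. proj y) \<in> linear_maps K Y Q"
  by (auto simp: linear_maps_def proj_closed proj_add proj_smult)

text \<open>The kernel of a \<open>K\<close>-linear \<open>h\<close> is a submodule; if it contains
  all commutators it contains the least submodule that does, so the choice of a member of the coset
  does not affect \<open>h\<close>.\<close>

lemma lift_some_rep:
  assumes A: "module K A" and h: "h \<in> linear_maps K Y A"
    and comm: "\<And>r y. \<lbrakk>r \<in> carrier R; y \<in> carrier Y\<rbrakk> \<Longrightarrow> h (lact Y r y) = h (ract Y y r)"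
    and y: "y \<in> carrier Y"
  shows "h (some_rep (proj y)) = h y"
proof -
  interpret A: module K A by fact
  note ha = linear_maps_additive[OF h]
  have hs: "h (k \<odot>\<^bsub>Y\<^esub> y) = k \<odot>\<^bsub>A\<^esub> h y" if "k \<in> carrier K" "y \<in> carrier Y" for k y
    using h that by (auto simp: linear_maps_def)
  note hcl = additive_maps_closed[OF ha]
  note hdiff = additive_maps_diff[OF abelian_group_axioms A.abelian_group_axioms ha]
  let ?H = "{y \<in> carrier Y. h y = \<zero>\<^bsub>A\<^esub>}"
  have "submodule ?H K Y"
  proof (rule submoduleI)
    show "\<zero>\<^bsub>Y\<^esub> \<in> ?H" using additive_maps_zero[OF abelian_group_axioms A.abelian_group_axioms ha] by simp
    fix a assume a: "a \<in> ?H"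
    have "h (\<zero>\<^bsub>Y\<^esub> \<ominus>\<^bsub>Y\<^esub> a) = \<zero>\<^bsub>A\<^esub>"
      using a hdiff[of "\<zero>\<^bsub>Y\<^esub>" a] additive_maps_zero[OF abelian_group_axioms A.abelian_group_axioms ha]
      by (simp add: A.minus_eq_zero_iff)
    then show "\<ominus>\<^bsub>Y\<^esub> a \<in> ?H" using a by (simp add: a_minus_def)
  qed (auto simp: additive_maps_add[OF ha] hs)
  moreover have "lact Y r y \<ominus>\<^bsub>Y\<^esub> ract Y y r \<in> ?H" if "r \<in> carrier R" "y \<in> carrier Y" for r y
    using that by (simp add: lact_in ract_in hdiff comm hcl A.minus_eq_zero_iff)
  ultimately have N: "commutators \<subseteq> ?H" by (rule commutators_least)
  have "some_rep (proj y) \<in> proj y"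
    unfolding some_rep_def using self_in_proj[OF y] by (rule someI)
  then have z: "some_rep (proj y) \<in> carrier Y" "some_rep (proj y) \<ominus>\<^bsub>Y\<^esub> y \<in> commutators"
    using proj_eqD[OF y] by auto
  then have "h (some_rep (proj y) \<ominus>\<^bsub>Y\<^esub> y) = \<zero>\<^bsub>A\<^esub>" using N by blast
  then show ?thesis using hdiff[OF z(1) y] hcl z(1) y by (simp add: A.minus_eq_zero_iff)
qed

end

section \<open>Maps out of the cyclic tensor product\<close>

context coring_coefficients
begin

sublocale cq: commutator_quotient K R "multi_tensor R C X n" for n
proof (intro commutator_quotient.intro commutator_quotient_axioms.intro mt_module)
  show "lact (MT n) r y \<in> carrier (MT n)" if "r \<in> carrier R" "y \<in> carrier (MT n)" for r y
    by (rule additive_maps_closed[OF mt_lact_additive[OF that(1)] that(2)])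
  show "ract (MT n) y r \<in> carrier (MT n)" if "y \<in> carrier (MT n)" "r \<in> carrier R" for r y
    by (rule additive_maps_closed[OF mt_ract_additive[OF that(2)] that(1)])
qed

abbreviation Z where "Z \<equiv> cyc K R C X"

abbreviation ct where "ct n \<equiv> cyc_tens K R C X n"

lemma cyc_module: "module K (Z n)"
  unfolding cyc_def by (rule cq.module_Q)

lemma ct_eq: "ct n cs x = cq.proj n (mono n cs x)"
  by (simp add: cyc_tens_def Let_def)

text \<open>The functions on monomials that induce \<open>K\<close>-linear maps on \<open>C\<^sup>\<otimes>\<^sup>n\<^sup>+\<^sup>1 \<otimes> X\<close> modulo commutators.\<close>

definition cyc_functional :: "nat \<Rightarrow> ('k, 'p, 'q) module_scheme \<Rightarrow> ('c list \<Rightarrow> 'x \<Rightarrow> 'p) \<Rightarrow> bool" where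
  "cyc_functional n A F \<longleftrightarrow> multibalanced (Suc n) A F \<and>
     (\<forall>cs\<in>tuples (Suc n). \<forall>k\<in>carrier K. \<forall>x\<in>carrier X. F cs (k \<odot>\<^bsub>X\<^esub> x) = k \<odot>\<^bsub>A\<^esub> F cs x) \<and>
     (\<forall>c\<in>carrier C. \<forall>cs\<in>tuples n. \<forall>r\<in>carrier R. \<forall>x\<in>carrier X.
        F (lact C r c # cs) x = F (c # cs) (ract X x r))"

lemma cyc_functionalI:
  assumes "multibalanced (Suc n) A F"
    and "\<And>cs k x. \<lbrakk>cs \<in> tuples (Suc n); k \<in> carrier K; x \<in> carrier X\<rbrakk> \<Longrightarrow> F cs (k \<odot>\<^bsub>X\<^esub> x) = k \<odot>\<^bsub>A\<^esub> F cs x"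
    and "\<And>c cs r x. \<lbrakk>c \<in> carrier C; cs \<in> tuples n; r \<in> carrier R; x \<in> carrier X\<rbrakk>
        \<Longrightarrow> F (lact C r c # cs) x = F (c # cs) (ract X x r)"
  shows "cyc_functional n A F"
  using assms by (simp add: cyc_functional_def)

lemma cyc_functional_multibalanced: "cyc_functional n A F \<Longrightarrow> multibalanced (Suc n) A F"
  and cyc_functional_smult: "\<lbrakk>cyc_functional n A F; cs \<in> tuples (Suc n); k \<in> carrier K; x \<in> carrier X\<rbrakk>
    \<Longrightarrow> F cs (k \<odot>\<^bsub>X\<^esub> x) = k \<odot>\<^bsub>A\<^esub> F cs x"
  and cyc_functional_lact: "\<lbrakk>cyc_functional n A F; c \<in> carrier C; cs \<in> tuples n; r \<in> carrier R; x \<in> carrier X\<rbrakk>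
    \<Longrightarrow> F (lact C r c # cs) x = F (c # cs) (ract X x r)"
  by (simp_all add: cyc_functional_def)

lemma ct_functional: "cyc_functional n (Z n) (ct n)"
proof (rule cyc_functionalI)
  note l = cq.proj_linear[of n, folded cyc_def]
  show "multibalanced (Suc n) (Z n) (ct n)"
    using multibalanced_comp[OF mono_multibalanced linear_maps_additive[OF l]]
    by (simp add: ct_eq[abs_def])
  show "ct n cs (k \<odot>\<^bsub>X\<^esub> x) = k \<odot>\<^bsub>Z n\<^esub> ct n cs x" if "cs \<in> tuples (Suc n)" "k \<in> carrier K" "x \<in> carrier X" for cs k x
    using that cq.proj_smult[OF that(2) mono_closed[OF that(1,3)], folded cyc_def]
    by (simp add: ct_eq mt_smult_mono)
  show "ct n (lact C r c # cs) x = ct n (c # cs) (ract X x r)"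
    if "c \<in> carrier C" "cs \<in> tuples n" "r \<in> carrier R" "x \<in> carrier X" for c cs r x
    using that cq.proj_commute[of r "mono n (c # cs) x" n]
    by (simp add: ct_eq mt_lact_mono mt_ract_mono mono_closed)
qed

lemma ct_closed: "cs \<in> tuples (Suc n) \<Longrightarrow> x \<in> carrier X \<Longrightarrow> ct n cs x \<in> carrier (Z n)"
  by (rule multibalanced_closed[OF cyc_functional_multibalanced[OF ct_functional]])

lemma cyc_ext:
  assumes "abelian_group A" "h \<in> additive_maps (Z n) A" "h' \<in> additive_maps (Z n) A"
    "\<And>cs x. \<lbrakk>cs \<in> tuples (Suc n); x \<in> carrier X\<rbrakk> \<Longrightarrow> h (ct n cs x) = h' (ct n cs x)" "z \<in> carrier (Z n)"
  shows "h z = h' z"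
proof -
  note l = linear_maps_additive[OF cq.proj_linear[of n, folded cyc_def]]
  from assms(5) obtain y where y: "y \<in> carrier (MT n)" "z = cq.proj n y"
    by (auto simp: cyc_def cq.carrier_Q)
  have "h (cq.proj n y) = h' (cq.proj n y)"
    by (rule mt_ext[OF assms(1) additive_maps_comp[OF l assms(2)] additive_maps_comp[OF l assms(3)] _ y(1)])
       (simp add: assms(4) ct_eq[symmetric])
  then show ?thesis using y by simp
qed

lemma mt_lift_linear:
  assumes A: "module K A" and F: "cyc_functional n A F"
  shows "pres_lift A (\<lambda>(cs, x). F cs x) \<in> linear_maps K (MT n) A"
proof -
  interpret A: module K A by fact
  note AA = A.abelian_group_axioms
  note m = cyc_functional_multibalanced[OF F]
  let ?h = "pres_lift A (\<lambda>(cs, x). F cs x)"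
  note h = mt_lift_additive[OF AA m]
  have "?h (k \<odot>\<^bsub>MT n\<^esub> y) = k \<odot>\<^bsub>A\<^esub> ?h y" if k: "k \<in> carrier K" and y: "y \<in> carrier (MT n)" for k y
  proof (rule mt_ext[OF AA additive_maps_comp[OF mt_smult_additive[OF k] h] _ _ y])
    have "(\<lambda>y. k \<odot>\<^bsub>A\<^esub> y) \<in> additive_maps A A"
      by (rule additive_mapsI) (use k A.smult_r_distr in auto)
    then show "(\<lambda>y. k \<odot>\<^bsub>A\<^esub> ?h y) \<in> additive_maps (MT n) A"
      by (rule additive_maps_comp[OF h])
    show "?h (k \<odot>\<^bsub>MT n\<^esub> mono n cs x) = k \<odot>\<^bsub>A\<^esub> ?h (mono n cs x)"
      if "cs \<in> tuples (Suc n)" "x \<in> carrier X" for cs x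
      using that k by (simp add: mt_smult_mono mt_lift_mono[OF AA m] cyc_functional_smult[OF F])
  qed
  then show ?thesis
    using h by (auto simp: linear_maps_def additive_maps_def)
qed

lemma mt_lift_commute:
  assumes A: "module K A" and F: "cyc_functional n A F" and r: "r \<in> carrier R" and y: "y \<in> carrier (MT n)"
  shows "pres_lift A (\<lambda>(cs, x). F cs x) (lact (MT n) r y) = pres_lift A (\<lambda>(cs, x). F cs x) (ract (MT n) y r)"
proof -
  interpret A: module K A by fact
  note AA = A.abelian_group_axioms and m = cyc_functional_multibalanced[OF F]
  note h = mt_lift_additive[OF AA m]
  show ?thesis
  proof (rule mt_ext[OF AA additive_maps_comp[OF mt_lact_additive[OF r] h] additive_maps_comp[OF mt_ract_additive[OF r] h] _ y])
    fix cs x assume "cs \<in> tuples (Suc n)" and x: "x \<in> carrier X"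
    then obtain c ds where cs: "cs = c # ds" "c \<in> carrier C" "ds \<in> tuples n" by (elim tuples_SucE)
    then show "pres_lift A (\<lambda>(cs, x). F cs x) (lact (MT n) r (mono n cs x))
        = pres_lift A (\<lambda>(cs, x). F cs x) (ract (MT n) (mono n cs x) r)"
      using x r by (simp add: mt_lact_mono mt_ract_mono mt_lift_mono[OF AA m] C.lact_closed X.ract_closed
          cyc_functional_lact[OF F])
  qed
qed

text \<open>\<open>cyc_lift\<close> makes two nested choices: a member of the commutator coset and
  then a formal combination representing it. \<open>lift_some_rep\<close> disposes of the outer
  one.\<close>

lemma cyc_lift_proj:
  assumes "module K A" "cyc_functional n A F" "y \<in> carrier (MT n)"
  shows "cyc_lift A (\<lambda>(cs, x). F cs x) (cq.proj n y) = pres_lift A (\<lambda>(cs, x). F cs x) y"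
  unfolding cyc_lift_def
  by (rule cq.lift_some_rep[OF assms(1) mt_lift_linear[OF assms(1,2)] mt_lift_commute[OF assms(1,2)] assms(3)])

lemma cyc_lift_ct:
  assumes "module K A" "cyc_functional n A F" "cs \<in> tuples (Suc n)" "x \<in> carrier X"
  shows "cyc_lift A (\<lambda>(cs, x). F cs x) (ct n cs x) = F cs x"
proof -
  interpret A: module K A by fact
  show ?thesis
    using assms(3,4)
    by (simp add: ct_eq cyc_lift_proj[OF assms(1,2)] mono_closed
        mt_lift_mono[OF A.abelian_group_axioms cyc_functional_multibalanced[OF assms(2)]])
qed

lemma cyc_lift_linear:
  assumes A: "module K A" and F: "cyc_functional n A F"
  shows "cyc_lift A (\<lambda>(cs, x). F cs x) \<in> linear_maps K (Z n) A"
proof -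
  note h = mt_lift_linear[OF A F]
  show ?thesis
    using h
    by (auto simp: linear_maps_def cyc_def cq.carrier_Q cq.proj_add[symmetric] cq.proj_smult[symmetric]
        cyc_lift_proj[OF A F])
qed

end

section \<open>Faces and degeneracies\<close>

lemma linear_maps_cong:
  assumes "module K M" "h \<in> linear_maps K M N" "\<And>x. x \<in> carrier M \<Longrightarrow> h' x = h x"
  shows "h' \<in> linear_maps K M N"
proof -
  interpret module K M by fact
  show ?thesis using assms(2,3) by (auto simp: linear_maps_def)
qed

context coring_coefficients
begin

lemma next_coeff_smult:
  "\<lbrakk>r \<in> carrier R; k \<in> carrier K; x \<in> carrier X\<rbrakk>
    \<Longrightarrow> next_coeff r cs (k \<odot>\<^bsub>X\<^esub> x) = k \<odot>\<^bsub>X\<^esub> next_coeff r cs x"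
  by (cases cs) (simp_all add: X.lact_smult_right)

lemma next_coeff_ract:
  "\<lbrakk>r \<in> carrier R; x \<in> carrier X; s \<in> carrier R\<rbrakk>
    \<Longrightarrow> next_coeff r cs (ract X x s) = ract X (next_coeff r cs x) s"
  by (cases cs) (simp_all add: X.lact_ract)

lemma next_mult:
  assumes "r \<in> carrier R" "s \<in> carrier R" "cs \<in> tuples m" "x \<in> carrier X"
  shows "next_list (r \<otimes>\<^bsub>R\<^esub> s) cs = next_list r (next_list s cs)"
    and "next_coeff (r \<otimes>\<^bsub>R\<^esub> s) cs x = next_coeff r (next_list s cs) (next_coeff s cs x)"
  using assms by (cases cs; cases m; simp add: C.lact_mult X.lact_mult)+

text \<open>The scalar is absorbed by the first factor of the tail or, if there is none, by the
  coefficient; \<open>F\<close> is additive in both places.\<close>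

lemma multibalanced_next_add:
  assumes "multibalanced m A F" "r \<in> carrier R" "s \<in> carrier R" "cs \<in> tuples m" "x \<in> carrier X"
  shows "F (next_list (r \<oplus>\<^bsub>R\<^esub> s) cs) (next_coeff (r \<oplus>\<^bsub>R\<^esub> s) cs x)
    = F (next_list r cs) (next_coeff r cs x) \<oplus>\<^bsub>A\<^esub> F (next_list s cs) (next_coeff s cs x)"
proof (cases cs)
  case Nil
  then show ?thesis
    using assms multibalanced_coeff_add[OF assms(1,4), of "lact X r x" "lact X s x"]
    by (simp add: X.lact_add_left X.lact_closed)
next
  case (Cons c ds)
  then obtain m' where m: "m = Suc m'" using assms(4) by (cases m) auto
  show ?thesis
    using assms Cons m by (simp add: C.lact_add_left multibalanced_hd_add[of m'] C.lact_closed)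
qed

text \<open>The left action of \<open>r\<close> on the first factor commutes with the right action
  that appears in the balancing condition.\<close>

lemma multibalanced_next:
  assumes "multibalanced m A F" "r \<in> carrier R"
  shows "multibalanced m A (\<lambda>cs x. F (next_list r cs) (next_coeff r cs x))"
proof (cases m)
  case 0
  then have F: "F [] \<in> additive_maps X A" using assms(1) by (simp add: multibalanced_0)
  show ?thesis
    unfolding 0 multibalanced_0 next_simps
    by (rule additive_maps_comp[OF _ F]) (rule additive_mapsI, use assms(2) X.lact_add_right X.lact_closed in auto)
next
  case (Suc m')
  note F = assms(1)[unfolded Suc]
  show ?thesis
    unfolding Suc
    by (rule multibalanced_SucI)
       (use assms(2) in \<open>simp_all add: multibalanced_Cons[OF F] C.lact_closed C.lact_add_right
         multibalanced_hd_add[OF F] C.lact_ract[symmetric] multibalanced_hd_ract[OF F]\<close>)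
qed

text \<open>Unlike \<open>cyc_face\<close>, this has no separate case for the last factor: absorbing
  the counit is the left action on the tail, so a recursion along the list treats every face
  alike.\<close>

definition face_list :: "nat \<Rightarrow> 'c list \<Rightarrow> 'c list" where
  "face_list k cs = take k cs @ next_list (\<epsilon> (cs ! k)) (drop (Suc k) cs)"

definition face_coeff :: "nat \<Rightarrow> 'c list \<Rightarrow> 'x \<Rightarrow> 'x" where
  "face_coeff k cs x = next_coeff (\<epsilon> (cs ! k)) (drop (Suc k) cs) x"

lemma face_simps [simp]:
  "face_list 0 (c # cs) = next_list (\<epsilon> c) cs"
  "face_list (Suc k) (c # cs) = c # face_list k cs"
  "face_coeff 0 (c # cs) x = next_coeff (\<epsilon> c) cs x"
  "face_coeff (Suc k) (c # cs) x = face_coeff k cs x"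
  by (simp_all add: face_list_def face_coeff_def)

lemma nth_tuples: "cs \<in> tuples m \<Longrightarrow> k < m \<Longrightarrow> cs ! k \<in> carrier C"
  by (auto simp: tuples_def)

lemma take_drop_tuples:
  assumes "cs \<in> tuples m"
  shows "k \<le> m \<Longrightarrow> take k cs \<in> tuples k" "drop k cs \<in> tuples (m - k)"
  using assms by (auto simp: tuples_def dest: in_set_takeD in_set_dropD)

lemma face_list_tuples: "cs \<in> tuples (Suc m) \<Longrightarrow> k \<le> m \<Longrightarrow> face_list k cs \<in> tuples m"
proof (induction k arbitrary: cs m)
  case 0
  then show ?case by (elim tuples_SucE) (simp add: next_list_tuples C.counit_closed)
next
  case (Suc k)
  then obtain m' where "m = Suc m'" by (cases m) auto
  then show ?case using Suc by (elim tuples_SucE) simp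
qed

lemma face_coeff_closed: "cs \<in> tuples (Suc m) \<Longrightarrow> k \<le> m \<Longrightarrow> x \<in> carrier X \<Longrightarrow> face_coeff k cs x \<in> carrier X"
  unfolding face_coeff_def by (rule next_coeff_closed[OF C.counit_closed[OF nth_tuples]]) auto

text \<open>Faces are left linear: at the head this is left linearity of the counit, and at later
  positions the scalar stays on the head.\<close>

lemma face_next:
  assumes "cs \<in> tuples (Suc m)" "k \<le> m" "r \<in> carrier R" "x \<in> carrier X"
  shows "face_list k (next_list r cs) = next_list r (face_list k cs)"
    and "face_coeff k (next_list r cs) (next_coeff r cs x) = next_coeff r (face_list k cs) (face_coeff k cs x)"
  using assms
  by (elim tuples_SucE; cases k; simp add: C.counit_lact C.counit_closed next_mult)+

text \<open>Induction on the position. At the head, right linearity of the counit sends a scalar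
  into the tail; further in, a scalar arriving at the tail passes through the face by
  \<open>face_next\<close>.\<close>

lemma face_multibalanced:
  assumes "multibalanced m A F" "k \<le> m"
  shows "multibalanced (Suc m) A (\<lambda>cs x. F (face_list k cs) (face_coeff k cs x))"
  using assms
proof (induction k arbitrary: m F)
  case 0
  show ?case
    by (rule multibalanced_SucI)
       (simp_all add: multibalanced_next[OF 0(1)] multibalanced_next_add[OF 0(1)] C.counit_closed
         C.counit_add C.counit_ract next_mult)
next
  case (Suc k)
  then obtain m' where m: "m = Suc m'" by (cases m) auto
  note F = Suc.prems(1)[unfolded m]
  have k: "k \<le> m'" using Suc.prems m by simp
  show ?case
    unfolding m
    by (rule multibalanced_SucI)
       (use k in \<open>simp_all add: Suc.IH[OF multibalanced_Cons[OF F]] multibalanced_hd_add[OF F]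
         multibalanced_hd_ract[OF F] face_list_tuples face_coeff_closed face_next\<close>)
qed

lemma face_functional:
  assumes F: "cyc_functional n A F" and k: "k \<le> Suc n"
  shows "cyc_functional (Suc n) A (\<lambda>cs x. F (face_list k cs) (face_coeff k cs x))"
proof (rule cyc_functionalI)
  show "multibalanced (Suc (Suc n)) A (\<lambda>cs x. F (face_list k cs) (face_coeff k cs x))"
    by (rule face_multibalanced[OF cyc_functional_multibalanced[OF F] k])
  show "F (face_list k cs) (face_coeff k cs (l \<odot>\<^bsub>X\<^esub> x)) = l \<odot>\<^bsub>A\<^esub> F (face_list k cs) (face_coeff k cs x)"
    if "cs \<in> tuples (Suc (Suc n))" "l \<in> carrier K" "x \<in> carrier X" for cs l x
  proof -
    have "face_coeff k cs (l \<odot>\<^bsub>X\<^esub> x) = l \<odot>\<^bsub>X\<^esub> face_coeff k cs x"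
      unfolding face_coeff_def by (rule next_coeff_smult[OF C.counit_closed[OF nth_tuples]]) (use that k in auto)
    then show ?thesis
      using that k by (simp add: cyc_functional_smult[OF F] face_list_tuples face_coeff_closed)
  qed
  show "F (face_list k (lact C r c # cs)) (face_coeff k (lact C r c # cs) x)
      = F (face_list k (c # cs)) (face_coeff k (c # cs) (ract X x r))"
    if "c \<in> carrier C" "cs \<in> tuples (Suc n)" "r \<in> carrier R" "x \<in> carrier X" for c cs r x
  proof (cases k)
    case 0
    \<comment> \<open>The head carrying \<open>r\<close> is erased, but \<open>r\<close> survives in
      its counit and lands on \<open>b\<close>, the new head; there the cyclic relation of
      \<open>F\<close> applies.\<close>
    from that(2) obtain b ds where cs: "cs = b # ds" "b \<in> carrier C" "ds \<in> tuples n" by (rule tuples_SucE)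
    show ?thesis
      using that 0 cs by (simp add: C.counit_lact C.lact_mult C.counit_closed C.lact_closed cyc_functional_lact[OF F])
  next
    case (Suc k')
    have "face_coeff k' cs (ract X x r) = ract X (face_coeff k' cs x) r"
      unfolding face_coeff_def by (rule next_coeff_ract[OF C.counit_closed[OF nth_tuples]]) (use that k Suc in auto)
    then show ?thesis
      using that Suc k by (simp add: cyc_functional_lact[OF F] face_list_tuples face_coeff_closed)
  qed
qed

text \<open>For \<open>i = 0\<close> this is left linearity of the other face; otherwise both faces
  leave the head alone and the induction proceeds in the tail.\<close>

lemma face_face:
  assumes "i < j" "j \<le> Suc m" "cs \<in> tuples (Suc (Suc m))" "x \<in> carrier X"
  shows "face_list i (face_list j cs) = face_list (j - 1) (face_list i cs) \<and>
    face_coeff i (face_list j cs) (face_coeff j cs x) = face_coeff (j - 1) (face_list i cs) (face_coeff i cs x)"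
  using assms
proof (induction i arbitrary: j m cs)
  case 0
  then obtain j' where j: "j = Suc j'" by (cases j) auto
  from 0(3) obtain c ds where cs: "cs = c # ds" "c \<in> carrier C" "ds \<in> tuples (Suc m)" by (rule tuples_SucE)
  show ?case using 0 j cs by (simp add: face_next C.counit_closed)
next
  case (Suc i)
  then obtain j' m' where j: "j = Suc j'" "m = Suc m'" by (cases j; cases m) auto
  obtain c ds where cs: "cs = c # ds" "c \<in> carrier C" "ds \<in> tuples (Suc m)"
    using Suc.prems(3) by (rule tuples_SucE)
  obtain j'' where "j' = Suc j''" using Suc.prems j by (cases j') auto
  then show ?case using Suc.IH[of j' m' ds] Suc.prems j cs by simp
qed

text \<open>A degeneracy sends a monomial to a sum, so it is recorded by its effect on functions of
  monomials. The order is reversed: applying \<open>s\<close> at \<open>j\<close> and then at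
  \<open>i\<close> corresponds to \<open>degen A j (degen A i F)\<close>.\<close>

definition degen :: "('p, 'q) ring_scheme \<Rightarrow> nat \<Rightarrow> ('c list \<Rightarrow> 'x \<Rightarrow> 'p) \<Rightarrow> 'c list \<Rightarrow> 'x \<Rightarrow> 'p" where
  "degen A k F cs x = bilift A (\<lambda>a b. F (take k cs @ a # b # drop (Suc k) cs) x) (\<Delta> (cs ! k))"

lemma degen_simps:
  "degen A 0 F (c # cs) x = bilift A (\<lambda>a b. F (a # b # cs) x) (\<Delta> c)"
  "degen A (Suc k) F (c # cs) x = degen A k (\<lambda>cs. F (c # cs)) cs x"
  by (simp_all add: degen_def)

lemma insert_tuples:
  assumes "cs \<in> tuples m" "k < m" "a \<in> carrier C" "b \<in> carrier C"
  shows "take k cs @ a # b # drop (Suc k) cs \<in> tuples (Suc m)"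
proof (rule append_tuples[OF take_drop_tuples(1)[OF assms(1)]])
  show "a # b # drop (Suc k) cs \<in> tuples (Suc (Suc (m - Suc k)))"
    using assms take_drop_tuples(2)[OF assms(1)] by simp
qed (use assms in auto)

lemma comult_nth_closed: "cs \<in> tuples m \<Longrightarrow> k < m \<Longrightarrow> \<Delta> (cs ! k) \<in> carrier C.CC.T"
  by (rule C.comult_closed[OF nth_tuples])

lemma degen_cong:
  assumes "abelian_group A" "cs \<in> tuples m" "k < m" "x \<in> carrier X"
    "\<And>cs. cs \<in> tuples (Suc m) \<Longrightarrow> F cs x = G cs x" "\<And>cs. cs \<in> tuples (Suc m) \<Longrightarrow> G cs x \<in> carrier A"
  shows "degen A k F cs x = degen A k G cs x"
  unfolding degen_def
  by (rule C.CC.bilift_cong[OF assms(1) comult_nth_closed[OF assms(2,3)]])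
     (use assms insert_tuples in auto)

lemma hom_degen:
  assumes "abelian_group A" "abelian_group A'" "h \<in> additive_maps A A'" "cs \<in> tuples m" "k < m" "x \<in> carrier X"
    "\<And>cs. cs \<in> tuples (Suc m) \<Longrightarrow> F cs x \<in> carrier A"
  shows "h (degen A k F cs x) = degen A' k (\<lambda>cs x. h (F cs x)) cs x"
  unfolding degen_def
  by (rule C.CC.hom_bilift[OF assms(1-3) comult_nth_closed[OF assms(4,5)]])
     (use assms insert_tuples in auto)

text \<open>A lift is a sum over a fixed representative of \<open>S\<close>, and each clause of
  \<open>multibalanced\<close> passes to sums, however \<open>G\<close> depends on \<open>a\<close>
  and \<open>b\<close>.\<close>

lemma multibalanced_bilift:
  assumes A: "abelian_group A" and S: "S \<in> carrier C.CC.T"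
    and G: "\<And>a b. \<lbrakk>a \<in> carrier C; b \<in> carrier C\<rbrakk> \<Longrightarrow> multibalanced m A (G a b)"
  shows "multibalanced m A (\<lambda>cs x. bilift A (\<lambda>a b. G a b cs x) S)"
  unfolding multibalanced_def
proof (intro conjI ballI allI impI additive_mapsI)
  note cong = C.CC.bilift_cong[OF A S] and add = C.CC.bilift_fun_add[OF A S]
  show "bilift A (\<lambda>a b. G a b cs x) S \<in> carrier A" if "cs \<in> tuples m" "x \<in> carrier X" for cs x
    by (rule C.CC.bilift_closed[OF A S]) (rule multibalanced_closed[OF G that])
  show "bilift A (\<lambda>a b. G a b cs (x \<oplus>\<^bsub>X\<^esub> y)) S
      = bilift A (\<lambda>a b. G a b cs x) S \<oplus>\<^bsub>A\<^esub> bilift A (\<lambda>a b. G a b cs y) S"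
    if "cs \<in> tuples m" "x \<in> carrier X" "y \<in> carrier X" for cs x y
    by (rule add) (simp_all add: that multibalanced_coeff_add[OF G] multibalanced_closed[OF G])
  fix i j us vs c assume *: "Suc (i + j) = m" "us \<in> tuples i" "vs \<in> tuples j" "c \<in> carrier C"
  have tup: "us @ d # ws \<in> tuples m" if "d \<in> carrier C" "ws \<in> tuples j" for d ws
    by (rule append_tuples[OF *(2), of "d # ws" "Suc j"]) (use that * in auto)
  show "bilift A (\<lambda>a b. G a b (us @ (c \<oplus>\<^bsub>C\<^esub> d) # vs) x) S
      = bilift A (\<lambda>a b. G a b (us @ c # vs) x) S \<oplus>\<^bsub>A\<^esub> bilift A (\<lambda>a b. G a b (us @ d # vs) x) S"
    if "d \<in> carrier C" "x \<in> carrier X" for d x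
    by (rule add) (simp_all add: that multibalanced_add[OF G *(2,3,1)] * tup multibalanced_closed[OF G])
  show "bilift A (\<lambda>a b. G a b (us @ ract C c r # vs) x) S
      = bilift A (\<lambda>a b. G a b (us @ c # next_list r vs) (next_coeff r vs x)) S"
    if "r \<in> carrier R" "x \<in> carrier X" for r x
    by (rule cong)
       (simp_all add: that multibalanced_ract[OF G *(2,3,1)] * tup multibalanced_closed[OF G]
         next_list_tuples next_coeff_closed)
qed

lemma multibalanced_pair:
  assumes F: "multibalanced (Suc (Suc m)) A F" and cs: "cs \<in> tuples m" and x: "x \<in> carrier X"
  shows "balanced R C C A (\<lambda>a b. F (a # b # cs) x)"
  by (rule balancedI)
     (use cs x in \<open>simp_all add: multibalanced_closed[OF F] multibalanced_hd_add[OF F]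
       multibalanced_hd_add[OF multibalanced_Cons[OF F]] multibalanced_hd_ract[OF F]\<close>)

text \<open>Left linearity of the degeneracy: for the head it is left linearity of
  \<open>\<Delta>\<close>, and later positions do not meet the scalar.\<close>

lemma degen_next:
  assumes A: "abelian_group A" and F: "multibalanced (Suc m) A F" and cs: "cs \<in> tuples m" and k: "k < m"
    and r: "r \<in> carrier R" and x: "x \<in> carrier X"
  shows "degen A k F (next_list r cs) (next_coeff r cs x)
    = degen A k (\<lambda>ds x. F (next_list r ds) (next_coeff r ds x)) cs x"
proof -
  obtain m' where m: "m = Suc m'" using k by (cases m) auto
  from cs obtain c ds where cs: "cs = c # ds" "c \<in> carrier C" "ds \<in> tuples m'" unfolding m by (rule tuples_SucE)
  show ?thesis
  proof (cases k)
    case 0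
    then show ?thesis
      using C.bilift_comult_lact[OF A multibalanced_pair[OF F[unfolded m] cs(3) x] cs(2) r] cs
      by (simp add: degen_simps)
  next
    case (Suc k')
    then show ?thesis using cs by (simp add: degen_simps)
  qed
qed

text \<open>At the head, additivity and right linearity of \<open>\<Delta>\<close> give the two
  conditions, the scalar leaving through the second leg. At later positions a scalar from the head
  enters the tail by \<open>degen_next\<close>.\<close>

lemma degen_multibalanced:
  assumes A: "abelian_group A" and "multibalanced (Suc m) A F" "k < m"
  shows "multibalanced m A (degen A k F)"
  using assms(2,3)
proof (induction k arbitrary: m F)
  case 0
  then obtain m' where m: "m = Suc m'" by (cases m) auto
  note F = 0(1)[unfolded m]
  show ?case
    unfolding m
  proof (rule multibalanced_SucI)
    show "multibalanced m' A (\<lambda>cs. degen A 0 F (c # cs))" if "c \<in> carrier C" for c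
      unfolding degen_simps
      by (rule multibalanced_bilift[OF A C.comult_closed[OF that]])
         (rule multibalanced_Cons[OF multibalanced_Cons[OF F]])
    show "degen A 0 F ((a \<oplus>\<^bsub>C\<^esub> b) # cs) x = degen A 0 F (a # cs) x \<oplus>\<^bsub>A\<^esub> degen A 0 F (b # cs) x"
      if "a \<in> carrier C" "b \<in> carrier C" "cs \<in> tuples m'" "x \<in> carrier X" for a b cs x
      unfolding degen_simps by (rule C.bilift_comult_add[OF A multibalanced_pair[OF F that(3,4)] that(1,2)])
    show "degen A 0 F (ract C a r # cs) x = degen A 0 F (a # next_list r cs) (next_coeff r cs x)"
      if "a \<in> carrier C" "r \<in> carrier R" "cs \<in> tuples m'" "x \<in> carrier X" for a r cs x
      unfolding degen_simps C.bilift_comult_ract[OF A multibalanced_pair[OF F that(3,4)] that(1,2)]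
      by (rule C.CC.bilift_cong[OF A C.comult_closed[OF that(1)]])
         (use that in \<open>simp_all add: multibalanced_hd_ract[OF multibalanced_Cons[OF F]]
           multibalanced_closed[OF F] next_list_tuples next_coeff_closed\<close>)
  qed
next
  case (Suc k)
  then obtain m' where m: "m = Suc m'" by (cases m) auto
  note F = Suc.prems(1)[unfolded m] and k = Suc.prems(2)[unfolded m]
  then have k: "k < m'" by simp
  have tup: "take k cs @ a # b # drop (Suc k) cs \<in> tuples (Suc m')"
    if "cs \<in> tuples m'" "a \<in> carrier C" "b \<in> carrier C" for cs a b
    by (rule insert_tuples[OF that(1) k that(2,3)])
  show ?case
    unfolding m
  proof (rule multibalanced_SucI)
    show "multibalanced m' A (\<lambda>cs. degen A (Suc k) F (c # cs))" if "c \<in> carrier C" for c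
      using Suc.IH[OF multibalanced_Cons[OF F that] k] by (simp add: degen_simps(2)[abs_def])
    show "degen A (Suc k) F ((a \<oplus>\<^bsub>C\<^esub> b) # cs) x = degen A (Suc k) F (a # cs) x \<oplus>\<^bsub>A\<^esub> degen A (Suc k) F (b # cs) x"
      if "a \<in> carrier C" "b \<in> carrier C" "cs \<in> tuples m'" "x \<in> carrier X" for a b cs x
      unfolding degen_simps unfolding degen_def
      by (rule C.CC.bilift_fun_add[OF A comult_nth_closed[OF that(3) k]])
         (use that tup in \<open>simp_all add: multibalanced_hd_add[OF F] multibalanced_closed[OF F]\<close>)
    show "degen A (Suc k) F (ract C a r # cs) x = degen A (Suc k) F (a # next_list r cs) (next_coeff r cs x)"
      if "a \<in> carrier C" "r \<in> carrier R" "cs \<in> tuples m'" "x \<in> carrier X" for a r cs x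
      unfolding degen_simps degen_next[OF A multibalanced_Cons[OF F that(1)] that(3) k that(2,4)]
      by (rule degen_cong[OF A that(3) k that(4)])
         (use that in \<open>simp_all add: multibalanced_hd_ract[OF F] multibalanced_closed[OF F]
           next_list_tuples next_coeff_closed\<close>)
  qed
qed

lemma degen_functional:
  assumes A: "module K A" and F: "cyc_functional (Suc n) A F" and k: "k \<le> n"
  shows "cyc_functional n A (degen A k F)"
proof (rule cyc_functionalI)
  interpret A: module K A by fact
  note AA = A.abelian_group_axioms
  note m = cyc_functional_multibalanced[OF F]
  have k': "k < Suc n" using k by simp
  show "multibalanced (Suc n) A (degen A k F)"
    by (rule degen_multibalanced[OF AA m k'])
  show "degen A k F cs (l \<odot>\<^bsub>X\<^esub> x) = l \<odot>\<^bsub>A\<^esub> degen A k F cs x"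
    if "cs \<in> tuples (Suc n)" "l \<in> carrier K" "x \<in> carrier X" for cs l x
  proof -
    have sm: "(\<lambda>y. l \<odot>\<^bsub>A\<^esub> y) \<in> additive_maps A A"
      by (rule additive_mapsI) (use that A.smult_r_distr in auto)
    have "l \<odot>\<^bsub>A\<^esub> degen A k F cs x = degen A k (\<lambda>cs x. l \<odot>\<^bsub>A\<^esub> F cs x) cs x"
      by (rule hom_degen[OF AA AA sm that(1) k' that(3)]) (rule multibalanced_closed[OF m _ that(3)])
    also have "\<dots> = degen A k (\<lambda>cs x. F cs (l \<odot>\<^bsub>X\<^esub> x)) cs x"
      by (rule degen_cong[OF AA that(1) k' that(3)])
         (use that in \<open>simp_all add: cyc_functional_smult[OF F] multibalanced_closed[OF m]\<close>)
    finally show ?thesis by (simp add: degen_def)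
  qed
  show "degen A k F (lact C r c # cs) x = degen A k F (c # cs) (ract X x r)"
    if "c \<in> carrier C" "cs \<in> tuples n" "r \<in> carrier R" "x \<in> carrier X" for c cs r x
  proof (cases k)
    case 0
    show ?thesis
      unfolding 0 degen_simps C.bilift_comult_lact[OF AA multibalanced_pair[OF m that(2,4)] that(1,3)]
      by (rule C.CC.bilift_cong[OF AA C.comult_closed[OF that(1)]])
         (use that in \<open>simp_all add: cyc_functional_lact[OF F] multibalanced_closed[OF m] X.ract_closed\<close>)
  next
    case (Suc k')
    have k'': "k' < n" using k Suc by simp
    have "degen A k' (\<lambda>cs. F (lact C r c # cs)) cs x = degen A k' (\<lambda>cs x. F (c # cs) (ract X x r)) cs x"
      by (rule degen_cong[OF AA that(2) k'' that(4)])
         (use that in \<open>simp_all add: cyc_functional_lact[OF F] multibalanced_closed[OF m] X.ract_closed\<close>)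
    then show ?thesis by (simp add: Suc degen_def)
  qed
qed

text \<open>At the head, equal positions give coassociativity, and distinct positions give two
  independent lifts, which commute as finite sums.\<close>

lemma degen_degen:
  assumes A: "abelian_group A" and "multibalanced (Suc (Suc m)) A F" "i \<le> j" "j < m" "cs \<in> tuples m" "x \<in> carrier X"
  shows "degen A j (degen A i F) cs x = degen A i (degen A (Suc j) F) cs x"
  using assms(2-6)
proof (induction i arbitrary: j m F cs)
  case 0
  then obtain m' where m: "m = Suc m'" by (cases m) auto
  note F = 0(1)[unfolded m]
  obtain c ds where cs: "cs = c # ds" "c \<in> carrier C" "ds \<in> tuples m'"
    using 0(4) unfolding m by (rule tuples_SucE)
  note x = 0(5)
  show ?case
  proof (cases j)
    case 0
    have "tribalanced R C C C A (\<lambda>a b c. F (a # b # c # ds) x)"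
    proof (rule tribalancedI)
      show "balanced R C C A (\<lambda>b c. F (a # b # c # ds) x)" if "a \<in> carrier C" for a
        by (rule multibalanced_pair[OF multibalanced_Cons[OF F that] cs(3) x])
      show "balanced R C C A (\<lambda>a b. F (a # b # c # ds) x)" if "c \<in> carrier C" for c
        by (rule multibalanced_pair[OF F _ x]) (use that cs in simp)
    qed
    from C.coassoc_sweedler[OF A this cs(2)] show ?thesis by (simp add: 0 cs degen_simps)
  next
    case (Suc j')
    then have j': "j' < m'" using \<open>j < m\<close> m by simp
    have "degen A j (degen A 0 F) cs x = bilift A (\<lambda>a b. bilift A (\<lambda>p q. F (p # q # take j' ds @ a # b # drop (Suc j') ds) x) (\<Delta> c)) (\<Delta> (ds ! j'))"
      by (simp add: cs Suc degen_def)
    also have "\<dots> = bilift A (\<lambda>p q. bilift A (\<lambda>a b. F (p # q # take j' ds @ a # b # drop (Suc j') ds) x) (\<Delta> (ds ! j'))) (\<Delta> c)"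
      by (rule bilift_swap[OF C.CC.tensor_product_axioms C.CC.tensor_product_axioms A
            comult_nth_closed[OF cs(3) j'] C.comult_closed[OF cs(2)]])
         (use x insert_tuples[OF cs(3) j'] in \<open>simp add: multibalanced_closed[OF F]\<close>)
    also have "\<dots> = degen A 0 (degen A (Suc j) F) cs x"
      by (simp add: cs Suc degen_def)
    finally show ?thesis .
  qed
next
  case (Suc i)
  then obtain j' m' where j: "j = Suc j'" "m = Suc m'" by (cases j; cases m) auto
  note F = Suc.prems(1)[unfolded j]
  obtain c ds where cs: "cs = c # ds" "c \<in> carrier C" "ds \<in> tuples m'"
    using Suc.prems(4) unfolding j by (rule tuples_SucE)
  have "degen A j' (degen A i (\<lambda>cs. F (c # cs))) ds x = degen A i (degen A (Suc j') (\<lambda>cs. F (c # cs))) ds x"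
    by (rule Suc.IH[OF multibalanced_Cons[OF F cs(2)]]) (use Suc.prems j cs in auto)
  then show ?case by (simp add: j cs degen_def)
qed

text \<open>For \<open>i = 0\<close> the counit of the erased head acts on the tail from the left,
  and \<open>degen_next\<close> moves it past the degeneracy.\<close>

lemma degen_face_less:
  assumes A: "abelian_group A" and "multibalanced (Suc m) A F" "i < j" "j \<le> m" "cs \<in> tuples (Suc m)" "x \<in> carrier X"
  shows "degen A j (\<lambda>cs x. F (face_list i cs) (face_coeff i cs x)) cs x
    = degen A (j - 1) F (face_list i cs) (face_coeff i cs x)"
  using assms(2-6)
proof (induction i arbitrary: j m F cs)
  case 0
  then obtain j' where j: "j = Suc j'" by (cases j) auto
  obtain c ds where cs: "cs = c # ds" "c \<in> carrier C" "ds \<in> tuples m"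
    using 0(4) by (rule tuples_SucE)
  show ?case
    using degen_next[OF A 0(1) cs(3) _ C.counit_closed[OF cs(2)] 0(5), of j'] 0 j cs
    by (simp add: degen_simps)
next
  case (Suc i)
  then obtain j' m' where j: "j = Suc j'" "m = Suc m'" by (cases j; cases m) auto
  note F = Suc.prems(1)[unfolded j]
  obtain c ds where cs: "cs = c # ds" "c \<in> carrier C" "ds \<in> tuples m"
    using Suc.prems(4) by (rule tuples_SucE)
  obtain j'' where j'': "j' = Suc j''" using Suc.prems j by (cases j') auto
  have "degen A j' (\<lambda>cs x. F (c # face_list i cs) (face_coeff i cs x)) ds x
      = degen A (j' - 1) (\<lambda>cs. F (c # cs)) (face_list i ds) (face_coeff i ds x)"
    by (rule Suc.IH[OF multibalanced_Cons[OF F cs(2)]]) (use Suc.prems j cs in auto)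
  then show ?case by (simp add: j j'' cs degen_simps)
qed

text \<open>The two cases are the two counit laws, applied under the additive map that places an
  element at position \<open>j\<close>.\<close>

lemma degen_face_id:
  assumes A: "abelian_group A" and "multibalanced m A F" "i = j \<or> i = Suc j" "j < m" "cs \<in> tuples m" "x \<in> carrier X"
  shows "degen A j (\<lambda>cs x. F (face_list i cs) (face_coeff i cs x)) cs x = F cs x"
  using assms(2-6)
proof (induction j arbitrary: i m F cs)
  case 0
  then obtain m' where m: "m = Suc m'" by (cases m) auto
  note F = 0(1)[unfolded m]
  obtain c ds where cs: "cs = c # ds" "c \<in> carrier C" "ds \<in> tuples m'"
    using 0(4) unfolding m by (rule tuples_SucE)
  note x = 0(5)
  have h: "(\<lambda>b. F (b # ds) x) \<in> additive_maps C A"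
    by (rule additive_mapsI) (use cs x in \<open>simp_all add: multibalanced_closed[OF F] multibalanced_hd_add[OF F]\<close>)
  note hb = C.CC.hom_bilift[OF C.abelian_group_axioms A h C.comult_closed[OF cs(2)], symmetric]
  show ?case
  proof (cases "i = 0")
    case True
    then show ?thesis
      using hb[of "\<lambda>a b. lact C (\<epsilon> a) b"] cs by (simp add: degen_simps C.lact_closed C.counit_closed C.counit_left)
  next
    case False
    then have i: "i = Suc 0" using 0(2) by simp
    \<comment> \<open>Erasing the second leg sends its counit to the right; balancing of
      \<open>F\<close> returns it to the first leg as a right action, as the right counit law
      requires.\<close>
    have "bilift A (\<lambda>a b. F (a # next_list (\<epsilon> b) ds) (next_coeff (\<epsilon> b) ds x)) (\<Delta> c)
        = bilift A (\<lambda>a b. F (ract C a (\<epsilon> b) # ds) x) (\<Delta> c)"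
      by (rule C.CC.bilift_cong[OF A C.comult_closed[OF cs(2)]])
         (use cs x in \<open>simp_all add: multibalanced_hd_ract[OF F] C.counit_closed multibalanced_closed[OF F]
           C.ract_closed next_list_tuples next_coeff_closed\<close>)
    then show ?thesis
      using hb[of "\<lambda>a b. ract C a (\<epsilon> b)"] cs i
      by (simp add: degen_simps C.ract_closed C.counit_closed C.counit_right)
  qed
next
  case (Suc j)
  then obtain i' m' where i: "i = Suc i'" "m = Suc m'" by (cases i; cases m) auto
  note F = Suc.prems(1)[unfolded i]
  obtain c ds where cs: "cs = c # ds" "c \<in> carrier C" "ds \<in> tuples m'"
    using Suc.prems(4) unfolding i by (rule tuples_SucE)
  have "degen A j (\<lambda>cs x. F (c # face_list i' cs) (face_coeff i' cs x)) ds x = F (c # ds) x"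
    by (rule Suc.IH[OF multibalanced_Cons[OF F cs(2)]]) (use Suc.prems i cs in auto)
  then show ?case by (simp add: i cs degen_simps)
qed

text \<open>The inserted legs lie strictly to the left of the erased factor, and its counit is
  absorbed further right, so both sides unfold to the same sum.\<close>

lemma degen_face_greater:
  assumes "Suc j < i" "j < m" "cs \<in> tuples m"
  shows "degen A j (\<lambda>cs x. F (face_list i cs) (face_coeff i cs x)) cs x
    = degen A j F (face_list (i - 1) cs) (face_coeff (i - 1) cs x)"
  using assms
proof (induction j arbitrary: i m F cs)
  case 0
  then obtain m' i' where m: "m = Suc m'" and i: "i = Suc (Suc i')" by (cases m; cases i; cases "i - 1") auto
  obtain c ds where cs: "cs = c # ds" "c \<in> carrier C" "ds \<in> tuples m'"
    using 0(3) unfolding m by (rule tuples_SucE)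
  show ?case by (simp add: cs i degen_simps)
next
  case (Suc j)
  then obtain i' m' where i: "i = Suc (Suc i')" "m = Suc m'" by (cases i; cases m; cases "i - 1") auto
  obtain c ds where cs: "cs = c # ds" "c \<in> carrier C" "ds \<in> tuples m'"
    using Suc.prems(3) unfolding i by (rule tuples_SucE)
  have "degen A j (\<lambda>cs x. F (c # face_list (Suc i') cs) (face_coeff (Suc i') cs x)) ds x
      = degen A j (\<lambda>cs. F (c # cs)) (face_list (Suc i' - 1) ds) (face_coeff (Suc i' - 1) ds x)"
    by (rule Suc.IH) (use Suc.prems i cs in auto)
  then show ?case by (simp add: i cs degen_simps)
qed

section \<open>The simplicial identities\<close>

abbreviation d where "d \<equiv> cyc_face K R C \<epsilon> X"

abbreviation s where "s \<equiv> cyc_degeneracy K R C \<Delta> X"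

text \<open>Lets \<open>cyc_face\<close> be replaced by its \<open>face_list\<close> form, with
  agreement checked only on lists of the right length; the representative chosen in
  \<open>cyc_lift\<close> involves no others.\<close>

lemma cyc_lift_cong:
  assumes "abelian_group A" "z \<in> carrier (Z n)"
    "\<And>cs x. \<lbrakk>cs \<in> tuples (Suc n); x \<in> carrier X\<rbrakk> \<Longrightarrow> F cs x = G cs x"
    "\<And>cs x. \<lbrakk>cs \<in> tuples (Suc n); x \<in> carrier X\<rbrakk> \<Longrightarrow> G cs x \<in> carrier A"
  shows "cyc_lift A (\<lambda>(cs, x). F cs x) z = cyc_lift A (\<lambda>(cs, x). G cs x) z"
proof -
  from assms(2) obtain y where y: "y \<in> carrier (MT n)" "z = cq.proj n y"
    by (auto simp: cyc_def cq.carrier_Q)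
  have "some_rep z \<in> z"
    unfolding some_rep_def y(2) using cq.self_in_proj[OF y(1)] by (rule someI)
  then have "some_rep z \<in> carrier (MT n)" using cq.proj_eqD[OF y(1)] y(2) by blast
  then show ?thesis
    unfolding cyc_lift_def by (rule mt.pres_lift_cong[OF assms(1)]) (use assms(3,4) in auto)
qed

lemma cyc_face:
  assumes k: "k \<le> Suc n"
  shows face_linear: "d (Suc n) k \<in> linear_maps K (Z (Suc n)) (Z n)"
    and face_ct: "\<lbrakk>cs \<in> tuples (Suc (Suc n)); x \<in> carrier X\<rbrakk>
      \<Longrightarrow> d (Suc n) k (ct (Suc n) cs x) = ct n (face_list k cs) (face_coeff k cs x)"
proof -
  let ?F = "\<lambda>cs x. ct n (face_list k cs) (face_coeff k cs x)"
  note F = face_functional[OF ct_functional k]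
  have ag: "abelian_group (Z n)" using cyc_module by (rule module.axioms(2))
  have eq: "d (Suc n) k z = cyc_lift (Z n) (\<lambda>(cs, x). ?F cs x) z" if "z \<in> carrier (Z (Suc n))" for z
    unfolding cyc_face_def diff_Suc_1
  proof (rule cyc_lift_cong[OF ag that])
    fix cs x assume cs: "cs \<in> tuples (Suc (Suc n))" and x: "x \<in> carrier X"
    show "?F cs x \<in> carrier (Z n)" using cs x k by (auto intro!: ct_closed face_list_tuples face_coeff_closed)
    show "(if k < Suc n
        then ct n (take k cs @ lact C (\<epsilon> (cs ! k)) (cs ! Suc k) # drop (Suc (Suc k)) cs) x
        else ct n (take k cs) (lact X (\<epsilon> (cs ! k)) x)) = ?F cs x"
    proof (cases "k < Suc n")
      case True
      then have "drop (Suc k) cs = cs ! Suc k # drop (Suc (Suc k)) cs"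
        using cs by (simp add: tuples_def Cons_nth_drop_Suc)
      then show ?thesis using True by (simp add: face_list_def face_coeff_def)
    next
      case False
      then show ?thesis using k cs by (simp add: face_list_def face_coeff_def tuples_def)
    qed
  qed
  show "d (Suc n) k \<in> linear_maps K (Z (Suc n)) (Z n)"
    by (rule linear_maps_cong[OF cyc_module cyc_lift_linear[OF cyc_module F] eq])
  show "d (Suc n) k (ct (Suc n) cs x) = ?F cs x" if "cs \<in> tuples (Suc (Suc n))" "x \<in> carrier X"
    using that by (simp add: eq ct_closed cyc_lift_ct[OF cyc_module F])
qed

lemma cyc_degeneracy:
  assumes k: "k \<le> n"
  shows degeneracy_linear: "s n k \<in> linear_maps K (Z n) (Z (Suc n))"
    and degeneracy_ct: "\<lbrakk>cs \<in> tuples (Suc n); x \<in> carrier X\<rbrakk>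
      \<Longrightarrow> s n k (ct n cs x) = degen (Z (Suc n)) k (ct (Suc n)) cs x"
proof -
  note F = degen_functional[OF cyc_module ct_functional k]
  have eq: "s n k = cyc_lift (Z (Suc n)) (\<lambda>(cs, x). degen (Z (Suc n)) k (ct (Suc n)) cs x)"
    by (simp add: cyc_degeneracy_def Let_def degen_def)
  show "s n k \<in> linear_maps K (Z n) (Z (Suc n))"
    unfolding eq by (rule cyc_lift_linear[OF cyc_module F])
  show "s n k (ct n cs x) = degen (Z (Suc n)) k (ct (Suc n)) cs x" if "cs \<in> tuples (Suc n)" "x \<in> carrier X"
    unfolding eq by (rule cyc_lift_ct[OF cyc_module F that])
qed

lemma cyc_abelian_group: "abelian_group (Z n)"
  using cyc_module by (rule module.axioms(2))

text \<open>With faces, degeneracies and double rotations for \<open>h\<close>, this reduces the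
  relations between composites to rules for \<open>degen\<close>.\<close>

lemma hom_degeneracy_ct:
  assumes "abelian_group A" "h \<in> additive_maps (Z (Suc n)) A" "k \<le> n" "cs \<in> tuples (Suc n)" "x \<in> carrier X"
    "\<And>cs. cs \<in> tuples (Suc (Suc n)) \<Longrightarrow> h (ct (Suc n) cs x) = F cs x"
  shows "h (s n k (ct n cs x)) = degen A k F cs x"
proof -
  have k: "k < Suc n" using assms(3) by simp
  have "h (s n k (ct n cs x)) = degen A k (\<lambda>cs x. h (ct (Suc n) cs x)) cs x"
    unfolding degeneracy_ct[OF assms(3-5)]
    by (rule hom_degen[OF cyc_abelian_group assms(1,2,4) k assms(5)]) (rule ct_closed[OF _ assms(5)])
  also have "\<dots> = degen A k F cs x"
    by (rule degen_cong[OF assms(1,4) k assms(5)])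
       (use assms additive_maps_closed[OF assms(2) ct_closed[OF _ assms(5)]] in auto)
  finally show ?thesis .
qed

lemma simplicial: "simplicial_module K Z d s"
proof (rule simplicial_module.intro)
  note ext = cyc_ext[OF cyc_abelian_group]
  note da = linear_maps_additive[OF face_linear] and sa = linear_maps_additive[OF degeneracy_linear]
  note comp = additive_maps_comp
  note m = cyc_functional_multibalanced[OF ct_functional]
  show "module K (Z n)" for n by (rule cyc_module)
  show "d (Suc n) k \<in> linear_maps K (Z (Suc n)) (Z n)" if "k \<le> Suc n" for n k
    by (rule face_linear[OF that])
  show "s n k \<in> linear_maps K (Z n) (Z (Suc n))" if "k \<le> n" for n k
    by (rule degeneracy_linear[OF that])
  show "d (Suc n) i (d (Suc (Suc n)) j z) = d (Suc n) (j - 1) (d (Suc (Suc n)) i z)"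
    if "i < j" "j \<le> Suc (Suc n)" "z \<in> carrier (Z (Suc (Suc n)))" for i j n z
  proof (rule ext[OF comp[OF da da] comp[OF da da] _ that(3)])
    show "d (Suc n) i (d (Suc (Suc n)) j (ct (Suc (Suc n)) cs x))
        = d (Suc n) (j - 1) (d (Suc (Suc n)) i (ct (Suc (Suc n)) cs x))"
      if "cs \<in> tuples (Suc (Suc (Suc n)))" "x \<in> carrier X" for cs x
      using that \<open>i < j\<close> \<open>j \<le> Suc (Suc n)\<close> face_face[of i j "Suc n" cs x]
      by (simp add: face_ct face_list_tuples face_coeff_closed)
  qed (use that in auto)
  show "s (Suc n) i (s n j z) = s (Suc n) (Suc j) (s n i z)"
    if "i \<le> j" "j \<le> n" "z \<in> carrier (Z n)" for i j n z
  proof (rule ext[OF comp[OF sa sa] comp[OF sa sa] _ that(3)])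
    fix cs x assume cs: "cs \<in> tuples (Suc n)" and x: "x \<in> carrier X"
    have h: "s (Suc n) l (s n k (ct n cs x)) = degen (Z (Suc (Suc n))) k (degen (Z (Suc (Suc n))) l (ct (Suc (Suc n)))) cs x"
      if "k \<le> n" "l \<le> Suc n" for k l
      by (rule hom_degeneracy_ct[OF cyc_abelian_group sa[OF that(2)] that(1) cs x])
         (rule degeneracy_ct[OF that(2) _ x])
    show "s (Suc n) i (s n j (ct n cs x)) = s (Suc n) (Suc j) (s n i (ct n cs x))"
      using degen_degen[OF cyc_abelian_group m that(1) _ cs x] that h by simp
  qed (use that in auto)
  show "d (Suc (Suc n)) i (s (Suc n) j z) = s n (j - 1) (d (Suc n) i z)"
    if "i < j" "j \<le> Suc n" "z \<in> carrier (Z (Suc n))" for i j n z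
  proof (rule ext[OF comp[OF sa da] comp[OF da sa] _ that(3)])
    fix cs x assume cs: "cs \<in> tuples (Suc (Suc n))" and x: "x \<in> carrier X"
    have i: "i \<le> Suc (Suc n)" "i \<le> Suc n" "j - 1 \<le> n" using that by auto
    have "d (Suc (Suc n)) i (s (Suc n) j (ct (Suc n) cs x))
        = degen (Z (Suc n)) j (\<lambda>cs x. ct (Suc n) (face_list i cs) (face_coeff i cs x)) cs x"
      by (rule hom_degeneracy_ct[OF cyc_abelian_group da[OF i(1)] that(2) cs x]) (rule face_ct[OF i(1) _ x])
    also have "\<dots> = degen (Z (Suc n)) (j - 1) (ct (Suc n)) (face_list i cs) (face_coeff i cs x)"
      by (rule degen_face_less[OF cyc_abelian_group m that(1,2) cs x])
    also have "\<dots> = s n (j - 1) (d (Suc n) i (ct (Suc n) cs x))"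
      using cs x i by (simp add: face_ct degeneracy_ct face_list_tuples face_coeff_closed)
    finally show "d (Suc (Suc n)) i (s (Suc n) j (ct (Suc n) cs x)) = s n (j - 1) (d (Suc n) i (ct (Suc n) cs x))" .
  qed (use that in auto)
  show "d (Suc n) i (s n j z) = z"
    if "i = j \<or> i = Suc j" "j \<le> n" "z \<in> carrier (Z n)" for i j n z
  proof (rule ext[OF comp[OF sa da] additive_maps_id _ that(3)])
    fix cs x assume cs: "cs \<in> tuples (Suc n)" and x: "x \<in> carrier X"
    have i: "i \<le> Suc n" "j < Suc n" using that by auto
    have "d (Suc n) i (s n j (ct n cs x)) = degen (Z n) j (\<lambda>cs x. ct n (face_list i cs) (face_coeff i cs x)) cs x"
      by (rule hom_degeneracy_ct[OF cyc_abelian_group da[OF i(1)] that(2) cs x]) (rule face_ct[OF i(1) _ x])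
    also have "\<dots> = ct n cs x"
      by (rule degen_face_id[OF cyc_abelian_group m that(1) i(2) cs x])
    finally show "d (Suc n) i (s n j (ct n cs x)) = ct n cs x" .
  qed (use that in auto)
  show "d (Suc (Suc n)) i (s (Suc n) j z) = s n j (d (Suc n) (i - 1) z)"
    if "Suc j < i" "i \<le> Suc (Suc n)" "z \<in> carrier (Z (Suc n))" for i j n z
  proof (rule ext[OF comp[OF sa da] comp[OF da sa] _ that(3)])
    fix cs x assume cs: "cs \<in> tuples (Suc (Suc n))" and x: "x \<in> carrier X"
    have i: "j \<le> Suc n" "i - 1 \<le> Suc n" "j \<le> n" "j < Suc (Suc n)" using that by auto
    have "d (Suc (Suc n)) i (s (Suc n) j (ct (Suc n) cs x))
        = degen (Z (Suc n)) j (\<lambda>cs x. ct (Suc n) (face_list i cs) (face_coeff i cs x)) cs x"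
      by (rule hom_degeneracy_ct[OF cyc_abelian_group da[OF that(2)] i(1) cs x]) (rule face_ct[OF that(2) _ x])
    also have "\<dots> = degen (Z (Suc n)) j (ct (Suc n)) (face_list (i - 1) cs) (face_coeff (i - 1) cs x)"
      by (rule degen_face_greater[OF that(1) i(4) cs])
    also have "\<dots> = s n j (d (Suc n) (i - 1) (ct (Suc n) cs x))"
      using cs x i by (simp add: face_ct degeneracy_ct face_list_tuples face_coeff_closed)
    finally show "d (Suc (Suc n)) i (s (Suc n) j (ct (Suc n) cs x)) = s n j (d (Suc n) (i - 1) (ct (Suc n) cs x))" .
  qed (use that in auto)
qed

end

section \<open>The para-cyclic structure\<close>

context module_coring_comodule
begin

sublocale cc: coring_coefficients K R C \<Delta>C \<epsilon>C X ..

text \<open>\<open>w_n\<close> in the same style as \<open>degen\<close>: an operation on functions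
  of monomials, since the coaction turns \<open>x\<close> into a sum.\<close>

definition rot :: "('p, 'q) ring_scheme \<Rightarrow> ('c list \<Rightarrow> 'x \<Rightarrow> 'p) \<Rightarrow> 'c list \<Rightarrow> 'x \<Rightarrow> 'p" where
  "rot A F cs x = bilift A (\<lambda>x0 x1. F (act (last cs) x1 # butlast cs) x0) (\<rho> x)"

lemma rot_snoc: "rot A F (us @ [c]) x = bilift A (\<lambda>x0 x1. F (act c x1 # us) x0) (\<rho> x)"
  by (simp add: rot_def)

lemma rot_cong:
  assumes "abelian_group A" "cs \<in> cc.tuples (Suc m)" "x \<in> carrier X"
    "\<And>ds y. \<lbrakk>ds \<in> cc.tuples (Suc m); y \<in> carrier X\<rbrakk> \<Longrightarrow> F ds y = G ds y"
    "\<And>ds y. \<lbrakk>ds \<in> cc.tuples (Suc m); y \<in> carrier X\<rbrakk> \<Longrightarrow> G ds y \<in> carrier A"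
  shows "rot A F cs x = rot A G cs x"
proof -
  obtain us c where "cs = us @ [c]" "c \<in> carrier C" "us \<in> cc.tuples m"
    using assms(2) by (rule cc.tuples_Suc_lastE)
  then show ?thesis
    using assms by (auto simp: rot_snoc act_closed intro!: X.VB.bilift_cong X.coaction_closed)
qed

lemma hom_rot:
  assumes "abelian_group A" "abelian_group A'" "h \<in> additive_maps A A'" "cs \<in> cc.tuples (Suc m)" "x \<in> carrier X"
    "\<And>ds y. \<lbrakk>ds \<in> cc.tuples (Suc m); y \<in> carrier X\<rbrakk> \<Longrightarrow> F ds y \<in> carrier A"
  shows "h (rot A F cs x) = rot A' (\<lambda>ds y. h (F ds y)) cs x"
proof -
  obtain us c where cs: "cs = us @ [c]" "c \<in> carrier C" "us \<in> cc.tuples m"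
    using assms(4) by (rule cc.tuples_Suc_lastE)
  show ?thesis
    unfolding cs(1) rot_snoc
    by (rule X.VB.hom_bilift[OF assms(1-3) X.coaction_closed[OF assms(5)]])
       (use cs assms(6) in \<open>simp add: act_closed\<close>)
qed

text \<open>Here the cyclic relation makes a rotation well defined: a left scalar on the front
  factor equals a right scalar on the coefficient, as the lift over \<open>\<rho> x\<close>
  requires.\<close>

lemma functional_balanced:
  assumes F: "cc.cyc_functional n A F" and us: "us \<in> cc.tuples n"
  shows "balanced R X C A (\<lambda>x c. F (c # us) x)"
proof -
  note m = cc.cyc_functional_multibalanced[OF F]
  show ?thesis
    by (rule balancedI)
       (use us in \<open>simp_all add: cc.multibalanced_closed[OF m] cc.multibalanced_hd_add[OF m]
         cc.multibalanced_coeff_add[OF m] cc.cyc_functional_lact[OF F]\<close>)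
qed

text \<open>Relations at the rotated factor come from \<open>twist_balanced\<close>; those at
  earlier factors persist inside the sum.\<close>

lemma rot_multibalanced:
  assumes A: "abelian_group A" and F: "cc.cyc_functional n A F"
  shows "cc.multibalanced (Suc n) A (rot A F)"
  unfolding cc.multibalanced_def
proof (intro conjI ballI allI impI)
  note m = cc.cyc_functional_multibalanced[OF F]
  note tw = twist_balanced[OF A functional_balanced[OF F]]
  note mcl = cc.multibalanced_closed[OF m]
  show "rot A F cs \<in> additive_maps X A" if "cs \<in> cc.tuples (Suc n)" for cs
  proof -
    obtain us c where cs: "cs = us @ [c]" "c \<in> carrier C" "us \<in> cc.tuples n"
      using \<open>cs \<in> cc.tuples (Suc n)\<close> by (rule cc.tuples_Suc_lastE)
    show ?thesis
      unfolding cs(1) rot_snoc[abs_def]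
      by (rule additive_mapsI) (rule balancedD[OF tw[OF cs(3)]], use cs in auto)+
  qed
  fix i j us vs a assume *: "Suc (i + j) = Suc n" "us \<in> cc.tuples i" "vs \<in> cc.tuples j" "a \<in> carrier C"
  have tup: "us @ e # ws \<in> cc.tuples n" if "e \<in> carrier C" "ws \<in> cc.tuples j'" "j = Suc j'" for e ws j'
    by (rule cc.append_tuples[OF *(2), of "e # ws" "Suc j'"]) (use that * in auto)
  have cons: "act c x1 # us \<in> cc.tuples (Suc i)" if "c \<in> carrier C" "x1 \<in> carrier B" for c x1
    using that * by (simp add: act_closed)
  show "rot A F (us @ (a \<oplus>\<^bsub>C\<^esub> b) # vs) x = rot A F (us @ a # vs) x \<oplus>\<^bsub>A\<^esub> rot A F (us @ b # vs) x"
    if "b \<in> carrier C" "x \<in> carrier X" for b x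
  proof (cases j)
    case 0
    then show ?thesis
      using balanced_add_left[OF tw[of us], of a b x] * that by (simp add: rot_snoc)
  next
    case (Suc j')
    obtain vs' c where vs: "vs = vs' @ [c]" "c \<in> carrier C" "vs' \<in> cc.tuples j'"
      using *(3) unfolding Suc by (rule cc.tuples_Suc_lastE)
    have ad: "F (act c x1 # us @ (a \<oplus>\<^bsub>C\<^esub> b) # vs') x0 = F (act c x1 # us @ a # vs') x0 \<oplus>\<^bsub>A\<^esub> F (act c x1 # us @ b # vs') x0"
      if "x1 \<in> carrier B" "x0 \<in> carrier X" for x0 x1
      using cc.multibalanced_add[OF m cons[OF vs(2) that(1)] vs(3) _ *(4) \<open>b \<in> carrier C\<close> that(2)] * Suc by simp
    have sn: "us @ e # vs = (us @ e # vs') @ [c]" for e by (simp add: vs)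
    show ?thesis
      unfolding sn rot_snoc
      by (rule X.VB.bilift_fun_add[OF A X.coaction_closed[OF that(2)]])
         (use that * vs Suc in \<open>simp_all add: ad mcl tup act_closed\<close>)
  qed
  show "rot A F (us @ ract C a r # vs) x = rot A F (us @ a # cc.next_list r vs) (cc.next_coeff r vs x)"
    if r: "r \<in> carrier R" and x: "x \<in> carrier X" for r x
  proof (cases j)
    case 0
    then show ?thesis
      using balanced_middle[OF tw[of us], of a r x] * that by (simp add: rot_snoc)
  next
    case (Suc j')
    obtain vs' c where vs: "vs = vs' @ [c]" "c \<in> carrier C" "vs' \<in> cc.tuples j'"
      using *(3) unfolding Suc by (rule cc.tuples_Suc_lastE)
    have ra: "F (act c x1 # us @ ract C a r # vs') x0 = F (act c x1 # us @ a # cc.next_list r vs') (cc.next_coeff r vs' x0)"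
      if "x1 \<in> carrier B" "x0 \<in> carrier X" for x0 x1
      using cc.multibalanced_ract[OF m cons[OF vs(2) that(1)] vs(3) _ *(4) r that(2)] * Suc by simp
    have sn: "us @ e # vs = (us @ e # vs') @ [c]" for e by (simp add: vs)
    have nt: "us @ a # cc.next_list r vs' \<in> cc.tuples n"
      by (rule tup[OF *(4) cc.next_list_tuples[OF r vs(3)] Suc])
    have eq: "rot A F (us @ ract C a r # vs) x
        = bilift A (\<lambda>x0 x1. F (act c x1 # us @ a # cc.next_list r vs') (cc.next_coeff r vs' x0)) (\<rho> x)"
      unfolding sn rot_snoc
      by (rule X.VB.bilift_cong[OF A X.coaction_closed[OF x]])
         (use that * vs Suc in \<open>simp_all add: ra mcl nt act_closed cc.next_coeff_closed\<close>)
    show ?thesis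
    proof (cases vs')
      case Nil
      \<comment> \<open>After the rotation the scalar crosses from the last remaining factor to the
        coefficient, and \<open>twist_lact\<close> compares this with its left action on the rotated
        factor \<open>c\<close>.\<close>
      have us: "us @ [a] \<in> cc.tuples n" using tup[of a "[]" j'] * vs Suc Nil by simp
      show ?thesis
        using twist_lact[OF A functional_balanced[OF F us] vs(2) x r] eq rot_snoc[of A F "us @ [a]" "lact C r c" x]
        by (simp add: vs(1) Nil)
    next
      case (Cons b vs'')
      show ?thesis
        using eq rot_snoc[of A F "us @ a # lact C r b # vs''" c x] by (simp add: vs(1) Cons)
    qed
  qed
qed

lemma rot_functional:
  assumes A: "module K A" and F: "cc.cyc_functional n A F"
  shows "cc.cyc_functional n A (rot A F)"
proof (rule cc.cyc_functionalI)
  interpret A: module K A by fact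
  note AA = A.abelian_group_axioms and m = cc.cyc_functional_multibalanced[OF F]
  show "cc.multibalanced (Suc n) A (rot A F)" by (rule rot_multibalanced[OF AA F])
  show "rot A F cs (k \<odot>\<^bsub>X\<^esub> x) = k \<odot>\<^bsub>A\<^esub> rot A F cs x"
    if "cs \<in> cc.tuples (Suc n)" and k: "k \<in> carrier K" and x: "x \<in> carrier X" for cs k x
  proof -
    obtain us c where cs: "cs = us @ [c]" "c \<in> carrier C" "us \<in> cc.tuples n"
      using \<open>cs \<in> cc.tuples (Suc n)\<close> by (rule cc.tuples_Suc_lastE)
    have sm: "(\<lambda>y. k \<odot>\<^bsub>A\<^esub> y) \<in> additive_maps A A"
      by (rule additive_mapsI) (use k A.smult_r_distr in auto)
    have "rot A F cs (k \<odot>\<^bsub>X\<^esub> x) = bilift A (\<lambda>x0 x1. F (act c x1 # us) (k \<odot>\<^bsub>X\<^esub> x0)) (\<rho> x)"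
      unfolding cs(1) rot_snoc
      by (rule X.bilift_coaction_smult[OF AA balanced_act[OF functional_balanced[OF F cs(3)] cs(2)] x k])
    also have "\<dots> = bilift A (\<lambda>x0 x1. k \<odot>\<^bsub>A\<^esub> F (act c x1 # us) x0) (\<rho> x)"
      by (rule X.VB.bilift_cong[OF AA X.coaction_closed[OF x]])
         (use cs k in \<open>simp_all add: cc.cyc_functional_smult[OF F] act_closed cc.multibalanced_closed[OF m]\<close>)
    also have "\<dots> = k \<odot>\<^bsub>A\<^esub> rot A F cs x"
      unfolding cs(1) rot_snoc
      by (rule X.VB.hom_bilift[OF AA AA sm X.coaction_closed[OF x], symmetric])
         (use cs in \<open>simp add: act_closed cc.multibalanced_closed[OF m]\<close>)
    finally show ?thesis .
  qed
  show "rot A F (lact C r c # cs) x = rot A F (c # cs) (ract X x r)"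
    if c: "c \<in> carrier C" and cs: "cs \<in> cc.tuples n" and r: "r \<in> carrier R" and x: "x \<in> carrier X" for c cs r x
  \<comment> \<open>For \<open>n > 0\<close> the first factor moves to second place, so the cyclic
    relation becomes the middle relation with the new front. For \<open>n = 0\<close> one factor is
    both first and last, and the scalar travels through \<open>x0\<close> and back.\<close>
  proof (cases n)
    case 0
    then have [simp]: "cs = []" using cs by simp
    note g = functional_balanced[OF F cs]
    have "rot A F (lact C r c # cs) x = bilift A (\<lambda>x0 x1. F [act c x1] (lact X r x0)) (\<rho> x)"
      using twist_lact[OF AA g c x r] rot_snoc[of A F "[]"] by simp
    also have "\<dots> = bilift A (\<lambda>x0 x1. F [ract C (act c x1) r] x0) (\<rho> x)"
      by (rule X.VB.bilift_cong[OF AA X.coaction_closed[OF x]])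
         (use c r 0 in \<open>simp_all add: act_closed cc.multibalanced_hd_ract[OF m] cc.multibalanced_closed[OF m]
           C.ract_closed XB.lact_closed\<close>)
    also have "\<dots> = rot A F (c # cs) (ract X x r)"
      using twist_ract[OF AA g c x r] rot_snoc[of A F "[]"] by simp
    finally show ?thesis .
  next
    case (Suc n')
    obtain us l where us: "cs = us @ [l]" "l \<in> carrier C" "us \<in> cc.tuples n'"
      using cs unfolding Suc by (rule cc.tuples_Suc_lastE)
    have g: "balanced R X C A (\<lambda>x b. F (b # c # us) x)"
      by (rule functional_balanced[OF F]) (use c us Suc in simp)
    have "rot A F (lact C r c # cs) x = bilift A (\<lambda>x0 x1. F (act l x1 # lact C r c # us) x0) (\<rho> x)"
      using rot_snoc[of A F "lact C r c # us" l x] us by simp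
    also have "\<dots> = bilift A (\<lambda>x0 x1. F (ract C (act l x1) r # c # us) x0) (\<rho> x)"
      by (rule X.VB.bilift_cong[OF AA X.coaction_closed[OF x]])
         (use c r us Suc in \<open>simp_all add: act_closed cc.multibalanced_hd_ract[OF m] cc.multibalanced_closed[OF m]
           C.ract_closed C.lact_closed\<close>)
    also have "\<dots> = rot A F (c # cs) (ract X x r)"
      using twist_ract[OF AA g us(2) x r] rot_snoc[of A F "c # us" l] us by simp
    finally show ?thesis .
  qed
qed

section \<open>The operators \<open>w_n\<close> and the para-cyclic relations\<close>

definition cyc_rot :: "nat \<Rightarrow> ('c list \<times> 'x \<Rightarrow>\<^sub>0 int) set set \<Rightarrow> ('c list \<times> 'x \<Rightarrow>\<^sub>0 int) set set" where
  "cyc_rot n = cyc_lift (cc.Z n) (\<lambda>(cs, x). rot (cc.Z n) (cc.ct n) cs x)"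

lemma cyc_rot_linear: "cyc_rot n \<in> linear_maps K (cc.Z n) (cc.Z n)"
  unfolding cyc_rot_def by (rule cc.cyc_lift_linear[OF cc.cyc_module rot_functional[OF cc.cyc_module cc.ct_functional]])

lemma cyc_rot_ct:
  "\<lbrakk>cs \<in> cc.tuples (Suc n); x \<in> carrier X\<rbrakk> \<Longrightarrow> cyc_rot n (cc.ct n cs x) = rot (cc.Z n) (cc.ct n) cs x"
  unfolding cyc_rot_def by (rule cc.cyc_lift_ct[OF cc.cyc_module rot_functional[OF cc.cyc_module cc.ct_functional]])

lemma hom_cyc_rot_ct:
  assumes "abelian_group A" "h \<in> additive_maps (cc.Z n) A" "cs \<in> cc.tuples (Suc n)" "x \<in> carrier X"
    "\<And>ds y. \<lbrakk>ds \<in> cc.tuples (Suc n); y \<in> carrier X\<rbrakk> \<Longrightarrow> h (cc.ct n ds y) = F ds y"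
  shows "h (cyc_rot n (cc.ct n cs x)) = rot A F cs x"
proof -
  have "h (cyc_rot n (cc.ct n cs x)) = rot A (\<lambda>ds y. h (cc.ct n ds y)) cs x"
    unfolding cyc_rot_ct[OF assms(3,4)]
    by (rule hom_rot[OF cc.cyc_abelian_group assms(1-4) cc.ct_closed])
  also have "\<dots> = rot A F cs x"
    by (rule rot_cong[OF assms(1,3,4)]) (use assms(5) additive_maps_closed[OF assms(2) cc.ct_closed] in auto)
  finally show ?thesis .
qed

text \<open>After the rotation, the counit of the new front factor acts on \<open>u\<close>; the
  cyclic relation moves it to the right of \<open>x0\<close>, where \<open>twist_counit\<close> sums
  it up.\<close>

lemma rot_face_zero:
  assumes A: "abelian_group A" and F: "cc.cyc_functional m A F"
    and us: "us \<in> cc.tuples (Suc m)" and c: "c \<in> carrier C" and x: "x \<in> carrier X"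
  shows "rot A (\<lambda>cs x. F (cc.face_list 0 cs) (cc.face_coeff 0 cs x)) (us @ [c]) x = F us (lact X (\<epsilon>C c) x)"
proof -
  note m = cc.cyc_functional_multibalanced[OF F]
  obtain u vs where u: "us = u # vs" "u \<in> carrier C" "vs \<in> cc.tuples m" using us by (rule cc.tuples_SucE)
  note h = cc.multibalanced_additive[OF m us]
  have "rot A (\<lambda>cs x. F (cc.face_list 0 cs) (cc.face_coeff 0 cs x)) (us @ [c]) x
      = bilift A (\<lambda>x0 x1. F (lact C (\<epsilon>C (act c x1)) u # vs) x0) (\<rho> x)"
    unfolding rot_snoc by (simp add: u(1))
  also have "\<dots> = bilift A (\<lambda>x0 x1. F us (ract X x0 (\<epsilon>C (act c x1)))) (\<rho> x)"
    by (rule X.VB.bilift_cong[OF A X.coaction_closed[OF x]])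
       (use c us u in \<open>simp_all add: cc.cyc_functional_lact[OF F] C.counit_closed act_closed
         cc.multibalanced_closed[OF m] X.V.ract_closed\<close>)
  also have "\<dots> = F us (bilift X (\<lambda>x0 x1. ract X x0 (\<epsilon>C (act c x1))) (\<rho> x))"
    by (rule X.VB.hom_bilift[OF X.V.abelian_group_axioms A h X.coaction_closed[OF x], symmetric])
       (use c in \<open>simp add: X.V.ract_closed C.counit_closed act_closed\<close>)
  finally show ?thesis by (simp add: twist_counit[OF c x])
qed

lemma rot_face:
  assumes A: "abelian_group A" and F: "cc.cyc_functional m A F" and k: "k \<le> m"
    and us: "us \<in> cc.tuples (Suc m)" and c: "c \<in> carrier C" and x: "x \<in> carrier X"
  shows "rot A (\<lambda>cs x. F (cc.face_list (Suc k) cs) (cc.face_coeff (Suc k) cs x)) (us @ [c]) x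
    = rot A F (cc.face_list k (us @ [c])) (cc.face_coeff k (us @ [c]) x)"
proof -
  have len: "length us = Suc m" using us by (simp add: cc.tuples_def)
  have L: "rot A (\<lambda>cs x. F (cc.face_list (Suc k) cs) (cc.face_coeff (Suc k) cs x)) (us @ [c]) x
      = bilift A (\<lambda>x0 x1. F (act c x1 # cc.face_list k us) (cc.face_coeff k us x0)) (\<rho> x)"
    by (simp add: rot_snoc)
  let ?r = "\<epsilon>C (us ! k)"
  have r: "?r \<in> carrier R" using cc.nth_tuples[OF us] k by (simp add: C.counit_closed)
  have fl: "cc.face_list k (us @ [c]) = take k us @ cc.next_list ?r (drop (Suc k) us @ [c])"
    "cc.face_coeff k (us @ [c]) x = cc.next_coeff ?r (drop (Suc k) us @ [c]) x"
    using k len by (simp_all add: cc.face_list_def cc.face_coeff_def nth_append)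
  show ?thesis
  \<comment> \<open>The rotated factor \<open>c\<close> is affected when the erased factor stands
    directly before it: the counit then acts on \<open>c\<close> on one side and on the coefficient
    on the other, which \<open>twist_lact\<close> equates.\<close>
  proof (cases "drop (Suc k) us")
    case Nil
    then have km: "k = m" using k len by simp
    have tk: "take k us \<in> cc.tuples m" using cc.take_drop_tuples(1)[OF us, of k] km by simp
    show ?thesis
      using twist_lact[OF A functional_balanced[OF F tk] c x r]
      unfolding L fl Nil
      by (simp add: rot_snoc cc.face_list_def cc.face_coeff_def Nil)
  next
    case (Cons b vs)
    have "cc.face_list k (us @ [c]) = cc.face_list k us @ [c]"
      unfolding fl by (simp add: cc.face_list_def Cons)
    moreover have "cc.face_coeff k (us @ [c]) x = x" "\<And>y. cc.face_coeff k us y = y"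
      unfolding fl by (simp_all add: cc.face_coeff_def Cons)
    ultimately show ?thesis unfolding L by (simp add: rot_snoc)
  qed
qed

text \<open>Splitting the last factor and rotating twice brings first its second leg and then its
  first leg to the front, with iterated coactions; this is the right-hand side of
  \<open>twist_comult\<close>.\<close>

lemma rot_degen_zero:
  assumes A: "abelian_group A" and F: "cc.cyc_functional (Suc n) A F"
    and us: "us \<in> cc.tuples n" and c: "c \<in> carrier C" and x: "x \<in> carrier X"
  shows "rot A (cc.degen A 0 F) (us @ [c]) x = cc.degen A n (rot A (rot A F)) (us @ [c]) x"
proof -
  have len: "length us = n" using us by (simp add: cc.tuples_def)
  note m = cc.cyc_functional_multibalanced[OF F]
  have "tribalanced R X C C A (\<lambda>x p q. F (p # q # us) x)"
  proof (rule tribalancedI)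
    show "balanced R C C A (\<lambda>p q. F (p # q # us) x)" if "x \<in> carrier X" for x
      by (rule cc.multibalanced_pair[OF m us that])
    show "balanced R X C A (\<lambda>x p. F (p # q # us) x)" if "q \<in> carrier C" for q
      by (rule functional_balanced[OF F]) (use that us in simp)
  qed
  from twist_comult[OF A this c x] show ?thesis
    by (simp add: rot_def cc.degen_def len butlast_append nth_append)
qed

text \<open>The coaction of \<open>x\<close> and the comultiplication of a factor other than the
  rotated one are independent finite sums.\<close>

lemma rot_degen:
  assumes A: "abelian_group A" and F: "cc.multibalanced (Suc (Suc n)) A F" and k: "k < n"
    and us: "us \<in> cc.tuples n" and c: "c \<in> carrier C" and x: "x \<in> carrier X"
  shows "rot A (cc.degen A (Suc k) F) (us @ [c]) x = cc.degen A k (rot A F) (us @ [c]) x"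
proof -
  have len: "length us = n" using us by (simp add: cc.tuples_def)
  have "rot A (cc.degen A (Suc k) F) (us @ [c]) x = bilift A (\<lambda>x0 x1.
      bilift A (\<lambda>a b. F (act c x1 # take k us @ a # b # drop (Suc k) us) x0) (\<Delta>C (us ! k))) (\<rho> x)"
    by (simp add: rot_def cc.degen_def)
  also have "\<dots> = bilift A (\<lambda>a b. bilift A (\<lambda>x0 x1.
      F (act c x1 # take k us @ a # b # drop (Suc k) us) x0) (\<rho> x)) (\<Delta>C (us ! k))"
    by (rule bilift_swap[OF X.VB.tensor_product_axioms C.CC.tensor_product_axioms A
          X.coaction_closed[OF x] cc.comult_nth_closed[OF us k]])
       (use c cc.insert_tuples[OF us k] in \<open>simp add: cc.multibalanced_closed[OF F] act_closed\<close>)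
  also have "\<dots> = cc.degen A k (rot A F) (us @ [c]) x"
    using k by (simp add: cc.degen_def rot_def nth_append len butlast_append)
  finally show ?thesis .
qed

theorem para_cyclic: "para_cyclic_structure K cc.Z cc.d cc.s cyc_rot"
proof (intro para_cyclic_structure.intro para_cyclic_structure_axioms.intro cc.simplicial cyc_rot_linear)
  note ext = cc.cyc_ext[OF cc.cyc_abelian_group]
  note da = linear_maps_additive[OF cc.face_linear] and sa = linear_maps_additive[OF cc.degeneracy_linear]
    and wa = linear_maps_additive[OF cyc_rot_linear]
  note comp = additive_maps_comp and AG = cc.cyc_abelian_group and ctf = cc.ct_functional
  note m = cc.cyc_functional_multibalanced[OF ctf]
  show "cc.d n 0 (cyc_rot n z) = cc.d n n z" if "n \<ge> 1" "z \<in> carrier (cc.Z n)" for n z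
  proof -
    from that(1) obtain l where n: "n = Suc l" by (cases n) auto
    show ?thesis
      unfolding n
    proof (rule ext[OF comp[OF wa da] da _ that(2)[unfolded n]])
      fix cs x assume cs: "cs \<in> cc.tuples (Suc (Suc l))" and x: "x \<in> carrier X"
      obtain us c where us: "cs = us @ [c]" "c \<in> carrier C" "us \<in> cc.tuples (Suc l)"
        using cs by (rule cc.tuples_Suc_lastE)
      have len: "length us = Suc l" using us(3) by (simp add: cc.tuples_def)
      have "cc.d (Suc l) 0 (cyc_rot (Suc l) (cc.ct (Suc l) cs x))
          = rot (cc.Z l) (\<lambda>cs x. cc.ct l (cc.face_list 0 cs) (cc.face_coeff 0 cs x)) cs x"
        by (rule hom_cyc_rot_ct[OF AG da cs x cc.face_ct]) auto
      also have "\<dots> = cc.ct l us (lact X (\<epsilon>C c) x)"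
        unfolding us(1) by (rule rot_face_zero[OF AG ctf us(3,2) x])
      also have "\<dots> = cc.d (Suc l) (Suc l) (cc.ct (Suc l) cs x)"
        using cs x len by (simp add: cc.face_ct us(1) cc.face_list_def cc.face_coeff_def nth_append)
      finally show "cc.d (Suc l) 0 (cyc_rot (Suc l) (cc.ct (Suc l) cs x)) = cc.d (Suc l) (Suc l) (cc.ct (Suc l) cs x)" .
    qed auto
  qed
  show "cc.d n k (cyc_rot n z) = cyc_rot (n - 1) (cc.d n (k - 1) z)"
    if "1 \<le> k" "k \<le> n" "z \<in> carrier (cc.Z n)" for n k z
  proof -
    from that obtain l j where n: "n = Suc l" "k = Suc j" by (cases n; cases k) auto
    have j: "j \<le> l" "j \<le> Suc l" "Suc j \<le> Suc l" using that n by auto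
    show ?thesis
      unfolding n diff_Suc_1
    proof (rule ext[OF comp[OF wa da] comp[OF da wa] _ that(3)[unfolded n]])
      fix cs x assume cs: "cs \<in> cc.tuples (Suc (Suc l))" and x: "x \<in> carrier X"
      obtain us c where us: "cs = us @ [c]" "c \<in> carrier C" "us \<in> cc.tuples (Suc l)"
        using cs by (rule cc.tuples_Suc_lastE)
      have "cc.d (Suc l) (Suc j) (cyc_rot (Suc l) (cc.ct (Suc l) cs x))
          = rot (cc.Z l) (\<lambda>cs x. cc.ct l (cc.face_list (Suc j) cs) (cc.face_coeff (Suc j) cs x)) cs x"
        by (rule hom_cyc_rot_ct[OF AG da[OF j(3)] cs x cc.face_ct[OF j(3)]])
      also have "\<dots> = rot (cc.Z l) (cc.ct l) (cc.face_list j cs) (cc.face_coeff j cs x)"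
        unfolding us(1) by (rule rot_face[OF AG ctf j(1) us(3,2) x])
      also have "\<dots> = cyc_rot l (cc.d (Suc l) j (cc.ct (Suc l) cs x))"
        using cs x j by (simp add: cc.face_ct cyc_rot_ct cc.face_list_tuples cc.face_coeff_closed)
      finally show "cc.d (Suc l) (Suc j) (cyc_rot (Suc l) (cc.ct (Suc l) cs x))
          = cyc_rot l (cc.d (Suc l) j (cc.ct (Suc l) cs x))" .
    qed (use j in auto)
  qed
  show "cc.s n 0 (cyc_rot n z) = cyc_rot (Suc n) (cyc_rot (Suc n) (cc.s n n z))" if "z \<in> carrier (cc.Z n)" for n z
  proof (rule ext[OF comp[OF wa sa] comp[OF comp[OF sa wa] wa] _ that])
    fix cs x assume cs: "cs \<in> cc.tuples (Suc n)" and x: "x \<in> carrier X"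
    obtain us c where us: "cs = us @ [c]" "c \<in> carrier C" "us \<in> cc.tuples n"
      using cs by (rule cc.tuples_Suc_lastE)
    let ?Z = "cc.Z (Suc n)" and ?F = "cc.ct (Suc n)"
    have "cc.s n 0 (cyc_rot n (cc.ct n cs x)) = rot ?Z (cc.degen ?Z 0 ?F) cs x"
      by (rule hom_cyc_rot_ct[OF AG sa cs x cc.degeneracy_ct]) auto
    also have "\<dots> = cc.degen ?Z n (rot ?Z (rot ?Z ?F)) cs x"
      unfolding us(1) by (rule rot_degen_zero[OF AG ctf us(3,2) x])
    also have "\<dots> = cyc_rot (Suc n) (cyc_rot (Suc n) (cc.s n n (cc.ct n cs x)))"
    proof (rule cc.hom_degeneracy_ct[OF AG comp[OF wa wa] order_refl cs x, symmetric])
      show "cyc_rot (Suc n) (cyc_rot (Suc n) (?F cs x)) = rot ?Z (rot ?Z ?F) cs x"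
        if "cs \<in> cc.tuples (Suc (Suc n))" for cs
        by (rule hom_cyc_rot_ct[OF AG wa that x cyc_rot_ct])
    qed
    finally show "cc.s n 0 (cyc_rot n (cc.ct n cs x)) = cyc_rot (Suc n) (cyc_rot (Suc n) (cc.s n n (cc.ct n cs x)))" .
  qed auto
  show "cc.s n k (cyc_rot n z) = cyc_rot (Suc n) (cc.s n (k - 1) z)"
    if "1 \<le> k" "k \<le> n" "z \<in> carrier (cc.Z n)" for n k z
  proof -
    from that obtain j where k: "k = Suc j" by (cases k) auto
    have j: "j < n" "j \<le> n" "Suc j \<le> n" using that k by auto
    show ?thesis
      unfolding k diff_Suc_1
    proof (rule ext[OF comp[OF wa sa] comp[OF sa wa] _ that(3)])
      fix cs x assume cs: "cs \<in> cc.tuples (Suc n)" and x: "x \<in> carrier X"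
      obtain us c where us: "cs = us @ [c]" "c \<in> carrier C" "us \<in> cc.tuples n"
        using cs by (rule cc.tuples_Suc_lastE)
      let ?Z = "cc.Z (Suc n)" and ?F = "cc.ct (Suc n)"
      have "cc.s n (Suc j) (cyc_rot n (cc.ct n cs x)) = rot ?Z (cc.degen ?Z (Suc j) ?F) cs x"
        by (rule hom_cyc_rot_ct[OF AG sa[OF j(3)] cs x cc.degeneracy_ct[OF j(3)]])
      also have "\<dots> = cc.degen ?Z j (rot ?Z ?F) cs x"
        unfolding us(1) by (rule rot_degen[OF AG m j(1) us(3,2) x])
      also have "\<dots> = cyc_rot (Suc n) (cc.s n j (cc.ct n cs x))"
        by (rule cc.hom_degeneracy_ct[OF AG wa j(2) cs x, symmetric]) (rule cyc_rot_ct[OF _ x])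
      finally show "cc.s n (Suc j) (cyc_rot n (cc.ct n cs x)) = cyc_rot (Suc n) (cc.s n j (cc.ct n cs x))" .
    qed (use j in auto)
  qed
qed

end

theorem theorem2p11:
  fixes K :: "'k ring" and R :: "('k, 'r) module" and B :: "('k, 'b) module"
    and \<xi> \<zeta> :: "'r \<Rightarrow> 'b"
    and \<Delta> :: "'b \<Rightarrow> ('b \<times> 'b \<Rightarrow>\<^sub>0 int) set" and \<epsilon> :: "'b \<Rightarrow> 'r"
    and C :: "('k, 'r, 'c) bimod"
    and \<Delta>C :: "'c \<Rightarrow> ('c \<times> 'c \<Rightarrow>\<^sub>0 int) set" and \<epsilon>C :: "'c \<Rightarrow> 'r"
    and act :: "'c \<Rightarrow> 'b \<Rightarrow> 'c"
    and X :: "('k, 'r, 'x) bimod" and \<rho> :: "'x \<Rightarrow> ('x \<times> 'b \<Rightarrow>\<^sub>0 int) set"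
  assumes "right_bialgebroid K R B \<xi> \<zeta> \<Delta> \<epsilon>"
    and "module_coring K R B \<xi> \<zeta> \<Delta> \<epsilon> C \<Delta>C \<epsilon>C act"
    and "right_comodule K R B \<xi> \<zeta> \<Delta> \<epsilon> X \<rho>"
  shows "(\<exists>w. (\<forall>c\<in>carrier C. \<forall>x\<in>carrier X.
              w (tens R C X c x) =
              pres_lift (tensor R X C) (\<lambda>(x0, x1). tens R X C x0 (act c x1)) (\<rho> x)) \<and>
            dual_transposition K R C \<Delta>C \<epsilon>C X w) \<and>
         (\<exists>w. (\<forall>n cs x. length cs = Suc n \<and> set cs \<subseteq> carrier C \<and> x \<in> carrier X \<longrightarrow>
              w n (cyc_tens K R C X n cs x) =
              pres_lift (cyc K R C X n)
                (\<lambda>(x0, x1). cyc_tens K R C X n (act (last cs) x1 # butlast cs) x0) (\<rho> x)) \<and>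
            para_cyclic_structure K (cyc K R C X)
              (cyc_face K R C \<epsilon>C X) (cyc_degeneracy K R C \<Delta>C X) w)"
proof -
  interpret module_coring_comodule K R B \<xi> \<zeta> \<Delta> \<epsilon> C \<Delta>C \<epsilon>C act X \<rho>
    using assms by (intro module_coring_comodule.intro)
  show ?thesis
  proof (intro conjI exI)
    show "\<forall>c\<in>carrier C. \<forall>x\<in>carrier X. transposition (tens R C X c x) =
        pres_lift (tensor R X C) (\<lambda>(x0, x1). tens R X C x0 (act c x1)) (\<rho> x)"
      using transposition_tens by simp
    show "\<forall>n cs x. length cs = Suc n \<and> set cs \<subseteq> carrier C \<and> x \<in> carrier X \<longrightarrow>
        cyc_rot n (cyc_tens K R C X n cs x) =
        pres_lift (cyc K R C X n) (\<lambda>(x0, x1). cyc_tens K R C X n (act (last cs) x1 # butlast cs) x0) (\<rho> x)"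
      by (simp add: cyc_rot_ct cc.tuples_def rot_def)
  qed (fact dual_transposition para_cyclic)+
qed

end
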